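(* Let $M$ be a smooth 4-manifold with a perfect triple $\Sigma^1,\Sigma^2,\Sigma^3$ of closed 2-forms ($d\Sigma^i=0$). Then the sequence $$TM \xrightarrow{\;d_1\;} S \xrightarrow{\;d_2\;} E\otimes\Lambda^1 \xrightarrow{\;d_3\;} E$$ (the Plebański complex, with bundles and first-order operators as defined in the context) is an elliptic complex of differential operators. That is, $d_2 d_1=0$, $d_3 d_2=0$, and for every point $x\in M$ and every nonzero covector $k\in T_x^*M$ the sequence of principal symbols $$0\to T_xM \xrightarrow{\sigma(d_1)(k)} S_x \xrightarrow{\sigma(d_2)(k)} E\otimes\Lambda^1_x \xrightarrow{\sigma(d_3)(k)} E\to 0$$ is exact.
   Context: Conventions. $E=\mathbb{R}^3$ (trivial bundle), with indices $i,j,k\in\{1,2,3\}$, Kronecker $\delta^{ij}$ and Levi-Civita symbol $\epsilon^{ijk}$; repeated indices are summed. $\Lambda^p$ denotes the bundle of $p$-forms on $M$. Differential operators act on smooth sections, and spaces of sections are denoted by the same letters as the bundles. Perfect triple. A triple of 2-forms $\Sigma^i$ with $\Sigma^i\wedge\Sigma^j = 2\delta^{ij}v_\Sigma$, where $v_\Sigma=\tfrac16\Sigma^k\wedge\Sigma^k$ is nowhere vanishing. $M$ is oriented by $v_\Sigma$. The triple determines a Riemannian metric $g$ with volume form $v_\Sigma$, for which the $\Sigma^i$ are self-dual and, raising indices with $g$, satisfy the quaternion algebra $$\Sigma^i_\mu{}^\alpha\Sigma^j_\alpha{}^\nu=-\delta^{ij}\delta_\mu{}^\nu+\epsilon^{ijk}\Sigma^k_\mu{}^\nu$$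 (the order and overall sign of the triple are taken so that this holds with $g$ positive definite). Index raising, $\nabla$ (Levi-Civita) and the volume tensor $\epsilon_{\mu\nu\rho\sigma}$ refer to $g$. The bundle $S$. $S\subset E\otimes\Lambda^2$ is the rank 13 bundle tangent to the space of perfect triples at $\Sigma$, i.e. $S=\{\,h_{[\mu}{}^\alpha\Sigma^i_{|\alpha|\nu]} : h_{\mu\nu} \text{ an arbitrary } 4\times4 \text{ tensor}\,\}$. The operator $J_1$. $J_1: E\otimes\Lambda^1\to E\otimes\Lambda^1$, $J_1(a)^i_\mu=\epsilon^{ijk}\Sigma^j_\mu{}^\alpha a^k_\alpha$. It satisfies $J_1^2=2\,\mathbb{I}+J_1$, so it is invertible. The operators. - $d_1:TM\to S$, $(d_1\xi)^i=d(\xi\lrcorner\Sigma^i)$. - $d_2:S\to E\otimes\Lambda^1$, $d_2\sigma=\tfrac12J_1^{-1}(\star d\sigma)$, with the convention $(\star d\sigma)^i_\mu=\epsilon_\mu{}^{\alpha\beta\gamma}\nabla_\alpha\sigma^i_{\beta\gamma}$. Equivalently, $a=d_2\sigma$ is the unique solution of $d\sigma^i+\epsilon^{ijk}a^j\wedge\Sigma^k=0$. - $d_3:E\otimes\Lambda^1\to E$, $(d_3a)^i=\epsilon^{ijk}\,\Sigma^j\wedge da^k/v_\Sigma$. *)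

theory Defs
  imports "HOL-Analysis.Analysis"
begin

section \<open>Smooth 4-manifolds\<close>

primrec Ck_on :: "nat \<Rightarrow> 'a::euclidean_space set \<Rightarrow> ('a \<Rightarrow> 'b::real_normed_vector) \<Rightarrow> bool" where
  "Ck_on 0 U f = continuous_on U f"
| "Ck_on (Suc n) U f =
    (f differentiable_on U \<and> (\<forall>e\<in>Basis. Ck_on n U (\<lambda>y. frechet_derivative f (at y) e)))"

text \<open>Only used for open sets.\<close>

definition smooth_on :: "'a::euclidean_space set \<Rightarrow> ('a \<Rightarrow> 'b::real_normed_vector) \<Rightarrow> bool" where
  "smooth_on U f \<longleftrightarrow> (\<forall>n. Ck_on n U f)"

text \<open>A chart is a domain together with a coordinate map, which is only relevant on the domain.
  The manifold is the whole type \<open>'m\<close>.\<close>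

type_synonym 'm chart = "'m set \<times> ('m \<Rightarrow> real^4)"

abbreviation dom_of :: "'m chart \<Rightarrow> 'm set" where "dom_of c \<equiv> fst c"
abbreviation coord :: "'m chart \<Rightarrow> 'm \<Rightarrow> real^4" where "coord c \<equiv> snd c"

definition chart_inv :: "'m chart \<Rightarrow> real^4 \<Rightarrow> 'm" where
  "chart_inv c = inv_into (dom_of c) (coord c)"

definition smooth_atlas :: "'m::topological_space chart set \<Rightarrow> bool" where
  "smooth_atlas A \<longleftrightarrow>
    (\<Union>c\<in>A. dom_of c) = UNIV \<and>
    (\<forall>c\<in>A. open (dom_of c) \<and> open (coord c ` dom_of c) \<and>
      homeomorphism (dom_of c) (coord c ` dom_of c) (coord c) (chart_inv c)) \<and>
    (\<forall>c\<in>A. \<forall>c'\<in>A. smooth_on (coord c ` (dom_of c \<inter> dom_of c')) (coord c' \<circ> chart_inv c))"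

definition charts_at :: "'m chart set \<Rightarrow> 'm \<Rightarrow> 'm chart set" where
  "charts_at A x = {c \<in> A. x \<in> dom_of c}"

text \<open>\<open>jac c c' x $ \<alpha> $ \<mu>\<close> is the derivative of the \<open>\<alpha>\<close>-th coordinate of \<open>c'\<close> with respect to
  the \<open>\<mu>\<close>-th coordinate of \<open>c\<close>.\<close>

definition jac :: "'m chart \<Rightarrow> 'm chart \<Rightarrow> 'm \<Rightarrow> real^4^4" where
  "jac c c' x = matrix (frechet_derivative (coord c' \<circ> chart_inv c) (at (coord c x)))"

definition pd :: "'m chart \<Rightarrow> 4 \<Rightarrow> ('m \<Rightarrow> 'b::real_normed_vector) \<Rightarrow> 'm \<Rightarrow> 'b" where
  "pd c \<mu> f x = frechet_derivative (f \<circ> chart_inv c) (at (coord c x)) (axis \<mu> 1)"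


section \<open>Tensor bundles and sections\<close>

text \<open>An element of a tensor bundle at \<open>x\<close> is the family of its components in all the charts
  around \<open>x\<close>, subject to the transformation law \<open>\<rho>\<close> of the bundle, and set to zero for
  all other arguments (so that equality of tensors is equality of functions).\<close>

definition tensor_fibre ::
  "(real^4^4 \<Rightarrow> 'v \<Rightarrow> 'v) \<Rightarrow> 'm chart set \<Rightarrow> 'm \<Rightarrow> ('m chart \<Rightarrow> 'v::zero) set" where
  "tensor_fibre \<rho> A x =
    {t. (\<forall>c\<in>charts_at A x. \<forall>c'\<in>charts_at A x. t c = \<rho> (jac c c' x) (t c')) \<and>
        (\<forall>c. c \<notin> charts_at A x \<longrightarrow> t c = 0)}"

definition TM :: "'m chart set \<Rightarrow> 'm \<Rightarrow> ('m chart \<Rightarrow> real^4) set" where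
  "TM = tensor_fibre (\<lambda>J v. matrix_inv J *v v)"

definition T_dual :: "'m chart set \<Rightarrow> 'm \<Rightarrow> ('m chart \<Rightarrow> real^4) set" where
  "T_dual = tensor_fibre (\<lambda>J k. transpose J *v k)"

definition T2_dual :: "'m chart set \<Rightarrow> 'm \<Rightarrow> ('m chart \<Rightarrow> real^4^4) set" where
  "T2_dual = tensor_fibre (\<lambda>J t. transpose J ** t ** J)"

text \<open>The trivial bundle with fibre \<open>real^3\<close>: the components are the same in all charts.\<close>

definition E_bundle :: "'m chart set \<Rightarrow> 'm \<Rightarrow> ('m chart \<Rightarrow> real^3) set" where
  "E_bundle = tensor_fibre (\<lambda>J e. e)"

text \<open>Components of elements of \<open>E \<otimes> \<Lambda>\<^sup>1\<close> are written \<open>a c $ i $ \<mu>\<close>, those of elements of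
  \<open>E \<otimes> \<Lambda>\<^sup>2\<close> are written \<open>\<sigma> c $ i $ \<mu> $ \<nu>\<close>.\<close>

definition E1_bundle :: "'m chart set \<Rightarrow> 'm \<Rightarrow> ('m chart \<Rightarrow> real^4^3) set" where
  "E1_bundle = tensor_fibre (\<lambda>J a. \<chi> i. transpose J *v (a $ i))"

definition E2_bundle :: "'m chart set \<Rightarrow> 'm \<Rightarrow> ('m chart \<Rightarrow> real^4^4^3) set" where
  "E2_bundle A x =
    {\<sigma> \<in> tensor_fibre (\<lambda>J s. \<chi> i. transpose J ** (s $ i) ** J) A x.
      \<forall>c i. transpose (\<sigma> c $ i) = - (\<sigma> c $ i)}"

definition smooth_fun :: "'m chart set \<Rightarrow> 'm set \<Rightarrow> ('m \<Rightarrow> real) \<Rightarrow> bool" where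
  "smooth_fun A U f \<longleftrightarrow> (\<forall>c\<in>A. smooth_on (coord c ` (dom_of c \<inter> U)) (f \<circ> chart_inv c))"

text \<open>Smooth sections over an open set \<open>U\<close>; the values outside \<open>U\<close> are irrelevant.\<close>

definition sections ::
  "'m chart set \<Rightarrow> ('m \<Rightarrow> ('m chart \<Rightarrow> 'v) set) \<Rightarrow> 'm set \<Rightarrow>
   ('m \<Rightarrow> 'm chart \<Rightarrow> 'v::real_normed_vector) set" where
  "sections A F U =
    {s. (\<forall>x\<in>U. s x \<in> F x) \<and>
        (\<forall>c\<in>A. smooth_on (coord c ` (dom_of c \<inter> U)) ((\<lambda>x. s x c) \<circ> chart_inv c))}"

definition differential :: "'m chart set \<Rightarrow> ('m \<Rightarrow> real) \<Rightarrow> 'm \<Rightarrow> 'm chart \<Rightarrow> real^4" where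
  "differential A f x c = (if c \<in> charts_at A x then \<chi> \<mu>. pd c \<mu> f x else 0)"


section \<open>First-order differential operators and principal symbols\<close>

definition first_order_operator ::
  "'m::topological_space chart set \<Rightarrow>
   ('m \<Rightarrow> ('m chart \<Rightarrow> 'v::real_normed_vector) set) \<Rightarrow>
   ('m \<Rightarrow> ('m chart \<Rightarrow> 'w::real_normed_vector) set) \<Rightarrow>
   (('m \<Rightarrow> 'm chart \<Rightarrow> 'v) \<Rightarrow> ('m \<Rightarrow> 'm chart \<Rightarrow> 'w)) \<Rightarrow> bool" where
  "first_order_operator A F G D \<longleftrightarrow>
    (\<forall>U s. open U \<and> s \<in> sections A F U \<longrightarrow> D s \<in> sections A G U) \<and>
    (\<forall>c\<in>A. \<exists>(a :: 4 \<Rightarrow> 'm \<Rightarrow> 'v \<Rightarrow> 'w) (b :: 'm \<Rightarrow> 'v \<Rightarrow> 'w).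
      (\<forall>x\<in>dom_of c. (\<forall>\<mu>. linear (a \<mu> x)) \<and> linear (b x)) \<and>
      (\<forall>v. (\<forall>\<mu>. smooth_on (coord c ` dom_of c) ((\<lambda>x. a \<mu> x v) \<circ> chart_inv c)) \<and>
           smooth_on (coord c ` dom_of c) ((\<lambda>x. b x v) \<circ> chart_inv c)) \<and>
      (\<forall>U s x. open U \<and> s \<in> sections A F U \<and> x \<in> U \<inter> dom_of c \<longrightarrow>
        D s x c = (\<Sum>\<mu>\<in>UNIV. a \<mu> x (pd c \<mu> (\<lambda>y. s y c) x)) + b x (s x c)))"

text \<open>The principal symbol of a first-order operator \<open>D\<close> at \<open>x\<close> in the direction of the covector
  \<open>k\<close> maps \<open>v\<close> to \<open>D (f s) (x)\<close> for any local function \<open>f\<close> with \<open>f x = 0\<close>, \<open>df (x) = k\<close>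
  and any local section \<open>s\<close> with \<open>s x = v\<close>.\<close>

definition principal_symbol ::
  "'m::topological_space chart set \<Rightarrow>
   ('m \<Rightarrow> ('m chart \<Rightarrow> 'v::real_normed_vector) set) \<Rightarrow>
   (('m \<Rightarrow> 'm chart \<Rightarrow> 'v) \<Rightarrow> ('m \<Rightarrow> 'm chart \<Rightarrow> 'w)) \<Rightarrow>
   'm \<Rightarrow> ('m chart \<Rightarrow> real^4) \<Rightarrow> ('m chart \<Rightarrow> 'v) \<Rightarrow> ('m chart \<Rightarrow> 'w)" where
  "principal_symbol A F D x k v =
    (THE w. \<forall>U f s. open U \<and> x \<in> U \<and> smooth_fun A U f \<and> f x = 0 \<and> differential A f x = k \<and>
       s \<in> sections A F U \<and> s x = v \<longrightarrow> D (\<lambda>y c. f y *\<^sub>R s y c) x = w)"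


section \<open>Perfect triples\<close>

definition kronecker :: "'i \<Rightarrow> 'i \<Rightarrow> real" where
  "kronecker i j = (if i = j then 1 else 0)"

definition eps :: "3 \<Rightarrow> 3 \<Rightarrow> 3 \<Rightarrow> real" where
  "eps i j k =
    (if (i, j, k) \<in> {(1, 2, 3), (2, 3, 1), (3, 1, 2)} then 1
     else if (i, j, k) \<in> {(1, 3, 2), (3, 2, 1), (2, 1, 3)} then -1 else 0)"

text \<open>Components of the wedge product of two 2-forms.\<close>

definition wedge22 :: "real^4^4 \<Rightarrow> real^4^4 \<Rightarrow> 4 \<Rightarrow> 4 \<Rightarrow> 4 \<Rightarrow> 4 \<Rightarrow> real" where
  "wedge22 \<alpha> \<beta> \<mu> \<nu> \<rho> \<tau> =
     \<alpha>$\<mu>$\<nu> * \<beta>$\<rho>$\<tau> - \<alpha>$\<mu>$\<rho> * \<beta>$\<nu>$\<tau> + \<alpha>$\<mu>$\<tau> * \<beta>$\<nu>$\<rho>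
   + \<alpha>$\<nu>$\<rho> * \<beta>$\<mu>$\<tau> - \<alpha>$\<nu>$\<tau> * \<beta>$\<mu>$\<rho> + \<alpha>$\<rho>$\<tau> * \<beta>$\<mu>$\<nu>"

definition vol :: "real^4^4^3 \<Rightarrow> 4 \<Rightarrow> 4 \<Rightarrow> 4 \<Rightarrow> 4 \<Rightarrow> real" where
  "vol S \<mu> \<nu> \<rho> \<tau> = (1/6) * (\<Sum>k\<in>UNIV. wedge22 (S$k) (S$k) \<mu> \<nu> \<rho> \<tau>)"

definition perfect_triple :: "'m chart set \<Rightarrow> ('m \<Rightarrow> 'm chart \<Rightarrow> real^4^4^3) \<Rightarrow> bool" where
  "perfect_triple A \<Sigma> \<longleftrightarrow>
    \<Sigma> \<in> sections A (E2_bundle A) UNIV \<and>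
    (\<forall>x. \<forall>c\<in>charts_at A x.
      (\<forall>i j \<mu> \<nu> \<rho> \<tau>. wedge22 (\<Sigma> x c $ i) (\<Sigma> x c $ j) \<mu> \<nu> \<rho> \<tau> =
         2 * kronecker i j * vol (\<Sigma> x c) \<mu> \<nu> \<rho> \<tau>) \<and>
      (\<exists>\<mu> \<nu> \<rho> \<tau>. vol (\<Sigma> x c) \<mu> \<nu> \<rho> \<tau> \<noteq> 0))"

definition closed_triple :: "'m chart set \<Rightarrow> ('m \<Rightarrow> 'm chart \<Rightarrow> real^4^4^3) \<Rightarrow> bool" where
  "closed_triple A \<Sigma> \<longleftrightarrow>
    (\<forall>x. \<forall>c\<in>charts_at A x. \<forall>i \<mu> \<nu> \<rho>.
      pd c \<mu> (\<lambda>y. \<Sigma> y c $ i $ \<nu> $ \<rho>) x + pd c \<nu> (\<lambda>y. \<Sigma> y c $ i $ \<rho> $ \<mu>) x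
        + pd c \<rho> (\<lambda>y. \<Sigma> y c $ i $ \<mu> $ \<nu>) x = 0)"

definition riemannian_metric :: "'m chart set \<Rightarrow> ('m \<Rightarrow> 'm chart \<Rightarrow> real^4^4) \<Rightarrow> bool" where
  "riemannian_metric A g \<longleftrightarrow>
    g \<in> sections A (T2_dual A) UNIV \<and>
    (\<forall>x. \<forall>c\<in>charts_at A x. transpose (g x c) = g x c \<and>
      (\<forall>u. u \<noteq> 0 \<longrightarrow> u \<bullet> (g x c *v u) > 0))"

text \<open>\<open>raised S G i $ \<mu> $ \<nu>\<close> is the component with lower index \<open>\<mu>\<close> and upper index \<open>\<nu>\<close> of the
  \<open>i\<close>-th 2-form of the triple \<open>S\<close>.\<close>

definition raised :: "real^4^4^3 \<Rightarrow> real^4^4 \<Rightarrow> 3 \<Rightarrow> real^4^4" where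
  "raised S G i = (S $ i) ** matrix_inv G"

text \<open>The Riemannian metric determined by a perfect triple. The conditions determine \<open>g\<close> (already
  the quaternion algebra forces \<open>g = \<Sigma>\<^sup>2 (\<Sigma>\<^sup>3)\<inverse> \<Sigma>\<^sup>1\<close>); its existence fixes the order and
  the overall sign of the triple. The volume form of \<open>g\<close> is taken for the orientation given by
  the volume form of the triple. In dimension four a 4-form is given by its component
  1234, and \<open>4 = 0\<close> in the index type.\<close>

definition triple_metric ::
  "'m chart set \<Rightarrow> ('m \<Rightarrow> 'm chart \<Rightarrow> real^4^4^3) \<Rightarrow> ('m \<Rightarrow> 'm chart \<Rightarrow> real^4^4) \<Rightarrow> bool" where
  "triple_metric A \<Sigma> g \<longleftrightarrow>
    riemannian_metric A g \<and>
    (\<forall>x. \<forall>c\<in>charts_at A x.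
      vol (\<Sigma> x c) 1 2 3 4 = sgn (vol (\<Sigma> x c) 1 2 3 4) * sqrt (det (g x c)) \<and>
      (\<forall>i \<mu> \<nu>. \<Sigma> x c $ i $ \<mu> $ \<nu> =
        (1/2) * (\<Sum>\<alpha>\<in>UNIV. \<Sum>\<beta>\<in>UNIV. \<Sum>\<rho>\<in>UNIV. \<Sum>\<tau>\<in>UNIV.
          vol (\<Sigma> x c) \<mu> \<nu> \<alpha> \<beta> * matrix_inv (g x c) $ \<alpha> $ \<rho> * matrix_inv (g x c) $ \<beta> $ \<tau> *
          \<Sigma> x c $ i $ \<rho> $ \<tau>)) \<and>
      (\<forall>i j. raised (\<Sigma> x c) (g x c) i ** raised (\<Sigma> x c) (g x c) j =
        - kronecker i j *\<^sub>R mat 1 + (\<Sum>k\<in>UNIV. eps i j k *\<^sub>R raised (\<Sigma> x c) (g x c) k)))"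


section \<open>The operators of the complex\<close>

text \<open>The \<open>i\<close>-th 2-form of the element of \<open>S\<close> given by \<open>h\<close> is the antisymmetric part (with the
  factor 1/2) of the matrix product of \<open>h\<close>, the inverse metric and \<open>\<Sigma>\<^sup>i\<close>.\<close>

definition S_bundle ::
  "'m chart set \<Rightarrow> ('m \<Rightarrow> 'm chart \<Rightarrow> real^4^4^3) \<Rightarrow> ('m \<Rightarrow> 'm chart \<Rightarrow> real^4^4) \<Rightarrow>
   'm \<Rightarrow> ('m chart \<Rightarrow> real^4^4^3) set" where
  "S_bundle A \<Sigma> g x =
    {\<sigma> \<in> E2_bundle A x. \<exists>h \<in> T2_dual A x. \<forall>c\<in>charts_at A x. \<forall>i \<mu> \<nu>.
      \<sigma> c $ i $ \<mu> $ \<nu> = (1/2) *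
        ((h c ** matrix_inv (g x c) ** (\<Sigma> x c $ i)) $ \<mu> $ \<nu>
         - (h c ** matrix_inv (g x c) ** (\<Sigma> x c $ i)) $ \<nu> $ \<mu>)}"

text \<open>The exterior derivative of \<open>E\<close>-valued 1-forms.\<close>

definition ext_d ::
  "'m chart set \<Rightarrow> ('m \<Rightarrow> 'm chart \<Rightarrow> real^4^3) \<Rightarrow> ('m \<Rightarrow> 'm chart \<Rightarrow> real^4^4^3)" where
  "ext_d A a x c =
    (if c \<in> charts_at A x
     then \<chi> i \<mu> \<nu>. pd c \<mu> (\<lambda>y. a y c $ i $ \<nu>) x - pd c \<nu> (\<lambda>y. a y c $ i $ \<mu>) x
     else 0)"

definition interior_product ::
  "('m \<Rightarrow> 'm chart \<Rightarrow> real^4) \<Rightarrow> ('m \<Rightarrow> 'm chart \<Rightarrow> real^4^4^3) \<Rightarrow>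
   ('m \<Rightarrow> 'm chart \<Rightarrow> real^4^3)" where
  "interior_product \<xi> \<Sigma> x c = (\<chi> i \<nu>. \<Sum>\<mu>\<in>UNIV. \<xi> x c $ \<mu> * \<Sigma> x c $ i $ \<mu> $ \<nu>)"

definition d1 ::
  "'m chart set \<Rightarrow> ('m \<Rightarrow> 'm chart \<Rightarrow> real^4^4^3) \<Rightarrow>
   ('m \<Rightarrow> 'm chart \<Rightarrow> real^4) \<Rightarrow> ('m \<Rightarrow> 'm chart \<Rightarrow> real^4^4^3)" where
  "d1 A \<Sigma> \<xi> = ext_d A (interior_product \<xi> \<Sigma>)"

definition J1 :: "real^4^4^3 \<Rightarrow> real^4^4 \<Rightarrow> real^4^3 \<Rightarrow> real^4^3" where
  "J1 S G a =
    (\<chi> i \<mu>. \<Sum>j\<in>UNIV. \<Sum>k\<in>UNIV. \<Sum>\<alpha>\<in>UNIV. eps i j k * raised S G j $ \<mu> $ \<alpha> * a $ k $ \<alpha>)"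

definition christoffel ::
  "('m \<Rightarrow> 'm chart \<Rightarrow> real^4^4) \<Rightarrow> 'm chart \<Rightarrow> 'm \<Rightarrow> 4 \<Rightarrow> 4 \<Rightarrow> 4 \<Rightarrow> real" where
  "christoffel g c x \<kappa> \<mu> \<nu> =
    (1/2) * (\<Sum>\<rho>\<in>UNIV. matrix_inv (g x c) $ \<kappa> $ \<rho> *
      (pd c \<mu> (\<lambda>y. g y c $ \<rho> $ \<nu>) x + pd c \<nu> (\<lambda>y. g y c $ \<rho> $ \<mu>) x
       - pd c \<rho> (\<lambda>y. g y c $ \<mu> $ \<nu>) x))"

text \<open>\<open>nabla g \<sigma> c x i \<alpha> \<beta> \<gamma>\<close> is the covariant derivative in the direction \<open>\<alpha>\<close> of the component
  \<open>\<beta> \<gamma>\<close> of the \<open>i\<close>-th 2-form.\<close>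

definition nabla ::
  "('m \<Rightarrow> 'm chart \<Rightarrow> real^4^4) \<Rightarrow> ('m \<Rightarrow> 'm chart \<Rightarrow> real^4^4^3) \<Rightarrow>
   'm chart \<Rightarrow> 'm \<Rightarrow> 3 \<Rightarrow> 4 \<Rightarrow> 4 \<Rightarrow> 4 \<Rightarrow> real" where
  "nabla g \<sigma> c x i \<alpha> \<beta> \<gamma> =
    pd c \<alpha> (\<lambda>y. \<sigma> y c $ i $ \<beta> $ \<gamma>) x
    - (\<Sum>\<kappa>\<in>UNIV. christoffel g c x \<kappa> \<alpha> \<beta> * \<sigma> x c $ i $ \<kappa> $ \<gamma>)
    - (\<Sum>\<kappa>\<in>UNIV. christoffel g c x \<kappa> \<alpha> \<gamma> * \<sigma> x c $ i $ \<beta> $ \<kappa>)"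

text \<open>The volume tensor of \<open>g\<close> is \<open>vol\<close> of the triple; its last three indices are raised.\<close>

definition star_d ::
  "('m \<Rightarrow> 'm chart \<Rightarrow> real^4^4^3) \<Rightarrow> ('m \<Rightarrow> 'm chart \<Rightarrow> real^4^4) \<Rightarrow>
   ('m \<Rightarrow> 'm chart \<Rightarrow> real^4^4^3) \<Rightarrow> ('m \<Rightarrow> 'm chart \<Rightarrow> real^4^3)" where
  "star_d \<Sigma> g \<sigma> x c =
    (\<chi> i \<mu>. \<Sum>\<alpha>\<in>UNIV. \<Sum>\<beta>\<in>UNIV. \<Sum>\<gamma>\<in>UNIV.
      (\<Sum>\<kappa>\<in>UNIV. \<Sum>\<rho>\<in>UNIV. \<Sum>\<tau>\<in>UNIV. vol (\<Sigma> x c) \<mu> \<kappa> \<rho> \<tau> *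
         matrix_inv (g x c) $ \<kappa> $ \<alpha> * matrix_inv (g x c) $ \<rho> $ \<beta> * matrix_inv (g x c) $ \<tau> $ \<gamma>) *
      nabla g \<sigma> c x i \<alpha> \<beta> \<gamma>)"

definition d2 ::
  "'m chart set \<Rightarrow> ('m \<Rightarrow> 'm chart \<Rightarrow> real^4^4^3) \<Rightarrow> ('m \<Rightarrow> 'm chart \<Rightarrow> real^4^4) \<Rightarrow>
   ('m \<Rightarrow> 'm chart \<Rightarrow> real^4^4^3) \<Rightarrow> ('m \<Rightarrow> 'm chart \<Rightarrow> real^4^3)" where
  "d2 A \<Sigma> g \<sigma> x c =
    (if c \<in> charts_at A x
     then (1/2) *\<^sub>R inv (J1 (\<Sigma> x c) (g x c)) (star_d \<Sigma> g \<sigma> x c)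
     else 0)"

text \<open>The quotient of two 4-forms is the quotient of their components 1234.\<close>

definition d3 ::
  "'m chart set \<Rightarrow> ('m \<Rightarrow> 'm chart \<Rightarrow> real^4^4^3) \<Rightarrow>
   ('m \<Rightarrow> 'm chart \<Rightarrow> real^4^3) \<Rightarrow> ('m \<Rightarrow> 'm chart \<Rightarrow> real^3)" where
  "d3 A \<Sigma> a x c =
    (if c \<in> charts_at A x
     then \<chi> i. \<Sum>j\<in>UNIV. \<Sum>k\<in>UNIV. eps i j k *
       (wedge22 (\<Sigma> x c $ j) (ext_d A a x c $ k) 1 2 3 4 / vol (\<Sigma> x c) 1 2 3 4)
     else 0)"

end

theory Submission
  imports Defs
begin

text \<open>
  The proof reduces everything to linear algebra. At a point, a positive metric whose raised
  triple satisfies the quaternion relations has, for every nonzero covector \<open>k\<close>, an orthonormal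
  frame \<open>e\<^sub>0, e\<^sub>1, e\<^sub>2, e\<^sub>3\<close> with \<open>e\<^sub>0\<close> along the vector dual to \<open>k\<close> and \<open>e\<^sub>i\<close> the image of \<open>e\<^sub>0\<close>
  under the \<open>i\<close>-th complex structure (\<open>adapted_frame\<close>). In this frame the triple has constant
  components \<open>0, 1, -1\<close> and \<open>k\<close> is a multiple of the dual of \<open>e\<^sub>0\<close>, so every pointwise
  question is a small explicit linear system. The frame components are related to the given ones
  by pulling forms back along a linear map, and the objects of the complex have descriptions that are
  natural under such pullbacks because the metric does not enter:

  \<^item> An element of \<open>E \<otimes> \<Lambda>\<^sup>2\<close> lies in \<open>S\<close> iff it satisfies the linearisation of the equations
    \<open>\<Sigma>\<^sup>i \<and> \<Sigma>\<^sup>j = 2 \<delta>\<^sup>i\<^sup>j v\<close> of a perfect triple (\<open>tangent_iff\<close>).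
  \<^item> The form \<open>a = d2 \<sigma>\<close> is the unique solution of \<open>d\<sigma>\<^sup>i + \<epsilon>\<^sup>i\<^sup>j\<^sup>k a\<^sup>j \<and> \<Sigma>\<^sup>k = 0\<close> (\<open>d2_iff\<close>). Contraction
    with the volume form turns this equation into \<open>2 J1 a = \<star>d\<sigma>\<close>, by self-duality of the triple,
    and \<open>J1\<close> is invertible because \<open>J1\<^sup>2 = 2 + J1\<close>. The Christoffel symbols cancel in \<open>\<star>d\<sigma>\<close>,
    since the connection is torsion free.

  From this description the global statements follow by exterior calculus. The operators are well
  defined because the exterior derivative commutes with changes of coordinates; this and the identity
  \<open>d \<circ> d = 0\<close> rest on the symmetry of second derivatives. The values of \<open>d1\<close> lie in \<open>S\<close> because
  closedness turns \<open>d(\<xi> \<lrcorner> \<Sigma>)\<close> into the Lie derivative of \<open>\<Sigma>\<close>: its zeroth-order part is a derivative of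
  a family of perfect triples, and its first-order part is an infinitesimal linear change of frame.
  For \<open>\<sigma> = d1 \<xi>\<close> the form \<open>d\<sigma>\<close> vanishes, so \<open>d2 \<sigma> = 0\<close>; and \<open>d\<close> applied to the equation for
  \<open>a = d2 \<sigma>\<close> gives \<open>\<epsilon>\<^sup>i\<^sup>j\<^sup>k da\<^sup>j \<and> \<Sigma>\<^sup>k = 0\<close>, which is \<open>d3 a = 0\<close>.

  The symbols are obtained by replacing \<open>d\<close> by \<open>k \<and>\<close>. Hence \<open>\<sigma>\<^sub>2(s) = a\<close> means
  \<open>k \<and> s\<^sup>i + \<epsilon>\<^sup>i\<^sup>j\<^sup>k a\<^sup>j \<and> \<Sigma>\<^sup>k = 0\<close>, and exactness is read off in the adapted frame
  (\<open>symbol1_injective\<close>, \<open>symbol1_surjective\<close>, \<open>connection_symbol_exact\<close>, \<open>symbol3_surjective\<close>).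
\<close>

section \<open>Smooth maps between Euclidean spaces\<close>

lemma Ck_on_Suc_open:
  assumes "open U"
  shows "Ck_on (Suc n) U f \<longleftrightarrow>
    (\<forall>x\<in>U. f differentiable at x) \<and> (\<forall>e\<in>Basis. Ck_on n U (\<lambda>y. frechet_derivative f (at y) e))"
  using assms by (simp add: differentiable_on_eq_differentiable_at)

text \<open>Smoothness on an open set is a local property, although the definition evaluates Frechet derivatives,
  which are junk values where the map is not differentiable. The closure properties of smooth maps below
  go by induction on the order of differentiability: the derivative of the combined map agrees on the
  open set with the expression given by the product or chain rule, to which the induction hypothesis applies.\<close>

lemma Ck_on_cong:
  assumes "open U" "Ck_on n U f" "\<And>x. x \<in> U \<Longrightarrow> f x = g x"
  shows "Ck_on n U g"
  using assms
proof (induction n arbitrary: f g)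
  case 0
  then show ?case by (simp cong: continuous_on_cong)
next
  case (Suc n)
  have d: "f differentiable at x" if "x \<in> U" for x
    using Suc.prems(2) that unfolding Ck_on_Suc_open[OF Suc.prems(1)] by blast
  have "g differentiable at x" if x: "x \<in> U" for x
  proof -
    obtain D where "(f has_derivative D) (at x)" using d[OF x] by (auto simp: differentiable_def)
    then have "(g has_derivative D) (at x)"
      by (rule has_derivative_transform_within_open[OF _ Suc.prems(1) x]) (rule Suc.prems(3))
    then show ?thesis by (auto simp: differentiable_def)
  qed
  moreover have "Ck_on n U (\<lambda>y. frechet_derivative g (at y) e)" if "e \<in> Basis" for e
  proof (rule Suc.IH[OF Suc.prems(1)])
    show "Ck_on n U (\<lambda>y. frechet_derivative f (at y) e)"
      using Suc.prems(2) that unfolding Ck_on_Suc_open[OF Suc.prems(1)] by blast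
    show "frechet_derivative f (at x) e = frechet_derivative g (at x) e" if "x \<in> U" for x
      using frechet_derivative_transform_within_open[OF d[OF that] Suc.prems(1) that Suc.prems(3)] by metis
  qed
  ultimately show ?case unfolding Ck_on_Suc_open[OF Suc.prems(1)] by blast
qed

lemma Ck_on_SucD: "open U \<Longrightarrow> Ck_on (Suc n) U f \<Longrightarrow> Ck_on n U f"
proof (induction n arbitrary: f)
  case 0
  then have "f differentiable_on U" by simp
  then show ?case by (simp add: differentiable_imp_continuous_on)
next
  case (Suc n)
  then show ?case unfolding Ck_on_Suc_open[OF Suc.prems(1)] by blast
qed

lemma Ck_on_subset: "open V \<Longrightarrow> V \<subseteq> U \<Longrightarrow> Ck_on n U f \<Longrightarrow> Ck_on n V f"
proof (induction n arbitrary: f)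
  case 0
  then show ?case by (auto intro: continuous_on_subset)
next
  case (Suc n)
  then show ?case unfolding Ck_on.simps by (meson differentiable_on_subset)
qed

lemma Ck_on_const: "open U \<Longrightarrow> Ck_on n U (\<lambda>_. v)"
  by (induction n arbitrary: v) (simp_all add: frechet_derivative_const)

lemma Ck_on_add:
  assumes "open U" "Ck_on n U f" "Ck_on n U g"
  shows "Ck_on n U (\<lambda>x. f x + g x)"
  using assms
proof (induction n arbitrary: f g)
  case 0
  then show ?case by (auto intro: continuous_intros)
next
  case (Suc n)
  note d = Suc.prems(2,3)[unfolded Ck_on_Suc_open[OF Suc.prems(1)]]
  have "Ck_on n U (\<lambda>y. frechet_derivative (\<lambda>x. f x + g x) (at y) e)" if e: "e \<in> Basis" for e
  proof (rule Ck_on_cong[OF Suc.prems(1)])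
    show "Ck_on n U (\<lambda>y. frechet_derivative f (at y) e + frechet_derivative g (at y) e)"
      using Suc.IH[OF Suc.prems(1)] d e by blast
    show "frechet_derivative f (at y) e + frechet_derivative g (at y) e =
        frechet_derivative (\<lambda>x. f x + g x) (at y) e" if "y \<in> U" for y
    proof -
      have "((\<lambda>x. f x + g x) has_derivative
          (\<lambda>e. frechet_derivative f (at y) e + frechet_derivative g (at y) e)) (at y)"
        using d that by (intro has_derivative_add) (auto simp: frechet_derivative_works[symmetric])
      from frechet_derivative_at[OF this] show ?thesis by metis
    qed
  qed
  moreover have "(\<lambda>x. f x + g x) differentiable at y" if "y \<in> U" for y
    using d that by (intro differentiable_add) blast+
  ultimately show ?case unfolding Ck_on_Suc_open[OF Suc.prems(1)] by blast
qed

lemma (in bounded_bilinear) Ck_on: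
  assumes "open U" "Ck_on n U f" "Ck_on n U g"
  shows "Ck_on n U (\<lambda>x. prod (f x) (g x))"
  using assms
proof (induction n arbitrary: f g)
  case 0
  then show ?case by (auto intro: continuous_on)
next
  case (Suc n)
  note d = Suc.prems(2,3)[unfolded Ck_on_Suc_open[OF Suc.prems(1)]]
  note l = Suc.prems(2,3)[THEN Ck_on_SucD[OF Suc.prems(1)]]
  have D: "((\<lambda>x. prod (f x) (g x)) has_derivative
          (\<lambda>e. prod (f y) (frechet_derivative g (at y) e) + prod (frechet_derivative f (at y) e) (g y))) (at y)"
    if "y \<in> U" for y
    using d that by (intro FDERIV) (auto simp: frechet_derivative_works[symmetric])
  have "Ck_on n U (\<lambda>y. frechet_derivative (\<lambda>x. prod (f x) (g x)) (at y) e)" if e: "e \<in> Basis" for e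
  proof (rule Ck_on_cong[OF Suc.prems(1)])
    show "Ck_on n U (\<lambda>y. prod (f y) (frechet_derivative g (at y) e) + prod (frechet_derivative f (at y) e) (g y))"
      by (rule Ck_on_add[OF Suc.prems(1)]; rule Suc.IH[OF Suc.prems(1)]) (use l d e in blast)+
    show "prod (f y) (frechet_derivative g (at y) e) + prod (frechet_derivative f (at y) e) (g y) =
        frechet_derivative (\<lambda>x. prod (f x) (g x)) (at y) e" if "y \<in> U" for y
      using frechet_derivative_at[OF D[OF that]] by metis
  qed
  with D show ?case unfolding Ck_on_Suc_open[OF Suc.prems(1)] differentiable_def by blast
qed

lemma (in bounded_linear) Ck_on:
  assumes "open U" "Ck_on n U g"
  shows "Ck_on n U (\<lambda>x. f (g x))"
  using assms
proof (induction n arbitrary: g)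
  case 0
  then show ?case by (auto intro: continuous_on)
next
  case (Suc n)
  note d = Suc.prems(2)[unfolded Ck_on_Suc_open[OF Suc.prems(1)]]
  have D: "((\<lambda>x. f (g x)) has_derivative (\<lambda>e. f (frechet_derivative g (at y) e))) (at y)"
    if "y \<in> U" for y
    using d that by (intro has_derivative) (auto simp: frechet_derivative_works[symmetric])
  have "Ck_on n U (\<lambda>y. frechet_derivative (\<lambda>x. f (g x)) (at y) e)" if e: "e \<in> Basis" for e
  proof (rule Ck_on_cong[OF Suc.prems(1)])
    show "Ck_on n U (\<lambda>y. f (frechet_derivative g (at y) e))"
      using Suc.IH[OF Suc.prems(1)] d e by blast
    show "f (frechet_derivative g (at y) e) = frechet_derivative (\<lambda>x. f (g x)) (at y) e" if "y \<in> U" for y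
      using frechet_derivative_at[OF D[OF that]] by metis
  qed
  with D show ?case unfolding Ck_on_Suc_open[OF Suc.prems(1)] differentiable_def by blast
qed

lemma Ck_on_inverse:
  fixes f :: "'a::euclidean_space \<Rightarrow> real"
  assumes "open U" "Ck_on n U f" "\<And>x. x \<in> U \<Longrightarrow> f x \<noteq> 0"
  shows "Ck_on n U (\<lambda>x. inverse (f x))"
  using assms
proof (induction n arbitrary: f)
  case 0
  then show ?case by (auto intro: continuous_on_inverse)
next
  case (Suc n)
  note d = Suc.prems(2)[unfolded Ck_on_Suc_open[OF Suc.prems(1)]]
  note l = Suc.prems(2)[THEN Ck_on_SucD[OF Suc.prems(1)]]
  have D: "((\<lambda>x. inverse (f x)) has_derivative
      (\<lambda>e. - (inverse (f y) * frechet_derivative f (at y) e * inverse (f y)))) (at y)"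
    if "y \<in> U" for y
    using d that Suc.prems(3) by (intro Deriv.has_derivative_inverse) (auto simp: frechet_derivative_works[symmetric])
  have "Ck_on n U (\<lambda>y. frechet_derivative (\<lambda>x. inverse (f x)) (at y) e)" if e: "e \<in> Basis" for e
  proof (rule Ck_on_cong[OF Suc.prems(1)])
    show "Ck_on n U (\<lambda>y. - (inverse (f y) * frechet_derivative f (at y) e * inverse (f y)))"
      using Suc.IH[OF Suc.prems(1) l Suc.prems(3)] d e
      by (intro bounded_linear.Ck_on[OF bounded_linear_minus[OF bounded_linear_ident]]
          bounded_bilinear.Ck_on[OF bounded_bilinear_mult] Suc.prems(1)) simp_all
    show "- (inverse (f y) * frechet_derivative f (at y) e * inverse (f y)) =
        frechet_derivative (\<lambda>x. inverse (f x)) (at y) e" if "y \<in> U" for y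
      using frechet_derivative_at[OF D[OF that]] by metis
  qed
  with D show ?case unfolding Ck_on_Suc_open[OF Suc.prems(1)] differentiable_def by blast
qed

lemma smooth_on_cong:
  "open U \<Longrightarrow> smooth_on U f \<Longrightarrow> (\<And>x. x \<in> U \<Longrightarrow> f x = g x) \<Longrightarrow> smooth_on U g"
  unfolding smooth_on_def using Ck_on_cong by blast

lemma smooth_on_subset: "open V \<Longrightarrow> V \<subseteq> U \<Longrightarrow> smooth_on U f \<Longrightarrow> smooth_on V f"
  unfolding smooth_on_def using Ck_on_subset by blast

lemma smooth_on_const: "open U \<Longrightarrow> smooth_on U (\<lambda>_. v)"
  unfolding smooth_on_def by (simp add: Ck_on_const)

lemma smooth_on_add:
  "open U \<Longrightarrow> smooth_on U f \<Longrightarrow> smooth_on U g \<Longrightarrow> smooth_on U (\<lambda>x. f x + g x)"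
  unfolding smooth_on_def by (simp add: Ck_on_add)

lemma (in bounded_bilinear) smooth_on:
  "open U \<Longrightarrow> smooth_on U f \<Longrightarrow> smooth_on U g \<Longrightarrow> smooth_on U (\<lambda>x. prod (f x) (g x))"
  unfolding smooth_on_def using Ck_on by blast

lemma (in bounded_linear) smooth_on:
  "open U \<Longrightarrow> smooth_on U g \<Longrightarrow> smooth_on U (\<lambda>x. f (g x))"
  unfolding smooth_on_def using Ck_on by blast

lemmas smooth_on_minus = bounded_linear.smooth_on[OF bounded_linear_minus[OF bounded_linear_ident]]

lemma smooth_on_diff:
  "open U \<Longrightarrow> smooth_on U f \<Longrightarrow> smooth_on U g \<Longrightarrow> smooth_on U (\<lambda>x. f x - g x)"
  using smooth_on_add[of U f "\<lambda>x. - g x"] smooth_on_minus by auto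

lemmas smooth_on_mult = bounded_bilinear.smooth_on[OF bounded_bilinear_mult]
lemmas smooth_on_scaleR = bounded_bilinear.smooth_on[OF bounded_bilinear_scaleR]
lemmas smooth_on_nth = bounded_linear.smooth_on[OF bounded_linear_vec_nth]

lemma smooth_on_sum:
  "open U \<Longrightarrow> (\<And>i. i \<in> I \<Longrightarrow> smooth_on U (f i)) \<Longrightarrow> smooth_on U (\<lambda>x. \<Sum>i\<in>I. f i x)"
  by (induction I rule: infinite_finite_induct) (simp_all add: smooth_on_const smooth_on_add)

lemma smooth_on_prod:
  fixes f :: "'i \<Rightarrow> 'a::euclidean_space \<Rightarrow> real"
  shows "open U \<Longrightarrow> (\<And>i. i \<in> I \<Longrightarrow> smooth_on U (f i)) \<Longrightarrow> smooth_on U (\<lambda>x. \<Prod>i\<in>I. f i x)"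
  by (induction I rule: infinite_finite_induct) (simp_all add: smooth_on_const smooth_on_mult)

lemma smooth_on_divide:
  fixes f g :: "'a::euclidean_space \<Rightarrow> real"
  assumes "open U" "smooth_on U f" "smooth_on U g" "\<And>x. x \<in> U \<Longrightarrow> g x \<noteq> 0"
  shows "smooth_on U (\<lambda>x. f x / g x)"
  unfolding divide_inverse using assms
  by (intro smooth_on_mult) (auto simp: smooth_on_def intro: Ck_on_inverse)

lemma bounded_linear_axis: "bounded_linear (\<lambda>v::'b::real_normed_vector. axis i v :: 'b^'n)"
proof
  show "axis i (x + y) = (axis i x + axis i y :: 'b^'n)" for x y
    by (simp add: axis_def vec_eq_iff)
  show "axis i (r *\<^sub>R x) = (r *\<^sub>R axis i x :: 'b^'n)" for r x
    by (simp add: axis_def vec_eq_iff)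
  show "\<exists>K. \<forall>x::'b. norm (axis i x :: 'b^'n) \<le> norm x * K"
    by (rule exI[of _ 1]) (simp add: norm_vec_def L2_set_def axis_def if_distrib[of norm] if_distrib[of "\<lambda>x. x\<^sup>2"] cong: if_cong)
qed

text \<open>A vector-valued map is the sum of its components along the coordinate axes, so smoothness can be
  tested on real-valued functions.\<close>

lemma smooth_on_vec_iff:
  fixes f :: "'a::euclidean_space \<Rightarrow> 'b::real_normed_vector^'n"
  assumes "open U"
  shows "smooth_on U f \<longleftrightarrow> (\<forall>i. smooth_on U (\<lambda>x. f x $ i))"
proof
  assume "smooth_on U f" then show "\<forall>i. smooth_on U (\<lambda>x. f x $ i)"
    using smooth_on_nth[OF assms] by blast
next
  assume r: "\<forall>i. smooth_on U (\<lambda>x. f x $ i)"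
  have "smooth_on U (\<lambda>x. \<Sum>i\<in>UNIV. axis i (f x $ i))"
    using r by (intro smooth_on_sum assms bounded_linear.smooth_on[OF bounded_linear_axis]) blast
  moreover have "(\<Sum>i\<in>UNIV. axis i (f x $ i)) = f x" for x
    by (simp add: vec_eq_iff axis_def)
  ultimately show "smooth_on U f" by simp
qed

lemma smooth_on_vec_lambda:
  fixes f :: "'n::finite \<Rightarrow> 'a::euclidean_space \<Rightarrow> 'b::real_normed_vector"
  shows "open U \<Longrightarrow> (\<And>i. smooth_on U (f i)) \<Longrightarrow> smooth_on U (\<lambda>x. \<chi> i. f i x)"
  unfolding smooth_on_vec_iff vec_lambda_beta by blast

lemma smooth_on_if_const:
  "open U \<Longrightarrow> (P \<Longrightarrow> smooth_on U f) \<Longrightarrow> (\<not> P \<Longrightarrow> smooth_on U g) \<Longrightarrow> smooth_on U (\<lambda>x. if P then f x else g x)"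
  by (cases P) simp_all

lemma smooth_on_derivative:
  "open U \<Longrightarrow> smooth_on U f \<Longrightarrow> e \<in> Basis \<Longrightarrow> smooth_on U (\<lambda>y. frechet_derivative f (at y) e)"
  unfolding smooth_on_def by (metis Ck_on.simps(2))

lemma smooth_on_differentiable:
  assumes "open U" "smooth_on U f" "x \<in> U" shows "f differentiable at x"
proof -
  have "Ck_on (Suc 0) U f" using assms(2) unfolding smooth_on_def by blast
  then show ?thesis using assms(3) unfolding Ck_on_Suc_open[OF assms(1)] by blast
qed

lemma smooth_on_det:
  fixes M :: "'a::euclidean_space \<Rightarrow> real^'n^'n"
  assumes "open U" "\<And>i j. smooth_on U (\<lambda>x. M x $ i $ j)"
  shows "smooth_on U (\<lambda>x. det (M x))"
  unfolding det_def using assms by (intro smooth_on_sum smooth_on_mult smooth_on_prod smooth_on_const)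

lemma matrix_inv_cancel:
  fixes M :: "'a::semiring_1^'n^'m"
  assumes "invertible M"
  shows "M ** matrix_inv M = mat 1" "matrix_inv M ** M = mat 1"
  using someI_ex[OF assms[unfolded invertible_def]] unfolding matrix_inv_def by auto

text \<open>Cramer's rule: the entries of the inverse are rational functions of the entries.\<close>

lemma matrix_inv_nth:
  fixes M :: "real^'n^'n"
  assumes "invertible M"
  shows "matrix_inv M $ k $ l = det (\<chi> i j. if j = k then axis l 1 $ i else M $ i $ j) / det M"
proof -
  have d: "det M \<noteq> 0" using assms by (simp add: invertible_det_nz)
  have "M *v (matrix_inv M *v axis l 1) = axis l 1"
    by (simp add: matrix_vector_mul_assoc matrix_inv_cancel(1)[OF assms])
  then have "matrix_inv M *v axis l 1 =
      (\<chi> k. det (\<chi> i j. if j = k then axis l 1 $ i else M $ i $ j) / det M)"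
    using cramer[OF d] by blast
  moreover have "(matrix_inv M *v axis l 1) $ k = matrix_inv M $ k $ l"
    by (simp add: matrix_vector_mult_def axis_def if_distrib cong: if_cong)
  ultimately show ?thesis by simp
qed

lemma smooth_on_matrix_inv:
  fixes M :: "'a::euclidean_space \<Rightarrow> real^'n^'n"
  assumes U: "open U" and M: "\<And>i j. smooth_on U (\<lambda>x. M x $ i $ j)"
    and inv: "\<And>x. x \<in> U \<Longrightarrow> invertible (M x)"
  shows "smooth_on U (\<lambda>x. matrix_inv (M x) $ k $ l)"
proof (rule smooth_on_cong[OF U])
  have "smooth_on U (\<lambda>x. (\<chi> i j. if j = k then axis l 1 $ i else M x $ i $ j) $ i $ j)" for i j
    unfolding vec_lambda_beta by (intro smooth_on_if_const smooth_on_const U M)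
  moreover have "det (M x) \<noteq> 0" if "x \<in> U" for x
    using inv[OF that] by (simp add: invertible_det_nz)
  ultimately show "smooth_on U (\<lambda>x. det (\<chi> i j. if j = k then axis l 1 $ i else M x $ i $ j) / det (M x))"
    by (intro smooth_on_divide smooth_on_det U M)
  show "det (\<chi> i j. if j = k then axis l 1 $ i else M x $ i $ j) / det (M x) = matrix_inv (M x) $ k $ l"
    if "x \<in> U" for x by (rule matrix_inv_nth[OF inv[OF that], symmetric])
qed

section \<open>Symmetry of second derivatives\<close>

lemma directional_derivative:
  fixes f :: "'a::euclidean_space \<Rightarrow> real"
  assumes "f differentiable at (p + s *\<^sub>R e)"
  shows "((\<lambda>s. f (p + s *\<^sub>R e)) has_real_derivative frechet_derivative f (at (p + s *\<^sub>R e)) e) (at s)"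
proof -
  let ?D = "frechet_derivative f (at (p + s *\<^sub>R e))"
  have D: "(f has_derivative ?D) (at (p + s *\<^sub>R e))"
    using assms frechet_derivative_works by blast
  have "((\<lambda>s. p + s *\<^sub>R e) has_derivative (\<lambda>t. t *\<^sub>R e)) (at s)"
    by (auto intro!: derivative_eq_intros)
  from has_derivative_compose[OF this D]
  have "((\<lambda>s. f (p + s *\<^sub>R e)) has_derivative (\<lambda>t. ?D (t *\<^sub>R e))) (at s)" .
  moreover have "(\<lambda>t. ?D (t *\<^sub>R e)) = (\<lambda>t. ?D e * t)"
    using linear_scale[OF has_derivative_linear[OF D]] by (simp add: mult.commute)
  ultimately show ?thesis by (simp add: has_field_derivative_def)
qed

text \<open>Two applications of the mean value theorem: first to the difference of \<open>f\<close> in direction \<open>d\<close> along a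
  segment in direction \<open>e\<close>, then to the derivative of \<open>f\<close> in direction \<open>e\<close>. The left-hand side is
  symmetric in \<open>e\<close> and \<open>d\<close>, which is the source of the symmetry of second derivatives.\<close>

lemma second_difference:
  fixes f :: "'a::euclidean_space \<Rightarrow> real"
  assumes f: "\<And>y. y \<in> U \<Longrightarrow> f differentiable at y"
    and fe: "\<And>y. y \<in> U \<Longrightarrow> (\<lambda>y. frechet_derivative f (at y) e) differentiable at y"
    and h: "0 < h" and U: "\<And>s t. 0 \<le> s \<Longrightarrow> s \<le> h \<Longrightarrow> 0 \<le> t \<Longrightarrow> t \<le> h \<Longrightarrow> x + s *\<^sub>R e + t *\<^sub>R d \<in> U"
  shows "\<exists>s t. 0 < s \<and> s < h \<and> 0 < t \<and> t < h \<and>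
    f (x + h *\<^sub>R e + h *\<^sub>R d) - f (x + h *\<^sub>R e) - f (x + h *\<^sub>R d) + f x =
    h * h * frechet_derivative (\<lambda>y. frechet_derivative f (at y) e) (at (x + s *\<^sub>R e + t *\<^sub>R d)) d"
proof -
  let ?fe = "\<lambda>y. frechet_derivative f (at y) e"
  have "((\<lambda>s. f (x + h *\<^sub>R d + s *\<^sub>R e) - f (x + s *\<^sub>R e)) has_real_derivative
      ?fe (x + h *\<^sub>R d + s *\<^sub>R e) - ?fe (x + s *\<^sub>R e)) (at s)" if "0 \<le> s" "s \<le> h" for s
    using U[OF that, of h] U[OF that, of 0] h
    by (intro DERIV_diff directional_derivative f) (auto simp: algebra_simps)
  from MVT2[OF h this] obtain s where s: "0 < s" "s < h" and
    1: "f (x + h *\<^sub>R d + h *\<^sub>R e) - f (x + h *\<^sub>R e) - (f (x + h *\<^sub>R d) - f x) =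
      h * (?fe (x + h *\<^sub>R d + s *\<^sub>R e) - ?fe (x + s *\<^sub>R e))" by auto
  have "((\<lambda>t. ?fe (x + s *\<^sub>R e + t *\<^sub>R d)) has_real_derivative
      frechet_derivative ?fe (at (x + s *\<^sub>R e + t *\<^sub>R d)) d) (at t)" if "0 \<le> t" "t \<le> h" for t
    using U[OF _ _ that, of s] s by (intro directional_derivative fe) auto
  from MVT2[OF h this] obtain t where t: "0 < t" "t < h" and
    2: "?fe (x + s *\<^sub>R e + h *\<^sub>R d) - ?fe (x + s *\<^sub>R e) =
      h * frechet_derivative ?fe (at (x + s *\<^sub>R e + t *\<^sub>R d)) d" by auto
  have "x + h *\<^sub>R d + s *\<^sub>R e = x + s *\<^sub>R e + h *\<^sub>R d"
    "x + h *\<^sub>R d + h *\<^sub>R e = x + h *\<^sub>R e + h *\<^sub>R d" by (simp_all add: algebra_simps)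
  with 1 2 have "f (x + h *\<^sub>R e + h *\<^sub>R d) - f (x + h *\<^sub>R e) - f (x + h *\<^sub>R d) + f x =
    h * h * frechet_derivative ?fe (at (x + s *\<^sub>R e + t *\<^sub>R d)) d" by simp
  with s t show ?thesis by blast
qed

lemma second_derivative_symmetric:
  fixes f :: "'a::euclidean_space \<Rightarrow> real"
  assumes U: "open U" and f: "smooth_on U f" and x: "x \<in> U" and e: "e \<in> Basis" and d: "d \<in> Basis"
  shows "frechet_derivative (\<lambda>y. frechet_derivative f (at y) e) (at x) d =
    frechet_derivative (\<lambda>y. frechet_derivative f (at y) d) (at x) e"
proof (rule ccontr)
  let ?D = "\<lambda>e y. frechet_derivative f (at y) e"
  let ?A = "\<lambda>y. frechet_derivative (?D e) (at y) d" and ?B = "\<lambda>y. frechet_derivative (?D d) (at y) e"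
  assume ne: "\<not> ?thesis"
  define \<epsilon> where "\<epsilon> = \<bar>?A x - ?B x\<bar> / 2"
  have \<epsilon>: "\<epsilon> > 0" using ne by (simp add: \<epsilon>_def)
  have sm: "smooth_on U (?D e)" "smooth_on U (?D d)" "smooth_on U ?A" "smooth_on U ?B"
    using smooth_on_derivative[OF U] f e d by blast+
  have "isCont ?A x" "isCont ?B x"
    by (intro differentiable_imp_continuous_within smooth_on_differentiable[OF U _ x] sm)+
  then obtain r1 r2 where r: "r1 > 0" "r2 > 0"
    and A: "\<And>y. dist y x < r1 \<Longrightarrow> dist (?A y) (?A x) < \<epsilon>"
    and B: "\<And>y. dist y x < r2 \<Longrightarrow> dist (?B y) (?B x) < \<epsilon>"
    unfolding continuous_at_eps_delta using \<epsilon> by metis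
  obtain r0 where r0: "r0 > 0" "ball x r0 \<subseteq> U" using U x openE by blast
  \<comment> \<open>a step so small that both intermediate points lie within all three radii\<close>
  define r where "r = min r0 (min r1 r2)"
  define h where "h = r / 4"
  have h: "h > 0" "r > 0" using r r0 by (auto simp: h_def r_def)
  have near: "dist (x + s *\<^sub>R e + t *\<^sub>R d) x < r" if "0 \<le> s" "s \<le> h" "0 \<le> t" "t \<le> h" for s t
  proof -
    have "dist (x + s *\<^sub>R e + t *\<^sub>R d) x = norm (s *\<^sub>R e + t *\<^sub>R d)"
      by (simp add: dist_norm algebra_simps)
    also have "\<dots> \<le> norm (s *\<^sub>R e) + norm (t *\<^sub>R d)" by (rule norm_triangle_ineq)
    also have "\<dots> = s + t" using that e d by (simp add: norm_Basis)
    finally show ?thesis using that h by (simp add: h_def)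
  qed
  have inU: "x + s *\<^sub>R e + t *\<^sub>R d \<in> U" if "0 \<le> s" "s \<le> h" "0 \<le> t" "t \<le> h" for s t
    using near[OF that] r0 by (auto simp: r_def dist_commute)
  have inU': "x + s *\<^sub>R d + t *\<^sub>R e \<in> U" if "0 \<le> s" "s \<le> h" "0 \<le> t" "t \<le> h" for s t
    using inU[OF that(3,4,1,2)] by (simp add: algebra_simps)
  obtain s t where st: "0 < s" "s < h" "0 < t" "t < h" and
    1: "f (x + h *\<^sub>R e + h *\<^sub>R d) - f (x + h *\<^sub>R e) - f (x + h *\<^sub>R d) + f x =
      h * h * ?A (x + s *\<^sub>R e + t *\<^sub>R d)"
    using second_difference[of U f e h x d] smooth_on_differentiable[OF U] f sm(1) h(1) inU by blast
  obtain s' t' where st': "0 < s'" "s' < h" "0 < t'" "t' < h" and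
    2: "f (x + h *\<^sub>R d + h *\<^sub>R e) - f (x + h *\<^sub>R d) - f (x + h *\<^sub>R e) + f x =
      h * h * ?B (x + s' *\<^sub>R d + t' *\<^sub>R e)"
    using second_difference[of U f d h x e] smooth_on_differentiable[OF U] f sm(2) h(1) inU' by blast
  have "x + h *\<^sub>R d + h *\<^sub>R e = x + h *\<^sub>R e + h *\<^sub>R d" by (simp add: algebra_simps)
  from 1 2[unfolded this]
  have "h * h * ?A (x + s *\<^sub>R e + t *\<^sub>R d) = h * h * ?B (x + s' *\<^sub>R d + t' *\<^sub>R e)" by linarith
  then have eq: "?A (x + s *\<^sub>R e + t *\<^sub>R d) = ?B (x + s' *\<^sub>R d + t' *\<^sub>R e)" using h by simp
  have "dist (x + s' *\<^sub>R d + t' *\<^sub>R e) x < r"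
    using near[of t' s'] st' by (simp add: algebra_simps)
  then have "dist (?B (x + s' *\<^sub>R d + t' *\<^sub>R e)) (?B x) < \<epsilon>" by (intro B) (simp add: r_def)
  moreover have "dist (?A (x + s *\<^sub>R e + t *\<^sub>R d)) (?A x) < \<epsilon>"
    using near[of s t] st by (intro A) (simp add: r_def)
  ultimately have "\<bar>?A x - ?B x\<bar> < 2 * \<epsilon>" unfolding eq dist_real_def by linarith
  then show False by (simp add: \<epsilon>_def)
qed

section \<open>Partial derivatives in charts\<close>

definition smooth_in :: "'m chart \<Rightarrow> 'm set \<Rightarrow> ('m \<Rightarrow> 'b::real_normed_vector) \<Rightarrow> bool" where
  "smooth_in c U f \<longleftrightarrow> smooth_on (coord c ` (dom_of c \<inter> U)) (f \<circ> chart_inv c)"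

text \<open>Differentiability of the coordinate expression at one point is all that the product and sum rules for
  \<open>pd\<close> need; smoothness on an open set implies it.\<close>

definition diff_at :: "'m chart \<Rightarrow> 'm \<Rightarrow> ('m \<Rightarrow> 'b::real_normed_vector) \<Rightarrow> bool" where
  "diff_at c x f \<longleftrightarrow> (f \<circ> chart_inv c) differentiable at (coord c x)"

lemma pd_unique:
  "((f \<circ> chart_inv c) has_derivative D) (at (coord c x)) \<Longrightarrow> pd c \<mu> f x = D (axis \<mu> 1)"
  unfolding pd_def using frechet_derivative_at by metis

lemma diff_at_has_derivative:
  "diff_at c x f \<Longrightarrow>
    ((\<lambda>y. f (chart_inv c y)) has_derivative frechet_derivative (f \<circ> chart_inv c) (at (coord c x))) (at (coord c x))"
  unfolding diff_at_def frechet_derivative_works by (simp add: o_def)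

lemma diff_atI: "((\<lambda>y. f (chart_inv c y)) has_derivative D) (at (coord c x)) \<Longrightarrow> diff_at c x f"
  unfolding diff_at_def differentiable_def o_def by blast

lemma pd_eqI: "((\<lambda>y. f (chart_inv c y)) has_derivative D) (at (coord c x)) \<Longrightarrow> pd c \<mu> f x = D (axis \<mu> 1)"
  by (rule pd_unique) (simp add: o_def)

lemma diff_at_const: "diff_at c x (\<lambda>_. k)"
  by (rule diff_atI) (rule has_derivative_const)

lemma pd_const: "pd c \<mu> (\<lambda>_. k) x = 0"
  by (subst pd_eqI[OF has_derivative_const]) simp

lemma
  assumes "diff_at c x f" "diff_at c x g"
  shows diff_at_add: "diff_at c x (\<lambda>y. f y + g y)"
    and pd_add: "pd c \<mu> (\<lambda>y. f y + g y) x = pd c \<mu> f x + pd c \<mu> g x"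
    and diff_at_diff: "diff_at c x (\<lambda>y. f y - g y)"
    and pd_diff: "pd c \<mu> (\<lambda>y. f y - g y) x = pd c \<mu> f x - pd c \<mu> g x"
proof -
  note D = assms[THEN diff_at_has_derivative]
  show "diff_at c x (\<lambda>y. f y + g y)" "diff_at c x (\<lambda>y. f y - g y)"
    by (rule diff_atI, rule has_derivative_add[OF D], rule diff_atI, rule has_derivative_diff[OF D])
  show "pd c \<mu> (\<lambda>y. f y + g y) x = pd c \<mu> f x + pd c \<mu> g x"
    unfolding pd_eqI[OF has_derivative_add[OF D]] by (simp add: pd_def)
  show "pd c \<mu> (\<lambda>y. f y - g y) x = pd c \<mu> f x - pd c \<mu> g x"
    unfolding pd_eqI[OF has_derivative_diff[OF D]] by (simp add: pd_def)
qed

lemma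
  assumes "bounded_bilinear p" "diff_at c x f" "diff_at c x g"
  shows diff_at_bilinear: "diff_at c x (\<lambda>y. p (f y) (g y))"
    and pd_bilinear: "chart_inv c (coord c x) = x \<Longrightarrow>
      pd c \<mu> (\<lambda>y. p (f y) (g y)) x = p (f x) (pd c \<mu> g x) + p (pd c \<mu> f x) (g x)"
proof -
  note D = bounded_bilinear.FDERIV[OF assms(1) assms(2,3)[THEN diff_at_has_derivative]]
  show "diff_at c x (\<lambda>y. p (f y) (g y))" by (rule diff_atI[OF D])
  show "pd c \<mu> (\<lambda>y. p (f y) (g y)) x = p (f x) (pd c \<mu> g x) + p (pd c \<mu> f x) (g x)"
    if "chart_inv c (coord c x) = x"
    unfolding pd_eqI[OF D] that by (simp add: pd_def)
qed

lemma
  assumes "bounded_linear h" "diff_at c x f"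
  shows diff_at_linear: "diff_at c x (\<lambda>y. h (f y))"
    and pd_linear: "pd c \<mu> (\<lambda>y. h (f y)) x = h (pd c \<mu> f x)"
proof -
  note D = bounded_linear.has_derivative[OF assms(1) assms(2)[THEN diff_at_has_derivative]]
  show "diff_at c x (\<lambda>y. h (f y))" by (rule diff_atI[OF D])
  show "pd c \<mu> (\<lambda>y. h (f y)) x = h (pd c \<mu> f x)"
    unfolding pd_eqI[OF D] by (simp add: pd_def)
qed

lemmas diff_at_nth = diff_at_linear[OF bounded_linear_vec_nth]
lemmas pd_nth = pd_linear[OF bounded_linear_vec_nth]
lemmas diff_at_minus = diff_at_linear[OF bounded_linear_minus[OF bounded_linear_ident]]
lemmas pd_minus = pd_linear[OF bounded_linear_minus[OF bounded_linear_ident]]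
lemmas diff_at_mult = diff_at_bilinear[OF bounded_bilinear_mult]
lemmas pd_mult = pd_bilinear[OF bounded_bilinear_mult]
lemmas pd_scaleR = pd_bilinear[OF bounded_bilinear_scaleR]

lemma diff_at_sum: "(\<And>i. i \<in> I \<Longrightarrow> diff_at c x (f i)) \<Longrightarrow> diff_at c x (\<lambda>y. \<Sum>i\<in>I. f i y)"
  by (induction I rule: infinite_finite_induct) (simp_all add: diff_at_const diff_at_add)

lemma pd_sum:
  "(\<And>i. i \<in> I \<Longrightarrow> diff_at c x (f i)) \<Longrightarrow> pd c \<mu> (\<lambda>y. \<Sum>i\<in>I. f i y) x = (\<Sum>i\<in>I. pd c \<mu> (f i) x)"
  by (induction I rule: infinite_finite_induct) (simp_all add: pd_const pd_add diff_at_sum)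

locale smooth_manifold =
  fixes A :: "'m::topological_space chart set"
  assumes atlas: "smooth_atlas A"
begin

lemma open_dom: "c \<in> A \<Longrightarrow> open (dom_of c)"
  using atlas unfolding smooth_atlas_def by blast

lemma chart_homeomorphism:
  "c \<in> A \<Longrightarrow> homeomorphism (dom_of c) (coord c ` dom_of c) (coord c) (chart_inv c)"
  using atlas unfolding smooth_atlas_def by blast

lemma chart_inv_coord: "c \<in> A \<Longrightarrow> x \<in> dom_of c \<Longrightarrow> chart_inv c (coord c x) = x"
  using chart_homeomorphism homeomorphism_apply1 by blast

lemma open_image:
  assumes "c \<in> A" "open U" shows "open (coord c ` (dom_of c \<inter> U))"
proof -
  have "openin (top_of_set (coord c ` dom_of c)) (coord c ` (dom_of c \<inter> U))"
    using chart_homeomorphism[OF assms(1)] assms(2)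
    by (intro homeomorphism_imp_open_map) (auto intro: openin_open_Int)
  moreover have "open (coord c ` dom_of c)"
    using atlas assms(1) unfolding smooth_atlas_def by blast
  ultimately show ?thesis using openin_open_eq by blast
qed

lemma charts_at_D: "c \<in> charts_at A x \<Longrightarrow> c \<in> A" "c \<in> charts_at A x \<Longrightarrow> x \<in> dom_of c"
  by (auto simp: charts_at_def)

lemma chart_exists: obtains c where "c \<in> charts_at A x"
proof -
  have "x \<in> (\<Union>c\<in>A. dom_of c)" using atlas unfolding smooth_atlas_def by blast
  then show ?thesis using that by (auto simp: charts_at_def)
qed

context
  fixes c :: "'m chart" and U :: "'m set" assumes c: "c \<in> A" and U: "open U"
begin

lemma smooth_in_diff_at:
  assumes "smooth_in c U f" "x \<in> dom_of c" "x \<in> U" shows "diff_at c x f"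
  using smooth_on_differentiable[OF open_image[OF c U] assms(1)[unfolded smooth_in_def]] assms(2,3)
  unfolding diff_at_def by blast

lemma smooth_in_cong:
  assumes "smooth_in c U f" "\<And>x. x \<in> dom_of c \<Longrightarrow> x \<in> U \<Longrightarrow> f x = g x" shows "smooth_in c U g"
  using assms(1) unfolding smooth_in_def
  by (rule smooth_on_cong[OF open_image[OF c U]]) (auto simp: chart_inv_coord[OF c] assms(2))

lemma smooth_in_const: "smooth_in c U (\<lambda>_. k)"
  unfolding smooth_in_def o_def by (rule smooth_on_const[OF open_image[OF c U]])

lemma smooth_in_add: "smooth_in c U f \<Longrightarrow> smooth_in c U g \<Longrightarrow> smooth_in c U (\<lambda>x. f x + g x)"
  unfolding smooth_in_def o_def by (rule smooth_on_add[OF open_image[OF c U]])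

lemma smooth_in_diff: "smooth_in c U f \<Longrightarrow> smooth_in c U g \<Longrightarrow> smooth_in c U (\<lambda>x. f x - g x)"
  unfolding smooth_in_def o_def by (rule smooth_on_diff[OF open_image[OF c U]])

lemma smooth_in_mult:
  fixes f g :: "_ \<Rightarrow> real"
  shows "smooth_in c U f \<Longrightarrow> smooth_in c U g \<Longrightarrow> smooth_in c U (\<lambda>x. f x * g x)"
  unfolding smooth_in_def o_def by (rule smooth_on_mult[OF open_image[OF c U]])

lemma smooth_in_scaleR: "smooth_in c U f \<Longrightarrow> smooth_in c U g \<Longrightarrow> smooth_in c U (\<lambda>x. f x *\<^sub>R g x)"
  unfolding smooth_in_def o_def by (rule smooth_on_scaleR[OF open_image[OF c U]])

lemma smooth_in_nth: "smooth_in c U f \<Longrightarrow> smooth_in c U (\<lambda>x. f x $ i)"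
  unfolding smooth_in_def o_def by (rule smooth_on_nth[OF open_image[OF c U]])

lemma smooth_in_sum: "(\<And>i. i \<in> I \<Longrightarrow> smooth_in c U (f i)) \<Longrightarrow> smooth_in c U (\<lambda>x. \<Sum>i\<in>I. f i x)"
  unfolding smooth_in_def o_def by (rule smooth_on_sum[OF open_image[OF c U]])

lemma smooth_in_vec_lambda: "(\<And>i. smooth_in c U (f i)) \<Longrightarrow> smooth_in c U (\<lambda>x. \<chi> i. f i x)"
  unfolding smooth_in_def o_def by (rule smooth_on_vec_lambda[OF open_image[OF c U]])

lemma smooth_in_divide:
  fixes f g :: "_ \<Rightarrow> real"
  assumes "smooth_in c U f" "smooth_in c U g" "\<And>x. x \<in> dom_of c \<Longrightarrow> x \<in> U \<Longrightarrow> g x \<noteq> 0"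
  shows "smooth_in c U (\<lambda>x. f x / g x)"
  using assms(1,2) unfolding smooth_in_def o_def
  by (rule smooth_on_divide[OF open_image[OF c U]]) (auto simp: chart_inv_coord[OF c] assms(3))

lemma smooth_in_matrix_inv:
  fixes M :: "_ \<Rightarrow> real^'n^'n"
  assumes "\<And>i j. smooth_in c U (\<lambda>x. M x $ i $ j)"
    and "\<And>x. x \<in> dom_of c \<Longrightarrow> x \<in> U \<Longrightarrow> invertible (M x)"
  shows "smooth_in c U (\<lambda>x. matrix_inv (M x) $ k $ l)"
  using assms(1) unfolding smooth_in_def o_def
  by (rule smooth_on_matrix_inv[OF open_image[OF c U]]) (auto simp: chart_inv_coord[OF c] assms(2))

lemma smooth_in_pd: 
  assumes "smooth_in c U f" shows "smooth_in c U (pd c \<mu> f)"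
proof -
  have "axis \<mu> (1::real) \<in> Basis" by (auto simp: Basis_vec_def)
  from smooth_on_derivative[OF open_image[OF c U] assms[unfolded smooth_in_def] this]
  show ?thesis unfolding smooth_in_def
    by (rule smooth_on_cong[OF open_image[OF c U]]) (auto simp: pd_def chart_inv_coord[OF c])
qed

text \<open>A partial derivative depends only on the germ of the function. This makes it possible to
  differentiate identities that hold only in the domain of a chart or only on an open set.\<close>

lemma pd_cong:
  assumes "diff_at c x f" "x \<in> dom_of c" "x \<in> U" "\<And>y. y \<in> dom_of c \<Longrightarrow> y \<in> U \<Longrightarrow> f y = g y"
  shows "pd c \<mu> g x = pd c \<mu> f x" and "diff_at c x g"
proof -
  have "((\<lambda>y. g (chart_inv c y)) has_derivative frechet_derivative (f \<circ> chart_inv c) (at (coord c x))) (at (coord c x))"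
    by (rule has_derivative_transform_within_open[OF diff_at_has_derivative[OF assms(1)] open_image[OF c U]])
      (use assms(2-4) in \<open>auto simp: chart_inv_coord[OF c]\<close>)
  from pd_eqI[OF this] diff_atI[OF this]
  show "pd c \<mu> g x = pd c \<mu> f x" "diff_at c x g" by (simp_all add: pd_def)
qed

lemma pd_commute:
  fixes f :: "_ \<Rightarrow> real"
  assumes f: "smooth_in c U f" and x: "x \<in> dom_of c" "x \<in> U"
  shows "pd c \<mu> (pd c \<nu> f) x = pd c \<nu> (pd c \<mu> f) x"
proof -
  let ?f = "f \<circ> chart_inv c" and ?V = "coord c ` (dom_of c \<inter> U)"
  have b: "axis \<mu> (1::real) \<in> Basis" for \<mu> :: 4 by (auto simp: Basis_vec_def)
  have V: "open ?V" by (rule open_image[OF c U])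
  have f': "smooth_on ?V ?f" using f unfolding smooth_in_def .
  have xV: "coord c x \<in> ?V" using x by blast
  have "pd c \<mu> (pd c \<nu> f) x =
      frechet_derivative (\<lambda>y. frechet_derivative ?f (at y) (axis \<nu> 1)) (at (coord c x)) (axis \<mu> 1)" for \<mu> \<nu>
    unfolding pd_def[of c \<mu>]
  proof (rule fun_cong[OF frechet_derivative_transform_within_open[symmetric, OF _ V xV]])
    show "(\<lambda>y. frechet_derivative ?f (at y) (axis \<nu> 1)) differentiable at (coord c x)"
      using smooth_on_differentiable[OF V smooth_on_derivative[OF V f' b] xV] .
    show "frechet_derivative ?f (at y) (axis \<nu> 1) = (pd c \<nu> f \<circ> chart_inv c) y" if "y \<in> ?V" for y
      using that by (auto simp: pd_def chart_inv_coord[OF c])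
  qed
  then show ?thesis using second_derivative_symmetric[OF V f' xV b b] by simp
qed

end

lemmas smooth_in_arith = smooth_in_vec_lambda smooth_in_sum smooth_in_mult smooth_in_scaleR
  smooth_in_add smooth_in_diff smooth_in_const

lemma smooth_in_subset:
  assumes "c \<in> A" "open U" "dom_of c \<inter> U \<subseteq> V" "smooth_in c V f"
  shows "smooth_in c U f"
  using assms(4) unfolding smooth_in_def
  by (rule smooth_on_subset[OF open_image[OF assms(1,2)], rotated]) (use assms(3) in blast)

lemma smooth_in_coord:
  assumes "c \<in> A" "c' \<in> A" shows "smooth_in c (dom_of c') (coord c')"
  using atlas assms unfolding smooth_atlas_def smooth_in_def by blast

lemma jac_eq_pd:
  assumes c: "c \<in> A" "c' \<in> A" and x: "x \<in> dom_of c" "x \<in> dom_of c'"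
  shows "jac c c' x $ \<alpha> $ \<mu> = pd c \<mu> (\<lambda>y. coord c' y $ \<alpha>) x"
  using pd_nth[OF smooth_in_diff_at[OF c(1) open_dom[OF c(2)] smooth_in_coord[OF c] x]]
  by (simp add: jac_def matrix_def pd_def)

lemma smooth_in_jac:
  assumes c: "c \<in> A" "c' \<in> A"
  shows "smooth_in c (dom_of c') (\<lambda>y. jac c c' y $ \<alpha> $ \<mu>)"
  by (rule smooth_in_cong[OF c(1) open_dom[OF c(2)]
        smooth_in_pd[OF c(1) open_dom[OF c(2)] smooth_in_nth[OF c(1) open_dom[OF c(2)] smooth_in_coord[OF c]]]])
    (simp add: jac_eq_pd[OF c])

text \<open>The Jacobian consists of first derivatives of a coordinate change, so its derivatives are second
  derivatives. They are the terms that spoil the tensoriality of derivatives of components, and by their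
  symmetry they drop out of exterior derivatives.\<close>

lemma jac_derivative_symmetric:
  assumes c: "c \<in> A" "c' \<in> A" and x: "x \<in> dom_of c" "x \<in> dom_of c'"
  shows "pd c \<nu> (\<lambda>y. jac c c' y $ \<alpha> $ \<mu>) x = pd c \<mu> (\<lambda>y. jac c c' y $ \<alpha> $ \<nu>) x"
proof -
  note o = open_dom[OF c(2)]
  have s: "smooth_in c (dom_of c') (\<lambda>y. coord c' y $ \<alpha>)"
    by (rule smooth_in_nth[OF c(1) o smooth_in_coord[OF c]])
  have "pd c \<nu> (\<lambda>y. jac c c' y $ \<alpha> $ \<mu>) x = pd c \<nu> (pd c \<mu> (\<lambda>y. coord c' y $ \<alpha>)) x" for \<mu> \<nu>
    by (rule pd_cong(1)[OF c(1) o smooth_in_diff_at[OF c(1) o smooth_in_pd[OF c(1) o s] x] x])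
      (simp add: jac_eq_pd[OF c])
  then show ?thesis using pd_commute[OF c(1) o s x] by simp
qed

lemma
  assumes c: "c \<in> A" "c' \<in> A" and x: "x \<in> dom_of c" "x \<in> dom_of c'" and f: "diff_at c' x f"
  shows diff_at_chart_change: "diff_at c x f"
    and pd_chart_change: "pd c \<mu> f x = (\<Sum>\<alpha>\<in>UNIV. jac c c' x $ \<alpha> $ \<mu> *\<^sub>R pd c' \<alpha> f x)"
proof -
  let ?T = "coord c' \<circ> chart_inv c"
  let ?DT = "frechet_derivative ?T (at (coord c x))"
  let ?Df = "frechet_derivative (f \<circ> chart_inv c') (at (coord c' x))"
  have "diff_at c x (coord c')"
    by (rule smooth_in_diff_at[OF c(1) open_dom[OF c(2)] smooth_in_coord[OF c] x])
  note T = diff_at_has_derivative[OF this]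
  have "coord c' (chart_inv c (coord c x)) = coord c' x" by (simp add: chart_inv_coord c x)
  then have f': "((\<lambda>y. f (chart_inv c' y)) has_derivative ?Df) (at (coord c' (chart_inv c (coord c x))))"
    using diff_at_has_derivative[OF f] by simp
  have D: "((\<lambda>y. f (chart_inv c y)) has_derivative (\<lambda>e. ?Df (?DT e))) (at (coord c x))"
    by (rule has_derivative_transform_within_open[OF has_derivative_compose[OF T f']
          open_image[OF c(1) open_dom[OF c(2)]]]) (use x in \<open>auto simp: chart_inv_coord c\<close>)
  show "diff_at c x f" by (rule diff_atI[OF D])
  have l: "linear ?Df" using has_derivative_linear[OF diff_at_has_derivative[OF f]] .
  have "?DT (axis \<mu> 1) = (\<Sum>\<alpha>\<in>UNIV. jac c c' x $ \<alpha> $ \<mu> *\<^sub>R axis \<alpha> 1)"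
    by (simp add: vec_eq_iff jac_def matrix_def axis_def if_distrib cong: if_cong)
  then show "pd c \<mu> f x = (\<Sum>\<alpha>\<in>UNIV. jac c c' x $ \<alpha> $ \<mu> *\<^sub>R pd c' \<alpha> f x)"
    unfolding pd_eqI[OF D] by (simp add: linear_sum[OF l] linear_scale[OF l] pd_def)
qed

lemma jac_refl:
  assumes c: "c \<in> A" and x: "x \<in> dom_of c"
  shows "jac c c x = mat 1"
proof -
  have "((\<lambda>y. y) has_derivative (\<lambda>y. y)) (at (coord c x))" by (rule has_derivative_ident)
  then have "((\<lambda>y. coord c (chart_inv c y)) has_derivative (\<lambda>y. y)) (at (coord c x))"
    by (rule has_derivative_transform_within_open[OF _ open_image[OF c open_UNIV]])
      (use x in \<open>auto simp: chart_inv_coord c\<close>)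
  from frechet_derivative_at[OF this, symmetric] show ?thesis
    by (simp add: jac_def o_def matrix_def mat_def vec_eq_iff axis_def)
qed

lemma jac_trans:
  assumes c: "c \<in> A" "c' \<in> A" "c'' \<in> A" and x: "x \<in> dom_of c" "x \<in> dom_of c'" "x \<in> dom_of c''"
  shows "jac c c'' x = jac c' c'' x ** jac c c' x"
proof -
  have "diff_at c' x (\<lambda>y. coord c'' y $ \<beta>)" for \<beta>
    by (rule smooth_in_diff_at[OF c(2) open_dom[OF c(3)]
          smooth_in_nth[OF c(2) open_dom[OF c(3)] smooth_in_coord[OF c(2,3)]] x(2,3)])
  from pd_chart_change[OF c(1,2) x(1,2) this] show ?thesis
    by (simp add: vec_eq_iff matrix_matrix_mult_def jac_eq_pd c x mult.commute)
qed

lemma jac_inverse: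
  assumes c: "c \<in> A" "c' \<in> A" and x: "x \<in> dom_of c" "x \<in> dom_of c'"
  shows "jac c' c x ** jac c c' x = mat 1"
  using jac_trans[OF c c(1) x x(1)] jac_refl[OF c(1) x(1)] by simp

lemma jac_invertible:
  assumes c: "c \<in> A" "c' \<in> A" and x: "x \<in> dom_of c" "x \<in> dom_of c'"
  shows "invertible (jac c c' x)"
  unfolding invertible_def using jac_inverse[OF c x] jac_inverse[OF c(2,1) x(2,1)] by blast

end

section \<open>Pullback of forms by linear maps\<close>

abbreviation antisymmetric :: "real^'n^'n \<Rightarrow> bool" where
  "antisymmetric M \<equiv> transpose M = - M"

lemma antisymmetric_nth:
  assumes "antisymmetric M" shows "M $ a $ b = - M $ b $ a"
proof -
  have "transpose M $ b $ a = (- M) $ b $ a" using assms by (rule arg_cong)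
  then show ?thesis by (simp add: transpose_def)
qed

lemma antisymmetric_nth_diag:
  assumes "antisymmetric (M :: real^'n^'n)" shows "M $ a $ a = 0"
  using antisymmetric_nth[OF assms, of a a] by linarith

lemma antisymmetricI: "(\<And>a b. M $ a $ b = - M $ b $ a) \<Longrightarrow> antisymmetric M"
  unfolding vec_eq_iff transpose_def vec_lambda_beta vector_uminus_component by blast

lemma matrix_inv_unique:
  fixes M N :: "real^'n^'n"
  assumes "M ** N = mat 1" shows "matrix_inv M = N"
proof -
  have N: "N ** M = mat 1" using assms matrix_left_right_inverse by blast
  then have "invertible M" using assms by (auto simp: invertible_def)
  then have "N ** (M ** matrix_inv M) = N" by (simp add: matrix_inv_cancel)
  then show ?thesis by (simp add: matrix_mul_assoc N)
qed

text \<open>The columns of \<open>P\<close> are the images of the basis vectors. With \<open>P\<close> a Jacobian these maps are the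
  transformation laws of covariant tensors, with the columns of \<open>P\<close> a frame they give the components in this frame.\<close>

definition pull1 :: "real^'n^'n \<Rightarrow> real^'n \<Rightarrow> real^'n" where
  "pull1 P k = transpose P *v k"

definition pull2 :: "real^'n^'n \<Rightarrow> real^'n^'n \<Rightarrow> real^'n^'n" where
  "pull2 P M = transpose P ** M ** P"

definition pull3 :: "real^4^4 \<Rightarrow> (4 \<Rightarrow> 4 \<Rightarrow> 4 \<Rightarrow> real) \<Rightarrow> 4 \<Rightarrow> 4 \<Rightarrow> 4 \<Rightarrow> real" where
  "pull3 P T a b c = (\<Sum>\<mu>\<in>UNIV. \<Sum>\<nu>\<in>UNIV. \<Sum>\<rho>\<in>UNIV. P$\<mu>$a * P$\<nu>$b * P$\<rho>$c * T \<mu> \<nu> \<rho>)"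

abbreviation pullE1 :: "real^'n^'n \<Rightarrow> real^'n^3 \<Rightarrow> real^'n^3" where
  "pullE1 P a \<equiv> \<chi> i. pull1 P (a $ i)"

abbreviation pullE2 :: "real^'n^'n \<Rightarrow> real^'n^'n^3 \<Rightarrow> real^'n^'n^3" where
  "pullE2 P s \<equiv> \<chi> i. pull2 P (s $ i)"

lemma pull1_nth: "pull1 P k $ a = (\<Sum>\<mu>\<in>UNIV. P$\<mu>$a * k$\<mu>)"
  by (simp add: pull1_def matrix_vector_mult_def transpose_def)

lemma pull2_nth: "pull2 P M $ a $ b = (\<Sum>\<mu>\<in>UNIV. \<Sum>\<nu>\<in>UNIV. P$\<mu>$a * P$\<nu>$b * M$\<mu>$\<nu>)"
proof -
  have "pull2 P M $ a $ b = (\<Sum>\<nu>\<in>UNIV. \<Sum>\<mu>\<in>UNIV. P$\<mu>$a * P$\<nu>$b * M$\<mu>$\<nu>)"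
    by (simp add: pull2_def matrix_matrix_mult_def transpose_def sum_distrib_right sum_distrib_left mult_ac)
  also have "\<dots> = (\<Sum>\<mu>\<in>UNIV. \<Sum>\<nu>\<in>UNIV. P$\<mu>$a * P$\<nu>$b * M$\<mu>$\<nu>)"
    by (rule sum.swap)
  finally show ?thesis .
qed

lemma pull1_mult: "pull1 P (pull1 Q k) = pull1 (Q ** P) k"
  unfolding pull1_def matrix_vector_mul_assoc matrix_transpose_mul ..

lemma pull2_mult: "pull2 P (pull2 Q M) = pull2 (Q ** P) M"
  by (simp add: pull2_def matrix_mul_assoc matrix_transpose_mul)

lemma pull1_id [simp]: "pull1 (mat 1) k = k"
  by (simp add: pull1_def transpose_mat)

lemma pull2_id [simp]: "pull2 (mat 1) M = M"
  by (simp add: pull2_def transpose_mat)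

lemma pull2_antisymmetric:
  fixes M :: "real^'n^'n"
  assumes "antisymmetric M" shows "antisymmetric (pull2 P M)"
proof (rule antisymmetricI)
  fix a b
  have "pull2 P M $ a $ b = (\<Sum>\<nu>\<in>UNIV. \<Sum>\<mu>\<in>UNIV. P$\<mu>$a * P$\<nu>$b * M$\<mu>$\<nu>)"
    unfolding pull2_nth by (rule sum.swap)
  also have "\<dots> = (\<Sum>\<nu>\<in>UNIV. \<Sum>\<mu>\<in>UNIV. - (P$\<nu>$b * P$\<mu>$a * M$\<nu>$\<mu>))"
    by (subst antisymmetric_nth[OF assms]) (simp add: mult_ac)
  also have "\<dots> = - pull2 P M $ b $ a"
    unfolding pull2_nth by (simp only: sum_negf)
  finally show "pull2 P M $ a $ b = - pull2 P M $ b $ a" .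
qed

text \<open>The three ways to distribute four summation indices over two factors, as they occur in the wedge product of
  two 2-forms.\<close>

lemma sum_product4:
  fixes f g :: "'a::finite \<Rightarrow> 'a \<Rightarrow> real"
  shows "(\<Sum>a\<in>UNIV. \<Sum>b\<in>UNIV. f a b) * (\<Sum>c\<in>UNIV. \<Sum>d\<in>UNIV. g c d) =
      (\<Sum>a\<in>UNIV. \<Sum>b\<in>UNIV. \<Sum>c\<in>UNIV. \<Sum>d\<in>UNIV. f a b * g c d)" (is ?A)
    and "(\<Sum>a\<in>UNIV. \<Sum>c\<in>UNIV. f a c) * (\<Sum>b\<in>UNIV. \<Sum>d\<in>UNIV. g b d) =
      (\<Sum>a\<in>UNIV. \<Sum>b\<in>UNIV. \<Sum>c\<in>UNIV. \<Sum>d\<in>UNIV. f a c * g b d)" (is ?B)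
    and "(\<Sum>a\<in>UNIV. \<Sum>d\<in>UNIV. f a d) * (\<Sum>b\<in>UNIV. \<Sum>c\<in>UNIV. g b c) =
      (\<Sum>a\<in>UNIV. \<Sum>b\<in>UNIV. \<Sum>c\<in>UNIV. \<Sum>d\<in>UNIV. f a d * g b c)" (is ?C)
proof -
  have A: "(\<Sum>a\<in>UNIV. \<Sum>b\<in>UNIV. f a b) * (\<Sum>c\<in>UNIV. \<Sum>d\<in>UNIV. g c d) =
      (\<Sum>a\<in>UNIV. \<Sum>b\<in>UNIV. \<Sum>c\<in>UNIV. \<Sum>d\<in>UNIV. f a b * g c d)" for f g :: "'a \<Rightarrow> 'a \<Rightarrow> real"
    by (simp only: sum_distrib_right) (simp only: sum_distrib_left)
  show ?A by (rule A)
  have B: "(\<Sum>a\<in>UNIV. \<Sum>c\<in>UNIV. \<Sum>b\<in>UNIV. \<Sum>d\<in>UNIV. h a b c d) =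
      (\<Sum>a\<in>UNIV. \<Sum>b\<in>UNIV. \<Sum>c\<in>UNIV. \<Sum>d\<in>UNIV. h a b c d)" for h :: "'a \<Rightarrow> 'a \<Rightarrow> 'a \<Rightarrow> 'a \<Rightarrow> real"
    by (rule sum.cong[OF refl]) (rule sum.swap)
  show ?B unfolding A by (rule B)
  have "(\<Sum>a\<in>UNIV. \<Sum>d\<in>UNIV. \<Sum>b\<in>UNIV. \<Sum>c\<in>UNIV. f a d * g b c) =
      (\<Sum>a\<in>UNIV. \<Sum>b\<in>UNIV. \<Sum>d\<in>UNIV. \<Sum>c\<in>UNIV. f a d * g b c)"
    by (rule B)
  also have "\<dots> = (\<Sum>a\<in>UNIV. \<Sum>b\<in>UNIV. \<Sum>c\<in>UNIV. \<Sum>d\<in>UNIV. f a d * g b c)"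
    by (rule sum.cong[OF refl], rule sum.cong[OF refl]) (rule sum.swap)
  finally show ?C unfolding A .
qed

abbreviation top_wedge :: "real^4^4 \<Rightarrow> real^4^4 \<Rightarrow> real" where
  "top_wedge \<alpha> \<beta> \<equiv> wedge22 \<alpha> \<beta> 1 2 3 4"

lemma top_wedge_pull2_sum:
  "top_wedge (pull2 P \<alpha>) (pull2 P \<beta>) =
    (\<Sum>\<mu>\<in>UNIV. \<Sum>\<nu>\<in>UNIV. \<Sum>\<rho>\<in>UNIV. \<Sum>\<tau>\<in>UNIV.
      P$\<mu>$1 * P$\<nu>$2 * P$\<rho>$3 * P$\<tau>$4 * wedge22 \<alpha> \<beta> \<mu> \<nu> \<rho> \<tau>)"
proof -
  have 1: "(\<Sum>\<mu>\<in>UNIV. \<Sum>\<nu>\<in>UNIV. P$\<mu>$1 * P$\<nu>$2 * \<alpha>$\<mu>$\<nu>) * (\<Sum>\<rho>\<in>UNIV. \<Sum>\<tau>\<in>UNIV. P$\<rho>$3 * P$\<tau>$4 * \<beta>$\<rho>$\<tau>) =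
      (\<Sum>\<mu>\<in>UNIV. \<Sum>\<nu>\<in>UNIV. \<Sum>\<rho>\<in>UNIV. \<Sum>\<tau>\<in>UNIV. P$\<mu>$1 * P$\<nu>$2 * P$\<rho>$3 * P$\<tau>$4 * (\<alpha>$\<mu>$\<nu> * \<beta>$\<rho>$\<tau>))" for \<alpha> \<beta>
    unfolding sum_product4(1) by (simp only: mult_ac)
  have 2: "(\<Sum>\<mu>\<in>UNIV. \<Sum>\<rho>\<in>UNIV. P$\<mu>$1 * P$\<rho>$3 * \<alpha>$\<mu>$\<rho>) * (\<Sum>\<nu>\<in>UNIV. \<Sum>\<tau>\<in>UNIV. P$\<nu>$2 * P$\<tau>$4 * \<beta>$\<nu>$\<tau>) =
      (\<Sum>\<mu>\<in>UNIV. \<Sum>\<nu>\<in>UNIV. \<Sum>\<rho>\<in>UNIV. \<Sum>\<tau>\<in>UNIV. P$\<mu>$1 * P$\<nu>$2 * P$\<rho>$3 * P$\<tau>$4 * (\<alpha>$\<mu>$\<rho> * \<beta>$\<nu>$\<tau>))" for \<alpha> \<beta>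
    unfolding sum_product4(2) by (simp only: mult_ac)
  have 3: "(\<Sum>\<mu>\<in>UNIV. \<Sum>\<tau>\<in>UNIV. P$\<mu>$1 * P$\<tau>$4 * \<alpha>$\<mu>$\<tau>) * (\<Sum>\<nu>\<in>UNIV. \<Sum>\<rho>\<in>UNIV. P$\<nu>$2 * P$\<rho>$3 * \<beta>$\<nu>$\<rho>) =
      (\<Sum>\<mu>\<in>UNIV. \<Sum>\<nu>\<in>UNIV. \<Sum>\<rho>\<in>UNIV. \<Sum>\<tau>\<in>UNIV. P$\<mu>$1 * P$\<nu>$2 * P$\<rho>$3 * P$\<tau>$4 * (\<alpha>$\<mu>$\<tau> * \<beta>$\<nu>$\<rho>))" for \<alpha> \<beta>
    unfolding sum_product4(3) by (simp only: mult_ac)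
  have w: "wedge22 \<alpha> \<beta> \<mu> \<nu> \<rho> \<tau> = \<alpha>$\<mu>$\<nu> * \<beta>$\<rho>$\<tau> - \<alpha>$\<mu>$\<rho> * \<beta>$\<nu>$\<tau> + \<alpha>$\<mu>$\<tau> * \<beta>$\<nu>$\<rho>
      + \<beta>$\<mu>$\<tau> * \<alpha>$\<nu>$\<rho> - \<beta>$\<mu>$\<rho> * \<alpha>$\<nu>$\<tau> + \<beta>$\<mu>$\<nu> * \<alpha>$\<rho>$\<tau>" for \<alpha> \<beta> \<mu> \<nu> \<rho> \<tau>
    by (simp add: wedge22_def)
  show ?thesis
    unfolding w pull2_nth 1 2 3 by (simp only: distrib_left right_diff_distrib sum.distrib sum_subtractf)
qed

text \<open>The forms \<open>e12\<close> and \<open>e34\<close> serve to express one 4-form with component \<open>1\<close> as a wedge product: every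
  other 4-form is a multiple of theirs.\<close>

definition e12 :: "real^4^4" where
  "e12 = (\<chi> \<mu> \<nu>. if (\<mu>, \<nu>) = (1, 2) then 1 else if (\<mu>, \<nu>) = (2, 1) then -1 else 0)"
definition e34 :: "real^4^4" where
  "e34 = (\<chi> \<mu> \<nu>. if (\<mu>, \<nu>) = (3, 4) then 1 else if (\<mu>, \<nu>) = (4, 3) then -1 else 0)"

text \<open>The space of 4-forms in dimension four is one-dimensional; the second factor on the right is the
  Levi-Civita symbol.\<close>

lemma wedge22_proportional:
  assumes "antisymmetric \<alpha>" "antisymmetric \<beta>"
  shows "wedge22 \<alpha> \<beta> \<mu> \<nu> \<rho> \<tau> = top_wedge \<alpha> \<beta> * wedge22 e12 e34 \<mu> \<nu> \<rho> \<tau>"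
proof -
  note a = antisymmetric_nth_diag[OF assms(1)] antisymmetric_nth_diag[OF assms(2)]
    antisymmetric_nth[OF assms(1), of 2 1] antisymmetric_nth[OF assms(1), of 3 1]
    antisymmetric_nth[OF assms(1), of 4 1] antisymmetric_nth[OF assms(1), of 3 2]
    antisymmetric_nth[OF assms(1), of 4 2] antisymmetric_nth[OF assms(1), of 4 3]
    antisymmetric_nth[OF assms(2), of 2 1] antisymmetric_nth[OF assms(2), of 3 1]
    antisymmetric_nth[OF assms(2), of 4 1] antisymmetric_nth[OF assms(2), of 3 2]
    antisymmetric_nth[OF assms(2), of 4 2] antisymmetric_nth[OF assms(2), of 4 3]
  have "\<forall>\<mu> \<nu> \<rho> \<tau>. wedge22 \<alpha> \<beta> \<mu> \<nu> \<rho> \<tau> = top_wedge \<alpha> \<beta> * wedge22 e12 e34 \<mu> \<nu> \<rho> \<tau>"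
    unfolding forall_4 by (simp add: wedge22_def e12_def e34_def a[simplified])
  then show ?thesis by blast
qed

text \<open>This is the determinant of \<open>P\<close>, in the form in which it enters wedge products of 2-forms: they
  are multiplied by it.\<close>

definition pull_factor :: "real^4^4 \<Rightarrow> real" where
  "pull_factor P = top_wedge (pull2 P e12) (pull2 P e34)"

lemma top_wedge_pull2:
  assumes "antisymmetric \<alpha>" "antisymmetric \<beta>"
  shows "top_wedge (pull2 P \<alpha>) (pull2 P \<beta>) = pull_factor P * top_wedge \<alpha> \<beta>"
  unfolding top_wedge_pull2_sum pull_factor_def
  by (subst wedge22_proportional[OF assms]) (simp add: sum_distrib_left mult_ac)

lemma pull_factor_nonzero:
  assumes "P ** Q = mat 1" shows "pull_factor P \<noteq> 0"
proof
  assume 0: "pull_factor P = 0"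
  have a: "antisymmetric e12" "antisymmetric e34"
    by (rule antisymmetricI, simp add: e12_def)+ (rule antisymmetricI, simp add: e34_def)
  have "top_wedge e12 e34 = top_wedge (pull2 Q (pull2 P e12)) (pull2 Q (pull2 P e34))"
    unfolding pull2_mult assms by simp
  also have "\<dots> = pull_factor Q * (pull_factor P * top_wedge e12 e34)"
    by (simp only: top_wedge_pull2 pull2_antisymmetric a)
  also have "\<dots> = 0" using 0 by simp
  finally show False by (simp add: wedge22_def e12_def e34_def)
qed

section \<open>Three-forms and the equation for the connection\<close>

definition alternating3 :: "(4 \<Rightarrow> 4 \<Rightarrow> 4 \<Rightarrow> real) \<Rightarrow> bool" where
  "alternating3 T \<longleftrightarrow> (\<forall>\<mu> \<nu> \<rho>. T \<nu> \<mu> \<rho> = - T \<mu> \<nu> \<rho> \<and> T \<mu> \<rho> \<nu> = - T \<mu> \<nu> \<rho>)"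

lemma alternating3D:
  assumes "alternating3 T" shows "T \<nu> \<mu> \<rho> = - T \<mu> \<nu> \<rho>" "T \<mu> \<rho> \<nu> = - T \<mu> \<nu> \<rho>"
  using assms unfolding alternating3_def by blast+

lemma alternating3_diag:
  assumes "alternating3 T" shows "T \<mu> \<mu> \<rho> = 0" "T \<mu> \<rho> \<rho> = 0" "T \<mu> \<rho> \<mu> = 0"
  using alternating3D(1)[OF assms, of \<mu> \<mu> \<rho>] alternating3D(2)[OF assms, of \<mu> \<rho> \<rho>]
    alternating3D(2)[OF assms, of \<mu> \<mu> \<rho>] by linarith+

lemma alternating3_zeroI:
  assumes T: "alternating3 T" and "T 1 2 3 = 0" "T 1 2 4 = 0" "T 1 3 4 = 0" "T 2 3 4 = 0"
  shows "T \<mu> \<nu> \<rho> = 0"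
proof -
  have *: "T a b c = 0 \<Longrightarrow> T b a c = 0 \<and> T a c b = 0 \<and> T b c a = 0 \<and> T c a b = 0 \<and> T c b a = 0" for a b c
    using alternating3D(1)[OF T, of a b c] alternating3D(2)[OF T, of a b c]
      alternating3D(2)[OF T, of b a c] alternating3D(1)[OF T, of a c b] alternating3D(2)[OF T, of c a b] by linarith
  have "\<forall>\<mu> \<nu> \<rho>. T \<mu> \<nu> \<rho> = 0"
    unfolding forall_4 using assms(2-5)[THEN *] assms(2-5) alternating3_diag[OF T] by blast
  then show ?thesis by blast
qed

definition wedge12 :: "real^4 \<Rightarrow> real^4^4 \<Rightarrow> 4 \<Rightarrow> 4 \<Rightarrow> 4 \<Rightarrow> real" where
  "wedge12 a s \<mu> \<nu> \<rho> = a$\<mu> * s$\<nu>$\<rho> + a$\<nu> * s$\<rho>$\<mu> + a$\<rho> * s$\<mu>$\<nu>"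

lemma wedge12_alternating:
  assumes "antisymmetric s" shows "alternating3 (wedge12 a s)"
  unfolding alternating3_def wedge12_def
proof (intro allI conjI)
  fix \<mu> \<nu> \<rho>
  have e: "s$\<nu>$\<mu> = - s$\<mu>$\<nu>" "s$\<rho>$\<mu> = - s$\<mu>$\<rho>" "s$\<rho>$\<nu> = - s$\<nu>$\<rho>"
    by (rule antisymmetric_nth[OF assms])+
  show "a$\<nu> * s$\<mu>$\<rho> + a$\<mu> * s$\<rho>$\<nu> + a$\<rho> * s$\<nu>$\<mu> = - (a$\<mu> * s$\<nu>$\<rho> + a$\<nu> * s$\<rho>$\<mu> + a$\<rho> * s$\<mu>$\<nu>)"
    "a$\<mu> * s$\<rho>$\<nu> + a$\<rho> * s$\<nu>$\<mu> + a$\<nu> * s$\<mu>$\<rho> = - (a$\<mu> * s$\<nu>$\<rho> + a$\<nu> * s$\<rho>$\<mu> + a$\<rho> * s$\<mu>$\<nu>)"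
    unfolding e by simp_all
qed

lemma sum_product3:
  fixes f :: "'a::finite \<Rightarrow> real" and g :: "'a \<Rightarrow> 'a \<Rightarrow> real"
  shows "(\<Sum>a\<in>UNIV. f a) * (\<Sum>b\<in>UNIV. \<Sum>c\<in>UNIV. g b c) = (\<Sum>a\<in>UNIV. \<Sum>b\<in>UNIV. \<Sum>c\<in>UNIV. f a * g b c)" (is ?A)
    and "(\<Sum>b\<in>UNIV. f b) * (\<Sum>c\<in>UNIV. \<Sum>a\<in>UNIV. g c a) = (\<Sum>a\<in>UNIV. \<Sum>b\<in>UNIV. \<Sum>c\<in>UNIV. f b * g c a)" (is ?B)
    and "(\<Sum>c\<in>UNIV. f c) * (\<Sum>a\<in>UNIV. \<Sum>b\<in>UNIV. g a b) = (\<Sum>a\<in>UNIV. \<Sum>b\<in>UNIV. \<Sum>c\<in>UNIV. f c * g a b)" (is ?C)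
proof -
  have A: "(\<Sum>a\<in>UNIV. f a) * (\<Sum>b\<in>UNIV. \<Sum>c\<in>UNIV. g b c) = (\<Sum>a\<in>UNIV. \<Sum>b\<in>UNIV. \<Sum>c\<in>UNIV. f a * g b c)"
    for f :: "'a \<Rightarrow> real" and g
    by (simp only: sum_distrib_right) (simp only: sum_distrib_left)
  show ?A by (rule A)
  have "(\<Sum>c\<in>UNIV. f c) * (\<Sum>a\<in>UNIV. \<Sum>b\<in>UNIV. g a b) = (\<Sum>a\<in>UNIV. \<Sum>c\<in>UNIV. \<Sum>b\<in>UNIV. f c * g a b)"
    unfolding A by (rule sum.swap)
  also have "\<dots> = (\<Sum>a\<in>UNIV. \<Sum>b\<in>UNIV. \<Sum>c\<in>UNIV. f c * g a b)"
    by (rule sum.cong[OF refl]) (rule sum.swap)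
  finally show ?C .
  have "(\<Sum>b\<in>UNIV. f b) * (\<Sum>c\<in>UNIV. \<Sum>a\<in>UNIV. g c a) = (\<Sum>b\<in>UNIV. \<Sum>a\<in>UNIV. \<Sum>c\<in>UNIV. f b * g c a)"
    unfolding A by (rule sum.cong[OF refl]) (rule sum.swap)
  also have "\<dots> = (\<Sum>a\<in>UNIV. \<Sum>b\<in>UNIV. \<Sum>c\<in>UNIV. f b * g c a)"
    by (rule sum.swap)
  finally show ?B .
qed

lemma wedge12_pull: "wedge12 (pull1 P a) (pull2 P s) = pull3 P (wedge12 a s)"
proof (intro ext)
  fix x y z
  have 1: "(\<Sum>\<mu>\<in>UNIV. P$\<mu>$x * a$\<mu>) * (\<Sum>\<nu>\<in>UNIV. \<Sum>\<rho>\<in>UNIV. P$\<nu>$y * P$\<rho>$z * s$\<nu>$\<rho>) =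
      (\<Sum>\<mu>\<in>UNIV. \<Sum>\<nu>\<in>UNIV. \<Sum>\<rho>\<in>UNIV. P$\<mu>$x * P$\<nu>$y * P$\<rho>$z * (a$\<mu> * s$\<nu>$\<rho>))"
    unfolding sum_product3(1) by (simp only: mult_ac)
  have 2: "(\<Sum>\<nu>\<in>UNIV. P$\<nu>$y * a$\<nu>) * (\<Sum>\<rho>\<in>UNIV. \<Sum>\<mu>\<in>UNIV. P$\<rho>$z * P$\<mu>$x * s$\<rho>$\<mu>) =
      (\<Sum>\<mu>\<in>UNIV. \<Sum>\<nu>\<in>UNIV. \<Sum>\<rho>\<in>UNIV. P$\<mu>$x * P$\<nu>$y * P$\<rho>$z * (a$\<nu> * s$\<rho>$\<mu>))"
    unfolding sum_product3(2) by (simp only: mult_ac)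
  have 3: "(\<Sum>\<rho>\<in>UNIV. P$\<rho>$z * a$\<rho>) * (\<Sum>\<mu>\<in>UNIV. \<Sum>\<nu>\<in>UNIV. P$\<mu>$x * P$\<nu>$y * s$\<mu>$\<nu>) =
      (\<Sum>\<mu>\<in>UNIV. \<Sum>\<nu>\<in>UNIV. \<Sum>\<rho>\<in>UNIV. P$\<mu>$x * P$\<nu>$y * P$\<rho>$z * (a$\<rho> * s$\<mu>$\<nu>))"
    unfolding sum_product3(3) by (simp only: mult_ac)
  show "wedge12 (pull1 P a) (pull2 P s) x y z = pull3 P (wedge12 a s) x y z"
    unfolding wedge12_def pull3_def pull1_nth pull2_nth 1 2 3
    by (simp only: distrib_left sum.distrib)
qed

lemma pull3_add: "pull3 P (\<lambda>\<mu> \<nu> \<rho>. T \<mu> \<nu> \<rho> + T' \<mu> \<nu> \<rho>) a b c = pull3 P T a b c + pull3 P T' a b c"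
  by (simp add: pull3_def distrib_left sum.distrib)

lemma pull3_scale: "pull3 P (\<lambda>\<mu> \<nu> \<rho>. r * T \<mu> \<nu> \<rho>) a b c = r * pull3 P T a b c"
  unfolding pull3_def sum_distrib_left by (simp only: mult_ac)

lemma pull3_zero: "pull3 P (\<lambda>\<mu> \<nu> \<rho>. 0) a b c = 0"
  by (simp add: pull3_def)

lemma pull3_sum:
  "finite I \<Longrightarrow> pull3 P (\<lambda>\<mu> \<nu> \<rho>. \<Sum>i\<in>I. T i \<mu> \<nu> \<rho>) a b c = (\<Sum>i\<in>I. pull3 P (T i) a b c)"
  by (induction I rule: finite_induct) (simp_all add: pull3_zero pull3_add)

text \<open>The equation \<open>T\<^sup>i + \<epsilon>\<^sup>i\<^sup>j\<^sup>k a\<^sup>j \<and> S\<^sup>k = 0\<close> for an \<open>E\<close>-valued 1-form \<open>a\<close>. With \<open>T = d\<sigma>\<close> it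
  characterises \<open>a = d2 \<sigma>\<close>, with \<open>T = k \<and> s\<close> it characterises the principal symbol of \<open>d2\<close>. No metric
  enters, so the equation is natural under all linear maps.\<close>

definition connection_eq :: "real^4^4^3 \<Rightarrow> (3 \<Rightarrow> 4 \<Rightarrow> 4 \<Rightarrow> 4 \<Rightarrow> real) \<Rightarrow> real^4^3 \<Rightarrow> bool" where
  "connection_eq S T a \<longleftrightarrow> (\<forall>i \<mu> \<nu> \<rho>.
    T i \<mu> \<nu> \<rho> + (\<Sum>j\<in>UNIV. \<Sum>k\<in>UNIV. eps i j k * wedge12 (a $ j) (S $ k) \<mu> \<nu> \<rho>) = 0)"

lemma connection_eq_pull:
  assumes "connection_eq S T a"
  shows "connection_eq (pullE2 P S) (\<lambda>i. pull3 P (T i)) (pullE1 P a)"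
  unfolding connection_eq_def
proof (intro allI)
  fix i \<mu> \<nu> \<rho>
  have "pull3 P (T i) \<mu> \<nu> \<rho> + (\<Sum>j\<in>UNIV. \<Sum>k\<in>UNIV. eps i j k * wedge12 (pullE1 P a $ j) (pullE2 P S $ k) \<mu> \<nu> \<rho>) =
    pull3 P (\<lambda>\<mu> \<nu> \<rho>. T i \<mu> \<nu> \<rho> + (\<Sum>j\<in>UNIV. \<Sum>k\<in>UNIV. eps i j k * wedge12 (a $ j) (S $ k) \<mu> \<nu> \<rho>)) \<mu> \<nu> \<rho>"
    by (simp add: pull3_add pull3_sum pull3_scale wedge12_pull)
  also have "\<dots> = 0" using assms by (simp add: connection_eq_def pull3_zero)
  finally show "pull3 P (T i) \<mu> \<nu> \<rho> + (\<Sum>j\<in>UNIV. \<Sum>k\<in>UNIV. eps i j k * wedge12 (pullE1 P a $ j) (pullE2 P S $ k) \<mu> \<nu> \<rho>) = 0" .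
qed

text \<open>The pointwise conditions that suffice to bring the triple and the metric into a normal form.\<close>

definition quaternionic :: "real^4^4^3 \<Rightarrow> real^4^4 \<Rightarrow> bool" where
  "quaternionic S G \<longleftrightarrow> transpose G = G \<and> (\<forall>u. u \<noteq> 0 \<longrightarrow> u \<bullet> (G *v u) > 0) \<and>
    (\<forall>i. antisymmetric (S $ i)) \<and>
    (\<forall>i j. raised S G i ** raised S G j = - kronecker i j *\<^sub>R mat 1 + (\<Sum>k\<in>UNIV. eps i j k *\<^sub>R raised S G k))"

lemma posdef_invertible:
  fixes G :: "real^'n^'n"
  assumes "\<forall>u. u \<noteq> 0 \<longrightarrow> u \<bullet> (G *v u) > 0" shows "invertible G"
proof -
  have "G *v u = 0 \<Longrightarrow> u = 0" for u using assms[rule_format, of u] by fastforce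
  then show ?thesis
    using invertible_left_inverse matrix_left_invertible_ker by blast
qed

lemma quaternionicD:
  assumes "quaternionic S G"
  shows "transpose G = G" "\<And>u. u \<noteq> 0 \<Longrightarrow> u \<bullet> (G *v u) > 0" "antisymmetric (S $ i)"
    "raised S G i ** raised S G j = - kronecker i j *\<^sub>R mat 1 + (\<Sum>k\<in>UNIV. eps i j k *\<^sub>R raised S G k)"
    "invertible G"
  using assms posdef_invertible[of G] unfolding quaternionic_def by blast+

lemma J1_nth: "J1 S G a $ i = (\<Sum>j\<in>UNIV. \<Sum>k\<in>UNIV. eps i j k *\<^sub>R (raised S G j *v (a $ k)))"
  by (simp add: vec_eq_iff J1_def matrix_vector_mult_def sum_distrib_left mult_ac)

lemma J1_linear: "linear (J1 S G)"
proof
  show "J1 S G (a + b) = J1 S G a + J1 S G b" for a b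
    by (simp add: vec_eq_iff J1_def distrib_left sum.distrib)
  show "J1 S G (r *\<^sub>R a) = r *\<^sub>R J1 S G a" for r a
    by (simp add: vec_eq_iff J1_def sum_distrib_left mult_ac)
qed

lemma raised_mult:
  assumes "quaternionic S G"
  shows "raised S G i *v (raised S G j *v u) =
    - kronecker i j *\<^sub>R u + (\<Sum>k\<in>UNIV. eps i j k *\<^sub>R (raised S G k *v u))"
  unfolding matrix_vector_mul_assoc quaternionicD(4)[OF assms]
  by (simp add: matrix_vector_mult_add_rdistrib matrix_vector_mult_diff_rdistrib scaleR_matrix_vector_assoc[symmetric] sum_3)

text \<open>The identity \<open>\<epsilon>\<^sup>i\<^sup>j\<^sup>k \<epsilon>\<^sup>k\<^sup>l\<^sup>m = \<delta>\<^sup>i\<^sup>l \<delta>\<^sup>j\<^sup>m - \<delta>\<^sup>i\<^sup>m \<delta>\<^sup>j\<^sup>l\<close> turns the square into products of two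
  complex structures, which the quaternion relations reduce.\<close>

lemma J1_square:
  assumes "quaternionic S G" shows "J1 S G (J1 S G a) = 2 *\<^sub>R a + J1 S G a"
proof -
  have neg: "M *v (- x) = - (M *v x)" for M :: "real^4^4" and x
    by (simp add: vec_eq_iff matrix_vector_mult_def sum_negf)
  have "\<forall>i. J1 S G (J1 S G a) $ i = (2 *\<^sub>R a + J1 S G a) $ i"
    unfolding forall_3
    by (simp add: J1_nth sum_3 eps_def raised_mult[OF assms] kronecker_def matrix_vector_right_distrib
        matrix_vector_mult_diff_distrib neg scaleR_2)
  then show ?thesis by (simp add: vec_eq_iff)
qed

lemma
  assumes "quaternionic S G"
  shows inv_J1: "inv (J1 S G) = (\<lambda>a. (1/2) *\<^sub>R (J1 S G a - a))"
    and inv_J1_J1: "inv (J1 S G) (J1 S G a) = a"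
proof -
  show *: "inv (J1 S G) = (\<lambda>a. (1/2) *\<^sub>R (J1 S G a - a))"
  proof (rule inv_equality)
    fix a
    show "(1/2) *\<^sub>R (J1 S G (J1 S G a) - J1 S G a) = a"
      by (simp add: J1_square[OF assms])
    show "J1 S G ((1/2) *\<^sub>R (J1 S G a - a)) = a"
      by (simp add: linear_scale[OF J1_linear] linear_diff[OF J1_linear] J1_square[OF assms])
  qed
  show "inv (J1 S G) (J1 S G a) = a"
    unfolding * by (simp add: J1_square[OF assms])
qed

definition self_dual :: "real^4^4^3 \<Rightarrow> real^4^4 \<Rightarrow> bool" where
  "self_dual S G \<longleftrightarrow> (\<forall>i \<mu> \<nu>. S $ i $ \<mu> $ \<nu> =
    (1/2) * (\<Sum>\<alpha>\<in>UNIV. \<Sum>\<beta>\<in>UNIV. \<Sum>\<rho>\<in>UNIV. \<Sum>\<tau>\<in>UNIV.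
      vol S \<mu> \<nu> \<alpha> \<beta> * matrix_inv G $ \<alpha> $ \<rho> * matrix_inv G $ \<beta> $ \<tau> * S $ i $ \<rho> $ \<tau>))"

text \<open>The algebraic operation in \<open>\<star>d\<sigma>\<close>: \<open>Q \<alpha>\<close> stands for the derivative of \<open>\<sigma>\<close> in direction \<open>\<alpha>\<close>, or for
  \<open>k\<^sub>\<alpha> \<sigma>\<close>. The volume form has its last three indices raised, which is a pullback by the inverse metric.\<close>

definition star3 :: "real^4^4^3 \<Rightarrow> real^4^4 \<Rightarrow> (4 \<Rightarrow> real^4^4^3) \<Rightarrow> real^4^3" where
  "star3 S G Q = (\<chi> i \<mu>. \<Sum>\<alpha>\<in>UNIV. \<Sum>\<beta>\<in>UNIV. \<Sum>\<gamma>\<in>UNIV.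
    pull3 (matrix_inv G) (vol S \<mu>) \<alpha> \<beta> \<gamma> * Q \<alpha> $ i $ \<beta> $ \<gamma>)"

text \<open>If \<open>Q \<alpha>\<close> is the derivative of \<open>\<sigma>\<close> in direction \<open>\<alpha>\<close>, then these are the components of the 3-forms
  \<open>d\<sigma>\<^sup>i\<close>.\<close>

definition cyclic :: "(4 \<Rightarrow> real^4^4^3) \<Rightarrow> 3 \<Rightarrow> 4 \<Rightarrow> 4 \<Rightarrow> 4 \<Rightarrow> real" where
  "cyclic Q i \<mu> \<nu> \<rho> = Q \<mu> $ i $ \<nu> $ \<rho> + Q \<nu> $ i $ \<rho> $ \<mu> + Q \<rho> $ i $ \<mu> $ \<nu>"

lemma vol_alternating:
  assumes "\<And>i. antisymmetric (S $ i)" shows "alternating3 (vol S \<mu>)"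
  unfolding alternating3_def
proof (intro allI conjI)
  fix \<nu> \<kappa> \<rho>
  have e: "S$i$\<kappa>$\<nu> = - S$i$\<nu>$\<kappa>" "S$i$\<rho>$\<kappa> = - S$i$\<kappa>$\<rho>" for i
    by (rule antisymmetric_nth[OF assms])+
  have 1: "wedge22 (S$i) (S$i) \<mu> \<kappa> \<nu> \<rho> = - wedge22 (S$i) (S$i) \<mu> \<nu> \<kappa> \<rho>"
    and 2: "wedge22 (S$i) (S$i) \<mu> \<nu> \<rho> \<kappa> = - wedge22 (S$i) (S$i) \<mu> \<nu> \<kappa> \<rho>" for i
    unfolding wedge22_def e by simp_all
  show "vol S \<mu> \<kappa> \<nu> \<rho> = - vol S \<mu> \<nu> \<kappa> \<rho>"
    unfolding vol_def 1 sum_negf by simp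
  show "vol S \<mu> \<nu> \<rho> \<kappa> = - vol S \<mu> \<nu> \<kappa> \<rho>"
    unfolding vol_def 2 sum_negf by simp
qed

lemma pull3_alternating:
  assumes T: "alternating3 T" shows "alternating3 (pull3 P T)"
  unfolding alternating3_def
proof (intro allI conjI)
  fix a b c
  have "pull3 P T b a c = (\<Sum>\<mu>\<in>UNIV. \<Sum>\<nu>\<in>UNIV. \<Sum>\<rho>\<in>UNIV. P$\<nu>$b * P$\<mu>$a * P$\<rho>$c * T \<nu> \<mu> \<rho>)"
    unfolding pull3_def by (rule sum.swap)
  also have "\<dots> = - pull3 P T a b c"
    unfolding pull3_def sum_negf[symmetric] by (subst alternating3D(1)[OF T]) (simp add: mult_ac)
  finally show "pull3 P T b a c = - pull3 P T a b c" .
  have "pull3 P T a c b = (\<Sum>\<mu>\<in>UNIV. \<Sum>\<nu>\<in>UNIV. \<Sum>\<rho>\<in>UNIV. P$\<mu>$a * P$\<rho>$c * P$\<nu>$b * T \<mu> \<rho> \<nu>)"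
    unfolding pull3_def by (rule sum.cong[OF refl]) (rule sum.swap)
  also have "\<dots> = - pull3 P T a b c"
    unfolding pull3_def sum_negf[symmetric] by (subst alternating3D(2)[OF T]) (simp add: mult_ac)
  finally show "pull3 P T a c b = - pull3 P T a b c" .
qed

lemma sum_rotate3:
  "(\<Sum>a\<in>UNIV. \<Sum>b\<in>UNIV. \<Sum>c\<in>UNIV. f b c a) = (\<Sum>a\<in>UNIV. \<Sum>b\<in>UNIV. \<Sum>c\<in>UNIV. f a b c :: real)"
proof -
  have "(\<Sum>a\<in>UNIV. \<Sum>b\<in>UNIV. \<Sum>c\<in>UNIV. f b c a) = (\<Sum>b\<in>UNIV. \<Sum>a\<in>UNIV. \<Sum>c\<in>UNIV. f b c a)"
    by (rule sum.swap)
  also have "\<dots> = (\<Sum>b\<in>UNIV. \<Sum>c\<in>UNIV. \<Sum>a\<in>UNIV. f b c a)"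
    by (rule sum.cong[OF refl]) (rule sum.swap)
  finally show ?thesis .
qed

text \<open>Contraction with an alternating tensor does not change under cyclic permutations of the other factor.\<close>

lemma sum_alternating_cyclic:
  fixes q :: "4 \<Rightarrow> 4 \<Rightarrow> 4 \<Rightarrow> real"
  assumes V: "alternating3 V"
  shows "(\<Sum>a\<in>UNIV. \<Sum>b\<in>UNIV. \<Sum>c\<in>UNIV. V a b c * (q a b c + q b c a + q c a b)) =
    3 * (\<Sum>a\<in>UNIV. \<Sum>b\<in>UNIV. \<Sum>c\<in>UNIV. V a b c * q a b c)"
proof -
  have cyc: "V a b c = V b c a" for a b c
    using alternating3D(1)[OF V, of a b c] alternating3D(2)[OF V, of b a c] by simp
  have 1: "(\<Sum>a\<in>UNIV. \<Sum>b\<in>UNIV. \<Sum>c\<in>UNIV. V a b c * q b c a) = (\<Sum>a\<in>UNIV. \<Sum>b\<in>UNIV. \<Sum>c\<in>UNIV. V a b c * q a b c)"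
    by (subst cyc) (rule sum_rotate3[of "\<lambda>a b c. V a b c * q a b c"])
  have 2: "(\<Sum>a\<in>UNIV. \<Sum>b\<in>UNIV. \<Sum>c\<in>UNIV. V a b c * q c a b) = (\<Sum>a\<in>UNIV. \<Sum>b\<in>UNIV. \<Sum>c\<in>UNIV. V a b c * q a b c)"
    using sum_rotate3[of "\<lambda>a b c. V a b c * q c a b"] by (simp only: cyc[symmetric])
  show ?thesis by (simp add: distrib_left sum.distrib 1 2)
qed

lemma sum_move_inner:
  "(\<Sum>b\<in>UNIV. \<Sum>c\<in>UNIV. \<Sum>k\<in>UNIV. \<Sum>r\<in>UNIV. \<Sum>t\<in>UNIV. f b c k r t) =
    (\<Sum>k\<in>UNIV. \<Sum>r\<in>UNIV. \<Sum>t\<in>UNIV. \<Sum>b\<in>UNIV. \<Sum>c\<in>UNIV. f b c k r t :: real)"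
proof -
  have *: "(\<Sum>c\<in>UNIV. \<Sum>k\<in>UNIV. \<Sum>r\<in>UNIV. \<Sum>t\<in>UNIV. h c k r t) =
    (\<Sum>k\<in>UNIV. \<Sum>r\<in>UNIV. \<Sum>t\<in>UNIV. \<Sum>c\<in>UNIV. h c k r t :: real)" for h
    by (rule trans[OF sum.swap], rule sum.cong[OF refl], rule trans[OF sum.swap], rule sum.cong[OF refl], rule sum.swap)
  have "(\<Sum>b\<in>UNIV. \<Sum>c\<in>UNIV. \<Sum>k\<in>UNIV. \<Sum>r\<in>UNIV. \<Sum>t\<in>UNIV. f b c k r t) =
    (\<Sum>b\<in>UNIV. \<Sum>k\<in>UNIV. \<Sum>r\<in>UNIV. \<Sum>t\<in>UNIV. \<Sum>c\<in>UNIV. f b c k r t)"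
    by (rule sum.cong[OF refl]) (rule *)
  also have "\<dots> = (\<Sum>k\<in>UNIV. \<Sum>r\<in>UNIV. \<Sum>t\<in>UNIV. \<Sum>b\<in>UNIV. \<Sum>c\<in>UNIV. f b c k r t)"
    by (rule *)
  finally show ?thesis .
qed

text \<open>The 2-forms are self-dual, so contracting the volume form with \<open>S\<^sup>k\<close> gives back \<open>2 S\<^sup>k\<close>; the
  remaining index is contracted with \<open>a\<close>.\<close>

lemma star3_contraction:
  assumes "self_dual S G"
  shows "(\<Sum>\<alpha>\<in>UNIV. \<Sum>\<beta>\<in>UNIV. \<Sum>\<gamma>\<in>UNIV. pull3 (matrix_inv G) (vol S \<mu>) \<alpha> \<beta> \<gamma> * (a$\<alpha> * S$k$\<beta>$\<gamma>)) =
    2 * (raised S G k *v a) $ \<mu>"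
proof -
  let ?H = "matrix_inv G"
  have sd': "(\<Sum>\<rho>\<in>UNIV. \<Sum>\<tau>\<in>UNIV. \<Sum>\<beta>\<in>UNIV. \<Sum>\<gamma>\<in>UNIV.
      vol S \<mu> \<kappa> \<rho> \<tau> * ?H$\<rho>$\<beta> * ?H$\<tau>$\<gamma> * S$k$\<beta>$\<gamma>) = 2 * S$k$\<mu>$\<kappa>" for \<kappa>
    using assms[unfolded self_dual_def, rule_format, of k \<mu> \<kappa>] by linarith
  have "(\<Sum>\<beta>\<in>UNIV. \<Sum>\<gamma>\<in>UNIV. pull3 ?H (vol S \<mu>) \<alpha> \<beta> \<gamma> * (a$\<alpha> * S$k$\<beta>$\<gamma>)) =
      2 * (\<Sum>\<kappa>\<in>UNIV. S$k$\<mu>$\<kappa> * ?H$\<kappa>$\<alpha>) * a$\<alpha>" for \<alpha>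
  proof -
    have "(\<Sum>\<beta>\<in>UNIV. \<Sum>\<gamma>\<in>UNIV. pull3 ?H (vol S \<mu>) \<alpha> \<beta> \<gamma> * (a$\<alpha> * S$k$\<beta>$\<gamma>)) =
      (\<Sum>\<beta>\<in>UNIV. \<Sum>\<gamma>\<in>UNIV. \<Sum>\<kappa>\<in>UNIV. \<Sum>\<rho>\<in>UNIV. \<Sum>\<tau>\<in>UNIV.
        ?H$\<kappa>$\<alpha> * a$\<alpha> * (vol S \<mu> \<kappa> \<rho> \<tau> * ?H$\<rho>$\<beta> * ?H$\<tau>$\<gamma> * S$k$\<beta>$\<gamma>))"
      unfolding pull3_def sum_distrib_right by (simp only: mult_ac)
    also have "\<dots> = (\<Sum>\<kappa>\<in>UNIV. \<Sum>\<rho>\<in>UNIV. \<Sum>\<tau>\<in>UNIV. \<Sum>\<beta>\<in>UNIV. \<Sum>\<gamma>\<in>UNIV.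
        ?H$\<kappa>$\<alpha> * a$\<alpha> * (vol S \<mu> \<kappa> \<rho> \<tau> * ?H$\<rho>$\<beta> * ?H$\<tau>$\<gamma> * S$k$\<beta>$\<gamma>))"
      by (rule sum_move_inner)
    also have "\<dots> = (\<Sum>\<kappa>\<in>UNIV. ?H$\<kappa>$\<alpha> * a$\<alpha> * (\<Sum>\<rho>\<in>UNIV. \<Sum>\<tau>\<in>UNIV. \<Sum>\<beta>\<in>UNIV. \<Sum>\<gamma>\<in>UNIV.
        vol S \<mu> \<kappa> \<rho> \<tau> * ?H$\<rho>$\<beta> * ?H$\<tau>$\<gamma> * S$k$\<beta>$\<gamma>))"
      unfolding sum_distrib_left ..
    also have "\<dots> = (\<Sum>\<kappa>\<in>UNIV. ?H$\<kappa>$\<alpha> * a$\<alpha> * (2 * S$k$\<mu>$\<kappa>))"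
      by (simp only: sd')
    also have "\<dots> = 2 * (\<Sum>\<kappa>\<in>UNIV. S$k$\<mu>$\<kappa> * ?H$\<kappa>$\<alpha>) * a$\<alpha>"
      unfolding sum_distrib_left sum_distrib_right by (simp only: mult_ac)
    finally show ?thesis .
  qed
  then show ?thesis
    by (simp add: raised_def matrix_vector_mult_def matrix_matrix_mult_def sum_distrib_left mult_ac)
qed

text \<open>Contract the equation for \<open>a\<close> with the volume form. Both terms carry a factor \<open>3\<close> from the cyclic sum, and the
  sign of \<open>\<epsilon>\<close> is absorbed by exchanging the roles of the two summation indices.\<close>

lemma star3_of_connection:
  assumes q: "quaternionic S G" and sd: "self_dual S G" and a: "connection_eq S (cyclic Q) a"
  shows "star3 S G Q = 2 *\<^sub>R J1 S G a"
proof -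
  have "star3 S G Q $ i $ \<mu> = 2 * J1 S G a $ i $ \<mu>" for i \<mu>
  proof -
    let ?V = "pull3 (matrix_inv G) (vol S \<mu>)"
    have V: "alternating3 ?V"
      using q by (intro pull3_alternating vol_alternating quaternionicD(3))
    have w: "(\<Sum>\<alpha>\<in>UNIV. \<Sum>\<beta>\<in>UNIV. \<Sum>\<gamma>\<in>UNIV. ?V \<alpha> \<beta> \<gamma> * wedge12 (a$j) (S$k) \<alpha> \<beta> \<gamma>) =
        3 * (2 * (raised S G k *v a$j) $ \<mu>)" for j k
      unfolding wedge12_def sum_alternating_cyclic[OF V, of "\<lambda>\<alpha> \<beta> \<gamma>. a$j$\<alpha> * S$k$\<beta>$\<gamma>"]
        star3_contraction[OF sd] ..
    have c: "cyclic Q i \<alpha> \<beta> \<gamma> = - (\<Sum>j\<in>UNIV. \<Sum>k\<in>UNIV. eps i j k * wedge12 (a$j) (S$k) \<alpha> \<beta> \<gamma>)" for \<alpha> \<beta> \<gamma>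
      using a unfolding connection_eq_def by (simp add: eq_neg_iff_add_eq_0)
    have "3 * star3 S G Q $ i $ \<mu> = (\<Sum>\<alpha>\<in>UNIV. \<Sum>\<beta>\<in>UNIV. \<Sum>\<gamma>\<in>UNIV. ?V \<alpha> \<beta> \<gamma> * cyclic Q i \<alpha> \<beta> \<gamma>)"
      unfolding cyclic_def star3_def vec_lambda_beta
      by (rule sum_alternating_cyclic[OF V, of "\<lambda>\<alpha> \<beta> \<gamma>. Q \<alpha> $ i $ \<beta> $ \<gamma>", symmetric])
    also have "\<dots> = - (\<Sum>j\<in>UNIV. \<Sum>k\<in>UNIV. eps i j k *
        (\<Sum>\<alpha>\<in>UNIV. \<Sum>\<beta>\<in>UNIV. \<Sum>\<gamma>\<in>UNIV. ?V \<alpha> \<beta> \<gamma> * wedge12 (a$j) (S$k) \<alpha> \<beta> \<gamma>))"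
      unfolding c mult_minus_right sum_negf sum_distrib_left
      by (subst sum_move_inner[symmetric]) (simp only: mult.left_commute)
    also have "\<dots> = - (\<Sum>j\<in>UNIV. \<Sum>k\<in>UNIV. eps i j k * (3 * (2 * (raised S G k *v a$j) $ \<mu>)))"
      unfolding w ..
    also have "\<dots> = 6 * J1 S G a $ i $ \<mu>"
      using exhaust_3[of i] by (auto simp: J1_nth sum_3 eps_def)
    finally show ?thesis by simp
  qed
  then show ?thesis by (simp add: vec_eq_iff)
qed

lemma connection_eq_zero:
  assumes "quaternionic S G" "self_dual S G" "connection_eq S (\<lambda>_ _ _ _. 0) a"
  shows "a = 0"
proof -
  have "cyclic (\<lambda>_. 0) = (\<lambda>_ _ _ _. 0)" by (intro ext) (simp add: cyclic_def)
  then have "star3 S G (\<lambda>_. 0) = 2 *\<^sub>R J1 S G a"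
    using star3_of_connection[OF assms(1,2), of "\<lambda>_. 0"] assms(3) by simp
  moreover have "star3 S G (\<lambda>_. 0) = 0" by (simp add: star3_def vec_eq_iff)
  ultimately have "J1 S G a = 0" by simp
  then show ?thesis using J1_square[OF assms(1), of a] linear_0[OF J1_linear] by simp
qed

lemma cyclic_alternating:
  assumes "\<And>\<alpha>. antisymmetric (Q \<alpha> $ i)" shows "alternating3 (cyclic Q i)"
  unfolding alternating3_def cyclic_def
proof (intro allI conjI)
  fix \<mu> \<nu> \<rho>
  have e: "Q \<alpha> $i$\<nu>$\<mu> = - Q \<alpha> $i$\<mu>$\<nu>" "Q \<alpha> $i$\<rho>$\<mu> = - Q \<alpha> $i$\<mu>$\<rho>" "Q \<alpha> $i$\<rho>$\<nu> = - Q \<alpha> $i$\<nu>$\<rho>" for \<alpha>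
    by (rule antisymmetric_nth[OF assms])+
  show "Q \<nu> $i$\<mu>$\<rho> + Q \<mu> $i$\<rho>$\<nu> + Q \<rho> $i$\<nu>$\<mu> = - (Q \<mu> $i$\<nu>$\<rho> + Q \<nu> $i$\<rho>$\<mu> + Q \<rho> $i$\<mu>$\<nu>)"
    "Q \<mu> $i$\<rho>$\<nu> + Q \<rho> $i$\<nu>$\<mu> + Q \<nu> $i$\<mu>$\<rho> = - (Q \<mu> $i$\<nu>$\<rho> + Q \<nu> $i$\<rho>$\<mu> + Q \<rho> $i$\<mu>$\<nu>)"
    unfolding e by simp_all
qed

text \<open>Both the unknown \<open>a\<close> and the data \<open>T\<close> range over spaces of dimension \<open>12\<close>, so existence follows
  from uniqueness; and uniqueness holds because \<open>J1\<close> is injective.\<close>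

lemma connection_exists:
  assumes q: "quaternionic S G" and sd: "self_dual S G" and T: "\<And>i. alternating3 (T i)"
  shows "\<exists>a. connection_eq S T a"
proof -
  define F where "F a i \<mu> \<nu> \<rho> = (\<Sum>j\<in>UNIV. \<Sum>k\<in>UNIV. eps i j k * wedge12 (a $ j) (S $ k) \<mu> \<nu> \<rho>)"
    for a :: "real^4^3" and i \<mu> \<nu> \<rho>
  \<comment> \<open>an alternating tensor is determined by its components with increasing indices\<close>
  define comps :: "(3 \<Rightarrow> 4 \<Rightarrow> 4 \<Rightarrow> 4 \<Rightarrow> real) \<Rightarrow> real^4^3"
    where "comps T = (\<chi> i m. if m = 1 then T i 1 2 3 else if m = 2 then T i 1 2 4
      else if m = 3 then T i 1 3 4 else T i 2 3 4)" for T
  have comps0: "T i \<mu> \<nu> \<rho> = 0" if "comps T = 0" "\<And>i. alternating3 (T i)" for T i \<mu> \<nu> \<rho>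
  proof (rule alternating3_zeroI[OF that(2)])
    have "comps T $ i $ m = 0" for m using that(1) by simp
    from this[of 1] this[of 2] this[of 3] this[of 4]
    show "T i 1 2 3 = 0" "T i 1 2 4 = 0" "T i 1 3 4 = 0" "T i 2 3 4 = 0"
      by (simp_all add: comps_def)
  qed
  have altF: "alternating3 (F a i)" for a i
    unfolding alternating3_def
  proof (intro allI conjI)
    fix \<mu> \<nu> \<rho>
    note w = alternating3D[OF wedge12_alternating[OF quaternionicD(3)[OF q]]]
    show "F a i \<nu> \<mu> \<rho> = - F a i \<mu> \<nu> \<rho>"
      unfolding F_def sum_negf[symmetric] by (subst w(1)) (simp only: mult_minus_right)
    show "F a i \<mu> \<rho> \<nu> = - F a i \<mu> \<nu> \<rho>"
      unfolding F_def sum_negf[symmetric] by (subst w(2)) (simp only: mult_minus_right)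
  qed
  have "linear (\<lambda>a. comps (F a))"
    by (rule linearI) (simp_all add: comps_def F_def wedge12_def vec_eq_iff sum_3 algebra_simps)
  moreover have "inj (\<lambda>a. comps (F a))"
  proof (subst linear_injective_0[OF \<open>linear (\<lambda>a. comps (F a))\<close>], intro allI impI)
    fix a assume "comps (F a) = 0"
    then have "F a i \<mu> \<nu> \<rho> = 0" for i \<mu> \<nu> \<rho> using comps0 altF by blast
    then show "a = 0" by (intro connection_eq_zero[OF q sd]) (simp add: connection_eq_def F_def)
  qed
  ultimately have "surj (\<lambda>a. comps (F a))" using linear_injective_imp_surjective by blast
  then obtain a where a: "comps (F a) = - comps T" by (metis surjD)
  have "T i \<mu> \<nu> \<rho> + F a i \<mu> \<nu> \<rho> = 0" for i \<mu> \<nu> \<rho>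
  proof (rule comps0[of "\<lambda>i \<mu> \<nu> \<rho>. T i \<mu> \<nu> \<rho> + F a i \<mu> \<nu> \<rho>"])
    have "comps (\<lambda>i \<mu> \<nu> \<rho>. T i \<mu> \<nu> \<rho> + F a i \<mu> \<nu> \<rho>) = comps T + comps (F a)"
      by (simp add: comps_def vec_eq_iff)
    then show "comps (\<lambda>i \<mu> \<nu> \<rho>. T i \<mu> \<nu> \<rho> + F a i \<mu> \<nu> \<rho>) = 0" using a by simp
    show "alternating3 (\<lambda>\<mu> \<nu> \<rho>. T i \<mu> \<nu> \<rho> + F a i \<mu> \<nu> \<rho>)" for i
      unfolding alternating3_def
    proof (intro allI conjI)
      fix \<mu> \<nu> \<rho>
      show "T i \<nu> \<mu> \<rho> + F a i \<nu> \<mu> \<rho> = - (T i \<mu> \<nu> \<rho> + F a i \<mu> \<nu> \<rho>)"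
        using alternating3D(1)[OF T, of i \<nu> \<mu> \<rho>] alternating3D(1)[OF altF, of a i \<nu> \<mu> \<rho>] by linarith
      show "T i \<mu> \<rho> \<nu> + F a i \<mu> \<rho> \<nu> = - (T i \<mu> \<nu> \<rho> + F a i \<mu> \<nu> \<rho>)"
        using alternating3D(2)[OF T, of i \<mu> \<rho> \<nu>] alternating3D(2)[OF altF, of a i \<mu> \<rho> \<nu>] by linarith
    qed
  qed
  then show ?thesis unfolding connection_eq_def F_def by blast
qed

text \<open>The value of \<open>d2 \<sigma>\<close> as a function of the first derivatives of \<open>\<sigma>\<close>.\<close>

definition connection :: "real^4^4^3 \<Rightarrow> real^4^4 \<Rightarrow> (4 \<Rightarrow> real^4^4^3) \<Rightarrow> real^4^3" where
  "connection S G Q = (1/2) *\<^sub>R inv (J1 S G) (star3 S G Q)"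

lemma connection_eq_iff:
  assumes q: "quaternionic S G" and sd: "self_dual S G" and Q: "\<And>\<alpha> i. antisymmetric (Q \<alpha> $ i)"
  shows "connection_eq S (cyclic Q) a \<longleftrightarrow> a = connection S G Q"
proof -
  have *: "a = connection S G Q" if "connection_eq S (cyclic Q) a" for a
  proof -
    have "2 *\<^sub>R J1 S G a = J1 S G (2 *\<^sub>R a)" by (rule linear_scale[OF J1_linear, symmetric])
    then show ?thesis
      unfolding connection_def star3_of_connection[OF q sd that] by (simp add: inv_J1_J1[OF q])
  qed
  obtain a' where "connection_eq S (cyclic Q) a'"
    using connection_exists[OF q sd, where T = "cyclic Q"] cyclic_alternating[of Q] Q by auto
  then have "connection_eq S (cyclic Q) (connection S G Q)" using *[of a'] by simp
  then show ?thesis using *[of a] by auto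
qed

section \<open>Adapted frames and the standard triple\<close>

text \<open>The triple \<open>\<Sigma>\<^sup>i = e\<^sup>4 \<and> e\<^sup>i - (1/2) \<epsilon>\<^sup>i\<^sup>j\<^sup>k e\<^sup>j \<and> e\<^sup>k\<close>. The index \<open>4\<close> plays the role of the
  distinguished direction \<open>0\<close>.\<close>

definition standard_triple :: "real^4^4^3" where
  "standard_triple = (\<chi> i a b.
    if (i, a, b) \<in> {(1, 4, 1), (1, 3, 2), (2, 4, 2), (2, 1, 3), (3, 4, 3), (3, 2, 1)} then 1
    else if (i, b, a) \<in> {(1, 4, 1), (1, 3, 2), (2, 4, 2), (2, 1, 3), (3, 4, 3), (3, 2, 1)} then -1 else 0)"

lemma standard_triple_antisymmetric: "antisymmetric (standard_triple $ i)"
proof (rule antisymmetricI)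
  fix a b
  have "\<forall>i a b. standard_triple $ i $ a $ b = - standard_triple $ i $ b $ a"
    unfolding forall_3 forall_4 by (simp add: standard_triple_def)
  then show "standard_triple $ i $ a $ b = - standard_triple $ i $ b $ a" by blast
qed

lemma pull2_columns: "pull2 (\<chi> \<mu> a. e a $ \<mu>) M $ a $ b = e a \<bullet> (M *v e b)"
  by (simp add: pull2_nth inner_vec_def matrix_vector_mult_def sum_distrib_left mult_ac)

lemma pull1_columns: "pull1 (\<chi> \<mu> a. e a $ \<mu>) k $ a = k \<bullet> e a"
  by (simp add: pull1_nth inner_vec_def mult_ac)

text \<open>Let \<open>v\<close> be the unit vector along the dual of \<open>k\<close> and \<open>n\<^sub>i = v R\<^sub>i\<close> with \<open>R\<^sub>i\<close> the raised forms. The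
  quaternion relations give \<open>n\<^sub>i R\<^sub>j = -\<delta>\<^sub>i\<^sub>j v + \<epsilon>\<^sub>i\<^sub>j\<^sub>k n\<^sub>k\<close>, and the antisymmetry of the forms
  makes the four vectors orthonormal. The components of the forms in this frame
  are then inner products of frame vectors.\<close>

lemma adapted_frame:
  assumes q: "quaternionic S G" and k: "k \<noteq> 0"
  obtains P Q \<kappa> where "P ** Q = mat 1" "Q ** P = mat 1" "\<kappa> \<noteq> 0" "pull2 P G = mat 1" "pullE2 P S = standard_triple"
    "pull1 P k = \<kappa> *\<^sub>R axis 4 1"
proof -
  let ?R = "raised S G"
  define ip where "ip x y = x \<bullet> (G *v y)" for x y
  define sf where "sf i x y = x \<bullet> (S $ i *v y)" for i x y
  have swap: "x \<bullet> (M *v y) = y \<bullet> (transpose M *v x)" for x y :: "real^4" and M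
    by (metis dot_lmul_matrix inner_commute transpose_matrix_vector)
  have ip_sym: "ip x y = ip y x" for x y
    unfolding ip_def using swap[of x G y] quaternionicD(1)[OF q] by simp
  have ip_add: "ip (x + y) z = ip x z + ip y z" and ip_scale: "ip (r *\<^sub>R x) z = r * ip x z" for x y z r
    by (simp_all add: ip_def inner_left_distrib)
  have sf_swap: "sf i x y = - sf i y x" for i x y
    unfolding sf_def swap[of x _ y] quaternionicD(3)[OF q]
    by (simp add: matrix_vector_mult_def inner_vec_def sum_negf)
  have RG: "?R i ** G = S $ i" for i
    using matrix_inv_cancel(2)[OF quaternionicD(5)[OF q]]
    by (simp add: raised_def matrix_mul_assoc[symmetric])
  have ip_R: "ip (x v* ?R i) y = sf i x y" for i x y
    unfolding ip_def sf_def dot_lmul_matrix matrix_vector_mul_assoc RG ..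
  have RR: "(x v* ?R i) v* ?R j = - kronecker i j *\<^sub>R x + (\<Sum>k\<in>UNIV. eps i j k *\<^sub>R (x v* ?R k))" for x i j
  proof -
    have add: "x v* (M + N) = x v* M + x v* N" and scale: "x v* (r *\<^sub>R M) = r *\<^sub>R (x v* M)"
      for M N :: "real^4^4" and r
      by (simp_all add: vec_eq_iff vector_matrix_mult_def distrib_left sum.distrib sum_distrib_left mult_ac)
    show ?thesis
      unfolding vector_matrix_mul_assoc quaternionicD(4)[OF q] sum_3 add scale by simp
  qed
  \<comment> \<open>the vector dual to \<open>k\<close>\<close>
  define y where "y = matrix_inv G *v k"
  have Gy: "G *v y = k"
    unfolding y_def matrix_vector_mul_assoc matrix_inv_cancel(1)[OF quaternionicD(5)[OF q]] by simp
  have "y \<noteq> 0" using Gy k by auto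
  then have pos: "ip y y > 0" unfolding ip_def by (rule quaternionicD(2)[OF q])
  define \<kappa> where "\<kappa> = sqrt (ip y y)"
  have \<kappa>: "\<kappa> > 0" "\<kappa> * \<kappa> = ip y y" using pos by (simp_all add: \<kappa>_def)
  define v where "v = (1/\<kappa>) *\<^sub>R y"
  define n where "n i = v v* ?R i" for i
  have vv: "ip v v = 1"
    using \<kappa> pos unfolding v_def ip_scale ip_sym[of y "(1/\<kappa>) *\<^sub>R y"] by simp
  have sfv: "sf i v v = 0" for i using sf_swap[of i v v] by simp
  have nv: "ip (n i) v = 0" for i by (simp add: n_def ip_R sfv)
  have nR: "n i v* ?R j = - kronecker i j *\<^sub>R v + (\<Sum>k\<in>UNIV. eps i j k *\<^sub>R n k)" for i j
    unfolding n_def by (rule RR)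
  have nn: "ip (n i) (n j) = kronecker i j" for i j
  proof -
    have "ip (n i) (n j) = sf i v (n j)" by (simp add: n_def ip_R)
    also have "\<dots> = - ip (n j v* ?R i) v" by (subst sf_swap) (simp add: ip_R)
    also have "\<dots> = kronecker j i"
      unfolding nR sum_3 ip_add ip_scale by (simp add: nv vv)
    finally show ?thesis by (auto simp: kronecker_def)
  qed
  have sf1: "sf i v (n j) = kronecker i j" for i j using nn[of i j] by (simp add: n_def ip_R)
  have sf2: "sf i (n j) v = - kronecker i j" for i j using sf_swap[of i "n j" v] sf1[of i j] by simp
  have sf3: "sf i (n j) (n k) = eps j i k" for i j k
  proof -
    have "sf i (n j) (n k) = ip (n j v* ?R i) (n k)" by (simp add: ip_R)
    also have "\<dots> = eps j i k"
      unfolding nR sum_3 ip_add ip_scale nn ip_sym[of v] nv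
      using exhaust_3[of k] by (auto simp: kronecker_def)
    finally show ?thesis .
  qed
  \<comment> \<open>the fourth vector of the frame is the distinguished one\<close>
  define e where "e a = (if a = 1 then n 1 else if a = 2 then n 2 else if a = 3 then n 3 else v)" for a :: 4
  define P where "P = (\<chi> \<mu> a. e a $ \<mu>)"
  have e: "e 1 = n 1" "e 2 = n 2" "e 3 = n 3" "e 4 = v" by (simp_all add: e_def)
  have "\<forall>a b. pull2 P G $ a $ b = mat 1 $ a $ b"
    unfolding P_def pull2_columns ip_def[symmetric] forall_4 e ip_sym[of v "n _"] nn nv vv
    by (simp add: mat_def kronecker_def)
  then have 1: "pull2 P G = mat 1" by (simp add: vec_eq_iff)
  have "\<forall>i a b. pull2 P (S $ i) $ a $ b = standard_triple $ i $ a $ b"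
    unfolding P_def pull2_columns sf_def[symmetric] forall_3 forall_4 e sf1 sf2 sf3 sfv
    by (simp add: standard_triple_def kronecker_def eps_def)
  then have 2: "pullE2 P S = standard_triple" by (simp add: vec_eq_iff)
  have k_e: "k \<bullet> x = \<kappa> * ip x v" for x
  proof -
    have "k = \<kappa> *\<^sub>R (G *v v)" using Gy \<kappa>(1) by (simp add: v_def matrix_vector_mult_scaleR)
    then show ?thesis by (simp add: ip_def inner_commute)
  qed
  have "\<forall>a. pull1 P k $ a = (\<kappa> *\<^sub>R axis 4 1) $ a"
    unfolding P_def pull1_columns k_e forall_4 e nv vv by (simp add: axis_def)
  then have 3: "pull1 P k = \<kappa> *\<^sub>R axis 4 1" by (simp add: vec_eq_iff)
  have QP: "(transpose P ** G) ** P = mat 1" using 1 by (simp add: pull2_def)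
  then have "P ** (transpose P ** G) = mat 1" by (simp add: matrix_left_right_inverse)
  from that[OF this QP _ 1 2 3] show ?thesis using \<kappa>(1) by simp
qed

definition outer :: "real^4 \<Rightarrow> real^4 \<Rightarrow> real^4^4" where
  "outer k b = (\<chi> \<mu> \<nu>. k$\<mu> * b$\<nu> - k$\<nu> * b$\<mu>)"

text \<open>The principal symbols of \<open>d1\<close> and \<open>d3\<close>: the exterior derivative is replaced by \<open>k \<and>\<close>, which is \<open>outer k\<close> on
  1-forms.\<close>

definition symbol1 :: "real^4^4^3 \<Rightarrow> real^4 \<Rightarrow> real^4 \<Rightarrow> real^4^4^3" where
  "symbol1 S k v = (\<chi> i. outer k (v v* S $ i))"

definition symbol3 :: "real^4^4^3 \<Rightarrow> real^4 \<Rightarrow> real^4^3 \<Rightarrow> real^3" where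
  "symbol3 S k a = (\<chi> i. \<Sum>j\<in>UNIV. \<Sum>l\<in>UNIV. eps i j l *
    (top_wedge (S $ j) (outer k (a $ l)) / vol S 1 2 3 4))"

text \<open>The linearisation at \<open>S\<close> of the equations \<open>S\<^sup>i \<and> S\<^sup>j = 2 \<delta>\<^sup>i\<^sup>j v\<close> with \<open>v = (1/6) S\<^sup>k \<and> S\<^sup>k\<close>. The
  equations form a trace-free symmetric matrix, so there are five of them, and they leave \<open>13\<close> of the \<open>18\<close>
  dimensions.\<close>

definition tangent :: "real^4^4^3 \<Rightarrow> real^4^4^3 \<Rightarrow> bool" where
  "tangent S s \<longleftrightarrow> (\<forall>i. antisymmetric (s $ i)) \<and> (\<forall>i j.
    top_wedge (s $ i) (S $ j) + top_wedge (s $ j) (S $ i) =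
      2/3 * kronecker i j * (\<Sum>k\<in>UNIV. top_wedge (s $ k) (S $ k)))"

lemma wedge22_commute: "wedge22 \<alpha> \<beta> = wedge22 \<beta> \<alpha>"
  by (intro ext) (simp add: wedge22_def)

lemma top_wedge_standard:
  "top_wedge \<alpha> (standard_triple $ 1) = - \<alpha>$1$4 - \<alpha>$2$3"
  "top_wedge \<alpha> (standard_triple $ 2) = \<alpha>$1$3 - \<alpha>$2$4"
  "top_wedge \<alpha> (standard_triple $ 3) = - \<alpha>$1$2 - \<alpha>$3$4"
  by (simp_all add: wedge22_def standard_triple_def)

lemma symbol1_standard_injective:
  assumes "\<kappa> \<noteq> 0" "symbol1 standard_triple (\<kappa> *\<^sub>R axis 4 1) v = 0" shows "v = 0"
proof -
  have c: "symbol1 standard_triple (\<kappa> *\<^sub>R axis 4 1) v $ i $ a $ b = 0" for i a b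
    using assms(2) by simp
  from c[of 1 4 1] c[of 1 4 2] c[of 1 4 3] c[of 2 4 3]
  have "\<forall>a. v $ a = 0"
    using assms(1) unfolding forall_4
    by (simp add: symbol1_def outer_def vector_matrix_mult_def standard_triple_def sum_4 axis_def)
  then show ?thesis by (simp add: vec_eq_iff)
qed

text \<open>The equation \<open>k \<and> s\<^sup>i = 0\<close> leaves only the components \<open>s\<^sup>i\<^sub>4\<^sub>a\<close>, a \<open>3 \<times> 3\<close> matrix. The tangency
  equations say that its symmetric part is a multiple of the identity; the four remaining parameters are the
  components of \<open>v\<close>.\<close>

lemma symbol1_standard_surjective:
  assumes \<kappa>: "\<kappa> \<noteq> 0" and s: "tangent standard_triple s"
    and w: "\<And>i \<mu> \<nu> \<rho>. wedge12 (\<kappa> *\<^sub>R axis 4 1) (s $ i) \<mu> \<nu> \<rho> = 0"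
  shows "\<exists>v. s = symbol1 standard_triple (\<kappa> *\<^sub>R axis 4 1) v"
proof -
  have a: "s$i$b$b = 0" "s$i$2$1 = - s$i$1$2" "s$i$3$1 = - s$i$1$3" "s$i$3$2 = - s$i$2$3"
    "s$i$1$4 = - s$i$4$1" "s$i$2$4 = - s$i$4$2" "s$i$3$4 = - s$i$4$3" for i b
    using s unfolding tangent_def by (blast intro: antisymmetric_nth antisymmetric_nth_diag)+
  have m: "s$i$1$2 = 0" "s$i$1$3 = 0" "s$i$2$3 = 0" for i
    using w[of i 4 1 2] w[of i 4 1 3] w[of i 4 2 3] \<kappa> by (simp_all add: wedge12_def axis_def)
  have t: "top_wedge (s$i) (standard_triple$j) + top_wedge (s$j) (standard_triple$i) =
      2/3 * kronecker i j * (\<Sum>k\<in>UNIV. top_wedge (s$k) (standard_triple$k))" for i j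
    using s unfolding tangent_def by blast
  have e: "s$2$4$1 = - s$1$4$2" "s$3$4$1 = - s$1$4$3" "s$3$4$2 = - s$2$4$3" "s$2$4$2 = s$1$4$1" "s$3$4$3 = s$1$4$1"
    using t[of 1 2] t[of 1 3] t[of 2 3] t[of 1 1] t[of 2 2] m a
    by (simp_all add: top_wedge_standard sum_3 kronecker_def)
  \<comment> \<open>the trace and the antisymmetric part of the matrix \<open>s\<^sup>i\<^sub>4\<^sub>a\<close>\<close>
  define v :: "real^4" where
    "v = (\<chi> a. (if a = 1 then s$2$4$3 else if a = 2 then s$3$4$1 else if a = 3 then s$1$4$2 else s$1$4$1) / \<kappa>)"
  have "\<forall>i a b. s$i$a$b = symbol1 standard_triple (\<kappa> *\<^sub>R axis 4 1) v $i$a$b"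
    unfolding forall_3 forall_4 using \<kappa>
    by (simp add: symbol1_def outer_def vector_matrix_mult_def standard_triple_def sum_4 axis_def v_def a m e)
  then show ?thesis by (auto simp: vec_eq_iff)
qed

text \<open>The 2-forms whose wedge product with each form of the standard triple vanishes, parametrised by their
  components \<open>12\<close>, \<open>13\<close>, \<open>23\<close>.\<close>

definition asd_form :: "real \<Rightarrow> real \<Rightarrow> real \<Rightarrow> real^4^4" where
  "asd_form x y z = (\<chi> a b.
    if (a, b) = (1, 2) then x else if (a, b) = (1, 3) then y else if (a, b) = (2, 3) then z
    else if (a, b) = (1, 4) then -z else if (a, b) = (2, 4) then y else if (a, b) = (3, 4) then -x
    else if (b, a) = (1, 2) then -x else if (b, a) = (1, 3) then -y else if (b, a) = (2, 3) then -z
    else if (b, a) = (1, 4) then z else if (b, a) = (2, 4) then -y else if (b, a) = (3, 4) then x else 0)"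

lemma asd_form_antisymmetric: "antisymmetric (asd_form x y z)"
proof (rule antisymmetricI)
  fix a b
  have "\<forall>a b. asd_form x y z $ a $ b = - asd_form x y z $ b $ a"
    unfolding forall_4 by (simp add: asd_form_def)
  then show "asd_form x y z $ a $ b = - asd_form x y z $ b $ a" by blast
qed

lemma vol_standard: "vol standard_triple 1 2 3 4 = 1"
  by (simp add: vol_def sum_3 top_wedge_standard) (simp add: standard_triple_def)

lemma symbol3_standard:
  "symbol3 standard_triple (\<kappa> *\<^sub>R axis 4 1) a = (\<chi> i. \<kappa> * (\<Sum>j\<in>UNIV. \<Sum>k\<in>UNIV.
    eps i j k * wedge12 (a $ j) (standard_triple $ k) 1 2 3))"
proof -
  have "\<forall>i. symbol3 standard_triple (\<kappa> *\<^sub>R axis 4 1) a $ i = \<kappa> * (\<Sum>j\<in>UNIV. \<Sum>k\<in>UNIV.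
    eps i j k * wedge12 (a $ j) (standard_triple $ k) 1 2 3)"
    unfolding forall_3 symbol3_def vec_lambda_beta sum_3 vol_standard
      wedge22_commute[of "standard_triple $ _"] top_wedge_standard
    by (simp add: eps_def wedge12_def standard_triple_def outer_def axis_def algebra_simps)
  then show ?thesis by (simp add: vec_eq_iff)
qed

text \<open>In the equation for \<open>a\<close> the component \<open>123\<close> does not involve \<open>s\<close>, since \<open>k\<close> has only a component \<open>4\<close>;
  it is the hypothesis. The other components prescribe \<open>s\<^sup>i\<^sub>1\<^sub>2\<close>, \<open>s\<^sup>i\<^sub>1\<^sub>3\<close>, \<open>s\<^sup>i\<^sub>2\<^sub>3\<close> and leave
  \<open>s\<^sup>i\<^sub>4\<^sub>a\<close> free, so \<open>s\<^sup>i\<close> can be completed to an anti-self-dual form. Such forms are trivially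
  tangent.\<close>

lemma connection_standard:
  assumes \<kappa>: "\<kappa> \<noteq> 0" and a: "symbol3 standard_triple (\<kappa> *\<^sub>R axis 4 1) a = 0"
  shows "\<exists>s. tangent standard_triple s \<and> connection_eq standard_triple (\<lambda>i. wedge12 (\<kappa> *\<^sub>R axis 4 1) (s $ i)) a"
proof -
  let ?k = "\<kappa> *\<^sub>R axis 4 1 :: real^4"
  define F where "F i \<mu> \<nu> \<rho> = (\<Sum>j\<in>UNIV. \<Sum>k\<in>UNIV. eps i j k * wedge12 (a $ j) (standard_triple $ k) \<mu> \<nu> \<rho>)"
    for i \<mu> \<nu> \<rho>
  define s where "s = (\<chi> i. asd_form (- F i 1 2 4 / \<kappa>) (- F i 1 3 4 / \<kappa>) (- F i 2 3 4 / \<kappa>))"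
  have anti: "antisymmetric (s $ i)" for i by (simp add: s_def asd_form_antisymmetric)
  have "\<forall>j. top_wedge (s $ i) (standard_triple $ j) = 0" for i
    unfolding forall_3 by (simp add: top_wedge_standard s_def) (simp add: asd_form_def)
  then have t: "tangent standard_triple s" using anti by (simp add: tangent_def)
  have F0: "F i 1 2 3 = 0" for i
    using a \<kappa> unfolding symbol3_standard F_def[symmetric] by (simp add: vec_eq_iff)
  have "wedge12 ?k (s $ i) \<mu> \<nu> \<rho> + F i \<mu> \<nu> \<rho> = 0" for i \<mu> \<nu> \<rho>
  proof (rule alternating3_zeroI[of "\<lambda>\<mu> \<nu> \<rho>. wedge12 ?k (s $ i) \<mu> \<nu> \<rho> + F i \<mu> \<nu> \<rho>"])
    note w = alternating3D[OF wedge12_alternating[OF anti]]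
    note w' = alternating3D[OF wedge12_alternating[OF standard_triple_antisymmetric]]
    show "alternating3 (\<lambda>\<mu> \<nu> \<rho>. wedge12 ?k (s $ i) \<mu> \<nu> \<rho> + F i \<mu> \<nu> \<rho>)"
      unfolding alternating3_def
    proof (intro allI conjI)
      fix \<mu> \<nu> \<rho>
      have "F i \<nu> \<mu> \<rho> = - F i \<mu> \<nu> \<rho>"
        unfolding F_def sum_negf[symmetric] by (subst w'(1)) (simp only: mult_minus_right)
      then show "wedge12 ?k (s $ i) \<nu> \<mu> \<rho> + F i \<nu> \<mu> \<rho> = - (wedge12 ?k (s $ i) \<mu> \<nu> \<rho> + F i \<mu> \<nu> \<rho>)"
        using w(1)[of ?k i \<nu> \<mu> \<rho>] by linarith
      have "F i \<mu> \<rho> \<nu> = - F i \<mu> \<nu> \<rho>"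
        unfolding F_def sum_negf[symmetric] by (subst w'(2)) (simp only: mult_minus_right)
      then show "wedge12 ?k (s $ i) \<mu> \<rho> \<nu> + F i \<mu> \<rho> \<nu> = - (wedge12 ?k (s $ i) \<mu> \<nu> \<rho> + F i \<mu> \<nu> \<rho>)"
        using w(2)[of ?k i \<mu> \<rho> \<nu>] by linarith
    qed
    show "wedge12 ?k (s $ i) 1 2 3 + F i 1 2 3 = 0" "wedge12 ?k (s $ i) 1 2 4 + F i 1 2 4 = 0"
      "wedge12 ?k (s $ i) 1 3 4 + F i 1 3 4 = 0" "wedge12 ?k (s $ i) 2 3 4 + F i 2 3 4 = 0"
      using \<kappa> F0[of i] by (simp_all add: wedge12_def axis_def s_def asd_form_def)
  qed
  then have "connection_eq standard_triple (\<lambda>i. wedge12 ?k (s $ i)) a"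
    by (simp add: connection_eq_def F_def)
  with t show ?thesis by blast
qed

lemma symbol3_standard_surjective:
  assumes "\<kappa> \<noteq> 0" shows "\<exists>a. symbol3 standard_triple (\<kappa> *\<^sub>R axis 4 1) a = e"
proof -
  \<comment> \<open>component 1 of the symbol is \<open>\<kappa> (a\<^sub>3\<^sub>2 - a\<^sub>2\<^sub>3)\<close>, and cyclically: one entry for each component of \<open>e\<close>\<close>
  define a :: "real^4^3" where "a = (\<chi> i \<mu>. (if (i, \<mu>) = (3, 2) then e $ 1
    else if (i, \<mu>) = (1, 3) then e $ 2 else if (i, \<mu>) = (2, 1) then e $ 3 else 0) / \<kappa>)"
  have "\<forall>i. symbol3 standard_triple (\<kappa> *\<^sub>R axis 4 1) a $ i = e $ i"
    unfolding forall_3 symbol3_standard using assms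
    by (simp add: sum_3 eps_def wedge12_def standard_triple_def a_def)
  then show ?thesis by (auto simp: vec_eq_iff)
qed

lemma symbol3_connection_standard:
  assumes "connection_eq standard_triple (\<lambda>i. wedge12 (\<kappa> *\<^sub>R axis 4 1) (s $ i)) a"
  shows "symbol3 standard_triple (\<kappa> *\<^sub>R axis 4 1) a = 0"
proof -
  have "wedge12 (\<kappa> *\<^sub>R axis 4 1) (s $ i) 1 2 3 = 0" for i
    by (simp add: wedge12_def axis_def)
  then have "(\<Sum>j\<in>UNIV. \<Sum>k\<in>UNIV. eps i j k * wedge12 (a $ j) (standard_triple $ k) 1 2 3) = 0" for i
    using assms[unfolded connection_eq_def, rule_format, of i 1 2 3] by simp
  then show ?thesis by (simp add: symbol3_standard vec_eq_iff)
qed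

lemma mult_standard:
  "(M ** standard_triple $ 1) $ a $ 1 = M $ a $ 4" "(M ** standard_triple $ 1) $ a $ 2 = M $ a $ 3"
  "(M ** standard_triple $ 1) $ a $ 3 = - M $ a $ 2" "(M ** standard_triple $ 1) $ a $ 4 = - M $ a $ 1"
  "(M ** standard_triple $ 2) $ a $ 1 = - M $ a $ 3" "(M ** standard_triple $ 2) $ a $ 2 = M $ a $ 4"
  "(M ** standard_triple $ 2) $ a $ 3 = M $ a $ 1" "(M ** standard_triple $ 2) $ a $ 4 = - M $ a $ 2"
  "(M ** standard_triple $ 3) $ a $ 1 = M $ a $ 2" "(M ** standard_triple $ 3) $ a $ 2 = - M $ a $ 1"
  "(M ** standard_triple $ 3) $ a $ 3 = M $ a $ 4" "(M ** standard_triple $ 3) $ a $ 4 = - M $ a $ 3"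
  by (simp_all add: matrix_matrix_mult_def sum_4 standard_triple_def)

text \<open>For the direction from left to right decompose \<open>s\<^sup>i\<close> into self-dual forms \<open>M\<^sup>i\<^sup>j \<Sigma>\<^sup>j\<close> and an anti-self-dual
  form \<open>N\<^sup>i\<close>; tangency means that \<open>M\<close> is a multiple of the identity plus an antisymmetric matrix. In
  \<open>H = s\<^sup>j \<Sigma>\<^sup>j\<close> the trace comes from the trace of \<open>M\<close>, the antisymmetric part from the
  antisymmetric part of \<open>M\<close>, and the trace-free symmetric part from \<open>N\<close>. The map from \<open>h\<close> to \<open>s\<close> multiplies
  these parts by known constants, which determines the coefficients in the choice of \<open>h\<close>.\<close>

lemma tangent_standard_iff:
  "tangent standard_triple s \<longleftrightarrow> (\<exists>h. \<forall>i. s $ i =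
    (1/2) *\<^sub>R (h ** standard_triple $ i - transpose (h ** standard_triple $ i)))"
proof
  assume s: "tangent standard_triple s"
  have a: "s$i$b$b = 0" "s$i$2$1 = - s$i$1$2" "s$i$3$1 = - s$i$1$3" "s$i$3$2 = - s$i$2$3"
    "s$i$1$4 = - s$i$4$1" "s$i$2$4 = - s$i$4$2" "s$i$3$4 = - s$i$4$3" for i b
    using s unfolding tangent_def by (blast intro: antisymmetric_nth antisymmetric_nth_diag)+
  have t: "top_wedge (s$i) (standard_triple$j) + top_wedge (s$j) (standard_triple$i) =
      2/3 * kronecker i j * (\<Sum>k\<in>UNIV. top_wedge (s$k) (standard_triple$k))" for i j
    using s unfolding tangent_def by blast
  have e: "s$2$4$1 = s$2$2$3 - s$1$1$3 - s$1$4$2"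
    "s$3$4$1 = s$3$2$3 + s$1$1$2 - s$1$4$3"
    "s$3$4$2 = s$2$1$2 - s$2$4$3 - s$3$1$3"
    "s$2$4$2 = s$1$4$1 - s$1$2$3 - s$2$1$3"
    "s$3$4$3 = s$1$4$1 - s$1$2$3 + s$3$1$2"
    using t[of 1 2] t[of 1 3] t[of 2 3] t[of 1 1] t[of 2 2] a(5,6,7)
    unfolding top_wedge_standard sum_3 by (simp_all add: kronecker_def)
  define H where "H = (\<Sum>j\<in>UNIV. s $ j ** standard_triple $ j)"
  \<comment> \<open>equal to \<open>-H\<close> plus a sixth of its trace plus half of its antisymmetric part\<close>
  define h where "h = (\<Sum>a\<in>UNIV. H $ a $ a / 6) *\<^sub>R mat 1 - (3/4) *\<^sub>R H - (1/4) *\<^sub>R transpose H"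
  have h: "h $ a $ b = (if a = b then (\<Sum>a\<in>UNIV. H $ a $ a / 6) else 0) - 3/4 * H $ a $ b - 1/4 * H $ b $ a" for a b
    by (simp add: h_def mat_def transpose_def)
  have H: "H $ a $ 1 = s$1$a$4 - s$2$a$3 + s$3$a$2" "H $ a $ 2 = s$1$a$3 + s$2$a$4 - s$3$a$1"
    "H $ a $ 3 = s$2$a$1 - s$1$a$2 + s$3$a$4" "H $ a $ 4 = - s$1$a$1 - s$2$a$2 - s$3$a$3" for a
    by (simp_all add: H_def sum_3 mult_standard)
  have "\<forall>i a b. s $ i $ a $ b = ((1/2) *\<^sub>R (h ** standard_triple $ i - transpose (h ** standard_triple $ i))) $ a $ b"
    unfolding forall_3 forall_4
    by (simp add: mult_standard transpose_def h H sum_4 a e field_simps)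
  then show "\<exists>h. \<forall>i. s $ i = (1/2) *\<^sub>R (h ** standard_triple $ i - transpose (h ** standard_triple $ i))"
    unfolding vec_eq_iff by blast
next
  assume "\<exists>h. \<forall>i. s $ i = (1/2) *\<^sub>R (h ** standard_triple $ i - transpose (h ** standard_triple $ i))"
  then obtain h where h: "\<And>i. s $ i = (1/2) *\<^sub>R (h ** standard_triple $ i - transpose (h ** standard_triple $ i))" by blast
  have "antisymmetric (s $ i)" for i
    unfolding h by (simp add: vec_eq_iff transpose_def field_simps)
  moreover have "\<forall>i j. top_wedge (s $ i) (standard_triple $ j) + top_wedge (s $ j) (standard_triple $ i) =
      2/3 * kronecker i j * (\<Sum>k\<in>UNIV. top_wedge (s $ k) (standard_triple $ k))"
    unfolding forall_3 top_wedge_standard sum_3 h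
    by (simp add: mult_standard transpose_def kronecker_def field_simps)
  ultimately show "tangent standard_triple s" unfolding tangent_def by blast
qed

section \<open>Exactness of the symbols of a quaternionic triple\<close>

lemma pullE2_mult: "pullE2 P (pullE2 Q s) = pullE2 (Q ** P) s"
  by (simp add: vec_eq_iff pull2_mult)

lemma pullE1_mult: "pullE1 P (pullE1 Q a) = pullE1 (Q ** P) a"
  by (simp add: vec_eq_iff pull1_mult)

lemma outer_antisymmetric: "antisymmetric (outer k b)"
  by (rule antisymmetricI) (simp add: outer_def)

lemma outer_pull: "outer (pull1 P k) (pull1 P b) = pull2 P (outer k b)"
proof -
  have e: "pull1 P k $ x * pull1 P b $ y = (\<Sum>\<mu>\<in>UNIV. \<Sum>\<nu>\<in>UNIV. P$\<mu>$x * P$\<nu>$y * (k$\<mu> * b$\<nu>))" for k b x y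
    unfolding pull1_nth sum_product by (simp only: mult_ac)
  have "outer (pull1 P k) (pull1 P b) $ x $ y = pull1 P k $ x * pull1 P b $ y - pull1 P b $ x * pull1 P k $ y" for x y
    by (simp add: outer_def mult.commute)
  then have "outer (pull1 P k) (pull1 P b) $ x $ y = pull2 P (outer k b) $ x $ y" for x y
    unfolding e pull2_nth outer_def vec_lambda_beta
    by (simp add: right_diff_distrib sum_subtractf mult.commute[of "k $ _"])
  then show ?thesis by (simp add: vec_eq_iff)
qed

lemma vector_matrix_pull2: "v v* pull2 P M = pull1 P ((P *v v) v* M)"
proof -
  have *: "x v* N = transpose N *v x" for x :: "real^'n" and N
    by simp
  show ?thesis
    unfolding * pull1_def pull2_def matrix_transpose_mul matrix_vector_mul_assoc by (simp add: matrix_mul_assoc)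
qed

lemma symbol1_pull: "symbol1 (pullE2 P S) (pull1 P k) v = pullE2 P (symbol1 S k (P *v v))"
  by (simp add: symbol1_def vec_eq_iff vector_matrix_pull2 outer_pull del: vector_transpose_matrix transpose_matrix_vector)

lemma tangent_pull:
  assumes "\<And>i. antisymmetric (S $ i)" "tangent S s"
  shows "tangent (pullE2 P S) (pullE2 P s)"
proof -
  have s: "antisymmetric (s $ i)" for i using assms(2) by (simp add: tangent_def)
  have e: "top_wedge (s $ i) (S $ j) + top_wedge (s $ j) (S $ i) =
      2/3 * kronecker i j * (\<Sum>k\<in>UNIV. top_wedge (s $ k) (S $ k))" for i j
    using assms(2) unfolding tangent_def by blast
  have "pull_factor P * top_wedge (s $ i) (S $ j) + pull_factor P * top_wedge (s $ j) (S $ i) =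
      2/3 * kronecker i j * (\<Sum>k\<in>UNIV. pull_factor P * top_wedge (s $ k) (S $ k))" for i j
    unfolding distrib_left[symmetric] e sum_distrib_left[symmetric] by simp
  then show ?thesis
    using s by (simp add: tangent_def top_wedge_pull2 assms(1) pull2_antisymmetric)
qed

lemma vol_eq_sum: "vol S 1 2 3 4 = 1/6 * (\<Sum>k\<in>UNIV. top_wedge (S $ k) (S $ k))"
  by (simp add: vol_def)

lemma vol_pull:
  assumes "\<And>i. antisymmetric (S $ i)"
  shows "vol (pullE2 P S) 1 2 3 4 = pull_factor P * vol S 1 2 3 4"
  unfolding vol_eq_sum by (simp add: top_wedge_pull2 assms sum_distrib_left)

lemma symbol3_pull:
  assumes "\<And>i. antisymmetric (S $ i)" "pull_factor P \<noteq> 0"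
  shows "symbol3 (pullE2 P S) (pull1 P k) (pullE1 P a) = symbol3 S k a"
  unfolding symbol3_def vol_pull[OF assms(1)]
  by (simp add: outer_pull top_wedge_pull2 assms outer_antisymmetric)

lemma symbol1_injective:
  assumes q: "quaternionic S G" and k: "k \<noteq> 0" and v: "symbol1 S k v = 0" shows "v = 0"
proof -
  obtain P Q \<kappa> where P: "P ** Q = mat 1" "Q ** P = mat 1" "\<kappa> \<noteq> 0" "pullE2 P S = standard_triple"
    "pull1 P k = \<kappa> *\<^sub>R axis 4 1" using adapted_frame[OF q k] by metis
  have Pv: "P *v (Q *v v) = v" by (simp add: matrix_vector_mul_assoc P)
  have "symbol1 standard_triple (\<kappa> *\<^sub>R axis 4 1) (Q *v v) = pullE2 P (symbol1 S k v)"
    using symbol1_pull[of P S k "Q *v v"] unfolding P Pv .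
  also have "\<dots> = 0" unfolding v by (simp add: vec_eq_iff pull2_nth)
  finally have "Q *v v = 0" by (rule symbol1_standard_injective[OF P(3)])
  then show ?thesis using Pv by simp
qed

lemma symbol1_surjective:
  assumes q: "quaternionic S G" and k: "k \<noteq> 0" and s: "tangent S s"
    and w: "\<And>i \<mu> \<nu> \<rho>. wedge12 k (s $ i) \<mu> \<nu> \<rho> = 0"
  shows "\<exists>v. s = symbol1 S k v"
proof -
  obtain P Q \<kappa> where P: "P ** Q = mat 1" "Q ** P = mat 1" "\<kappa> \<noteq> 0" "pullE2 P S = standard_triple"
    "pull1 P k = \<kappa> *\<^sub>R axis 4 1" using adapted_frame[OF q k] by metis
  have "tangent standard_triple (pullE2 P s)"
    using tangent_pull[OF quaternionicD(3)[OF q] s, of P] unfolding P .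
  moreover have "wedge12 (\<kappa> *\<^sub>R axis 4 1) (pullE2 P s $ i) \<mu> \<nu> \<rho> = 0" for i \<mu> \<nu> \<rho>
    using wedge12_pull[of P k "s $ i"] w unfolding P by (simp add: pull3_def)
  ultimately obtain v where "pullE2 P s = symbol1 standard_triple (\<kappa> *\<^sub>R axis 4 1) v"
    using symbol1_standard_surjective[OF P(3)] by blast
  also have "\<dots> = pullE2 P (symbol1 S k (P *v v))"
    using symbol1_pull[of P S k v] unfolding P .
  finally have "pullE2 Q (pullE2 P s) = pullE2 Q (pullE2 P (symbol1 S k (P *v v)))" by simp
  then have "s = symbol1 S k (P *v v)" unfolding pullE2_mult P by simp
  then show ?thesis by blast
qed

lemma pull1_inverse: "P ** Q = mat 1 \<Longrightarrow> pull1 Q (pull1 P k) = k"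
  by (simp add: pull1_mult)

lemma pullE_inverse:
  assumes "P ** Q = mat 1" shows "pullE2 Q (pullE2 P s) = s" "pullE1 Q (pullE1 P a) = a"
  unfolding pullE2_mult pullE1_mult assms by simp_all

lemma connection_symbol_exact:
  assumes q: "quaternionic S G" and k: "k \<noteq> 0" and a: "symbol3 S k a = 0"
  shows "\<exists>s. tangent S s \<and> connection_eq S (\<lambda>i. wedge12 k (s $ i)) a"
proof -
  obtain P Q \<kappa> where P: "P ** Q = mat 1" "Q ** P = mat 1" "\<kappa> \<noteq> 0" "pullE2 P S = standard_triple"
    "pull1 P k = \<kappa> *\<^sub>R axis 4 1" using adapted_frame[OF q k] by metis
  note inv = pull1_inverse[OF P(1), of k, unfolded P] pullE_inverse(1)[OF P(1), of S, unfolded P]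
    pullE_inverse(2)[OF P(1), of a]
  have "symbol3 standard_triple (\<kappa> *\<^sub>R axis 4 1) (pullE1 P a) = 0"
    using symbol3_pull[OF quaternionicD(3)[OF q] pull_factor_nonzero[OF P(1)], of k a] a unfolding P by simp
  then obtain s where s: "tangent standard_triple s"
    and c: "connection_eq standard_triple (\<lambda>i. wedge12 (\<kappa> *\<^sub>R axis 4 1) (s $ i)) (pullE1 P a)"
    using connection_standard[OF P(3)] by blast
  have "tangent S (pullE2 Q s)"
    using tangent_pull[OF standard_triple_antisymmetric s, of Q] unfolding inv .
  moreover have "connection_eq S (\<lambda>i. wedge12 k (pullE2 Q s $ i)) a"
    using connection_eq_pull[OF c, of Q] unfolding inv wedge12_pull[symmetric] by simp
  ultimately show ?thesis by blast
qed

lemma symbol3_surjective: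
  assumes q: "quaternionic S G" and k: "k \<noteq> 0" shows "\<exists>a. symbol3 S k a = e"
proof -
  obtain P Q \<kappa> where P: "P ** Q = mat 1" "Q ** P = mat 1" "\<kappa> \<noteq> 0" "pullE2 P S = standard_triple"
    "pull1 P k = \<kappa> *\<^sub>R axis 4 1" using adapted_frame[OF q k] by metis
  obtain a where "symbol3 standard_triple (\<kappa> *\<^sub>R axis 4 1) a = e"
    using symbol3_standard_surjective[OF P(3)] by blast
  then have "symbol3 S k (pullE1 Q a) = e"
    using symbol3_pull[OF quaternionicD(3)[OF q] pull_factor_nonzero[OF P(1)], of k "pullE1 Q a"]
    unfolding P pullE_inverse(2)[OF P(2)] by simp
  then show ?thesis by blast
qed

lemma symbol3_connection:
  assumes q: "quaternionic S G" and k: "k \<noteq> 0" and c: "connection_eq S (\<lambda>i. wedge12 k (s $ i)) a"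
  shows "symbol3 S k a = 0"
proof -
  obtain P Q \<kappa> where P: "P ** Q = mat 1" "Q ** P = mat 1" "\<kappa> \<noteq> 0" "pullE2 P S = standard_triple"
    "pull1 P k = \<kappa> *\<^sub>R axis 4 1" using adapted_frame[OF q k] by metis
  have "connection_eq standard_triple (\<lambda>i. wedge12 (\<kappa> *\<^sub>R axis 4 1) (pullE2 P s $ i)) (pullE1 P a)"
    using connection_eq_pull[OF c, of P] unfolding P wedge12_pull[symmetric] by simp
  then show ?thesis
    using symbol3_connection_standard
      symbol3_pull[OF quaternionicD(3)[OF q] pull_factor_nonzero[OF P(1)], of k a] unfolding P by metis
qed

lemma symbol1_closed: "wedge12 k (symbol1 S k v $ i) \<mu> \<nu> \<rho> = 0"
  by (simp add: symbol1_def outer_def wedge12_def algebra_simps)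

lemma vol_nonzero:
  assumes q: "quaternionic S G" shows "vol S 1 2 3 4 \<noteq> 0"
proof -
  have "axis 1 1 \<noteq> (0 :: real^4)" by (simp add: axis_eq_0_iff)
  from adapted_frame[OF q this] obtain P where P: "pullE2 P S = standard_triple" by metis
  show ?thesis
    using vol_pull[OF quaternionicD(3)[OF q], of P] unfolding P vol_standard by auto
qed

lemma pull2_half_antisymmetrization:
  "pull2 P ((1/2) *\<^sub>R (M - transpose M)) = (1/2) *\<^sub>R (pull2 P M - transpose (pull2 P M))"
proof -
  have t: "pull2 P (transpose M) = transpose (pull2 P M)"
    by (simp add: pull2_def matrix_transpose_mul matrix_mul_assoc)
  show ?thesis
    unfolding t[symmetric]
    by (simp add: vec_eq_iff pull2_nth right_diff_distrib sum_subtractf diff_divide_distrib sum_divide_distrib)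
qed

text \<open>The bundle \<open>S\<close> is defined by the right-hand side, which involves the metric and an existential
  quantifier. Both sides are natural under pullback, so it is enough to know the
  equivalence for the standard triple. In an adapted frame the inverse metric is \<open>P P\<^sup>T\<close>.\<close>

lemma tangent_iff:
  assumes q: "quaternionic S G"
  shows "tangent S s \<longleftrightarrow> (\<exists>h. \<forall>i. s $ i =
    (1/2) *\<^sub>R (h ** matrix_inv G ** S $ i - transpose (h ** matrix_inv G ** S $ i)))"
proof -
  have "axis 1 1 \<noteq> (0 :: real^4)" by (simp add: axis_eq_0_iff)
  from adapted_frame[OF q this] obtain P Q where P: "P ** Q = mat 1" "Q ** P = mat 1"
    and G: "pull2 P G = mat 1" and S: "pullE2 P S = standard_triple" by metis
  have S': "pull2 P (S $ i) = standard_triple $ i" for i using arg_cong[OF S, of "\<lambda>s. s $ i"] by simp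
  have "(transpose P ** G) ** P = mat 1" using G by (simp add: pull2_def)
  then have "P ** (transpose P ** G) = mat 1" by (rule iffD1[OF matrix_left_right_inverse])
  then have "(P ** transpose P) ** G = mat 1" by (simp only: matrix_mul_assoc)
  then have "G ** (P ** transpose P) = mat 1" by (rule iffD1[OF matrix_left_right_inverse])
  then have Ginv: "matrix_inv G = P ** transpose P" by (rule matrix_inv_unique)
  let ?f = "\<lambda>h i. (1/2) *\<^sub>R (h ** matrix_inv G ** S $ i - transpose (h ** matrix_inv G ** S $ i))"
  let ?g = "\<lambda>h i. (1/2) *\<^sub>R (h ** standard_triple $ i - transpose (h ** standard_triple $ i))"
  have f: "pull2 P (?f h i) = ?g (pull2 P h) i" for h i
  proof -
    have "pull2 P (h ** matrix_inv G ** S $ i) = pull2 P h ** standard_triple $ i"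
      unfolding Ginv S'[symmetric] by (simp add: pull2_def matrix_mul_assoc)
    then show ?thesis by (simp only: pull2_half_antisymmetrization)
  qed
  have pull_back: "pull2 Q (pull2 P M) = M" "pull2 P (pull2 Q M) = M" for M
    by (simp_all add: pull2_mult P)
  have "tangent S s \<longleftrightarrow> tangent standard_triple (pullE2 P s)"
  proof
    show "tangent standard_triple (pullE2 P s)" if "tangent S s"
      using tangent_pull[OF quaternionicD(3)[OF q] that, of P] unfolding S .
    show "tangent S s" if "tangent standard_triple (pullE2 P s)"
      using tangent_pull[OF standard_triple_antisymmetric that, of Q]
      unfolding S[symmetric] pullE_inverse(1)[OF P(1)] .
  qed
  also have "\<dots> \<longleftrightarrow> (\<exists>h. \<forall>i. pull2 P (s $ i) = ?g h i)"
    unfolding tangent_standard_iff by (simp only: vec_lambda_beta)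
  also have "\<dots> \<longleftrightarrow> (\<exists>h. \<forall>i. s $ i = ?f h i)"
  proof
    assume "\<exists>h. \<forall>i. pull2 P (s $ i) = ?g h i"
    then obtain h where h: "\<forall>i. pull2 P (s $ i) = ?g h i" by blast
    have "s $ i = ?f (pull2 Q h) i" for i
    proof -
      have "s $ i = pull2 Q (pull2 P (s $ i))" by (simp only: pull_back)
      also have "\<dots> = pull2 Q (pull2 P (?f (pull2 Q h) i))" by (simp only: f pull_back h)
      also have "\<dots> = ?f (pull2 Q h) i" by (rule pull_back)
      finally show ?thesis .
    qed
    then show "\<exists>h. \<forall>i. s $ i = ?f h i" by (intro exI allI)
  next
    assume "\<exists>h. \<forall>i. s $ i = ?f h i"
    then obtain h where "\<forall>i. s $ i = ?f h i" by blast
    then have "pull2 P (s $ i) = ?g (pull2 P h) i" for i by (simp only: f)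
    then show "\<exists>h. \<forall>i. pull2 P (s $ i) = ?g h i" by (intro exI allI)
  qed
  finally show ?thesis .
qed

section \<open>Tensor bundles and principal symbols\<close>

text \<open>The composition law is contravariant because \<open>\<rho>\<close>, applied to the Jacobian of the chart \<open>c'\<close> with respect to
  the chart \<open>c\<close>, takes components in \<open>c'\<close> to components in \<open>c\<close>.\<close>

definition representation :: "(real^4^4 \<Rightarrow> 'v \<Rightarrow> 'v) \<Rightarrow> bool" where
  "representation \<rho> \<longleftrightarrow> (\<forall>v. \<rho> (mat 1) v = v) \<and>
    (\<forall>P Q v. invertible P \<longrightarrow> invertible Q \<longrightarrow> \<rho> P (\<rho> Q v) = \<rho> (Q ** P) v)"

lemma representation_pull2: "representation pull2"
  by (simp add: representation_def pull2_mult)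

lemma representation_pullE1: "representation pullE1"
  by (simp add: representation_def pull1_mult)

lemma representation_pullE2: "representation pullE2"
  by (simp add: representation_def pull2_mult)

lemma matrix_inv_mult:
  fixes P Q :: "real^'n^'n"
  assumes "invertible P" "invertible Q" shows "matrix_inv (Q ** P) = matrix_inv P ** matrix_inv Q"
proof (rule matrix_inv_unique)
  have "Q ** P ** (matrix_inv P ** matrix_inv Q) = Q ** (P ** matrix_inv P) ** matrix_inv Q"
    by (simp only: matrix_mul_assoc)
  then show "Q ** P ** (matrix_inv P ** matrix_inv Q) = mat 1"
    by (simp add: matrix_inv_cancel(1)[OF assms(1)] matrix_inv_cancel(1)[OF assms(2)])
qed

lemma matrix_inv_mat1: "matrix_inv (mat 1 :: real^'n^'n) = mat 1"
  by (rule matrix_inv_unique) simp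

lemma representation_vector: "representation (\<lambda>J v. matrix_inv J *v v)"
  by (simp add: representation_def matrix_inv_mult matrix_inv_mat1 matrix_vector_mul_assoc)

lemma T_dual_eq: "T_dual = tensor_fibre pull1"
  unfolding T_dual_def pull1_def[abs_def] ..
lemma T2_dual_eq: "T2_dual = tensor_fibre pull2"
  unfolding T2_dual_def pull2_def[abs_def] ..
lemma E1_bundle_eq: "E1_bundle = tensor_fibre pullE1"
  unfolding E1_bundle_def pull1_def ..
lemma E2_bundle_eq: "E2_bundle A x = {\<sigma> \<in> tensor_fibre pullE2 A x. \<forall>c i. antisymmetric (\<sigma> c $ i)}"
  unfolding E2_bundle_def pull2_def ..

lemma tensor_fibreD:
  assumes "t \<in> tensor_fibre \<rho> A x"
  shows "c \<in> charts_at A x \<Longrightarrow> c' \<in> charts_at A x \<Longrightarrow> t c = \<rho> (jac c c' x) (t c')"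
    and "c \<notin> charts_at A x \<Longrightarrow> t c = 0"
  using assms unfolding tensor_fibre_def by blast+

lemma tensor_fibre_eqI:
  assumes "t \<in> tensor_fibre \<rho> A x" "t' \<in> tensor_fibre \<rho> A x" "c \<in> charts_at A x" "t c = t' c"
  shows "t = t'"
proof
  fix c' show "t c' = t' c'"
  proof (cases "c' \<in> charts_at A x")
    case True
    then show ?thesis
      using tensor_fibreD(1)[OF assms(1) True assms(3)] tensor_fibreD(1)[OF assms(2) True assms(3)]
        assms(4) by simp
  next
    case False
    then show ?thesis using tensor_fibreD(2)[OF assms(1)] tensor_fibreD(2)[OF assms(2)] by simp
  qed
qed

text \<open>For fixed \<open>x\<close> this is the tensor at \<open>x\<close> that has the components \<open>v\<close> in the chart \<open>c0\<close>; for variable \<open>x\<close> it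
  is a section over the domain of \<open>c0\<close>.\<close>

definition extend_tensor ::
  "(real^4^4 \<Rightarrow> 'v \<Rightarrow> 'v) \<Rightarrow> 'm chart set \<Rightarrow> 'm chart \<Rightarrow> 'v::zero \<Rightarrow> 'm \<Rightarrow> 'm chart \<Rightarrow> 'v" where
  "extend_tensor \<rho> A c0 v x c = (if c \<in> charts_at A x then \<rho> (jac c c0 x) v else 0)"

lemma sections_iff:
  "s \<in> sections A F U \<longleftrightarrow> (\<forall>x\<in>U. s x \<in> F x) \<and> (\<forall>c\<in>A. smooth_in c U (\<lambda>x. s x c))"
  by (simp add: sections_def smooth_in_def)

context smooth_manifold
begin

lemma extend_tensor_fibre:
  assumes "representation \<rho>" "c0 \<in> charts_at A x"
  shows "extend_tensor \<rho> A c0 v x \<in> tensor_fibre \<rho> A x" "extend_tensor \<rho> A c0 v x c0 = v"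
proof -
  note D = charts_at_D
  have law: "\<rho> (jac c c' x) (\<rho> (jac c' c0 x) v) = \<rho> (jac c c0 x) v"
    if "c \<in> charts_at A x" "c' \<in> charts_at A x" for c c'
    using assms(1) jac_trans[OF D(1)[OF that(1)] D(1)[OF that(2)] D(1)[OF assms(2)]
        D(2)[OF that(1)] D(2)[OF that(2)] D(2)[OF assms(2)]]
      jac_invertible[OF D(1)[OF that(1)] D(1)[OF that(2)] D(2)[OF that(1)] D(2)[OF that(2)]]
      jac_invertible[OF D(1)[OF that(2)] D(1)[OF assms(2)] D(2)[OF that(2)] D(2)[OF assms(2)]]
    unfolding representation_def by simp
  show "extend_tensor \<rho> A c0 v x \<in> tensor_fibre \<rho> A x"
    by (simp add: tensor_fibre_def extend_tensor_def law)
  show "extend_tensor \<rho> A c0 v x c0 = v"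
    using assms jac_refl[OF D(1)[OF assms(2)] D(2)[OF assms(2)]]
    by (simp add: extend_tensor_def representation_def)
qed

lemma extend_tensor_self:
  assumes "t \<in> tensor_fibre \<rho> A x" "c0 \<in> charts_at A x"
  shows "extend_tensor \<rho> A c0 (t c0) x = t"
proof
  fix c show "extend_tensor \<rho> A c0 (t c0) x c = t c"
    using tensor_fibreD(1)[OF assms(1) _ assms(2), of c] tensor_fibreD(2)[OF assms(1), of c]
    by (simp add: extend_tensor_def)
qed

lemma extend_tensor_section:
  assumes \<rho>: "representation \<rho>" and c0: "c0 \<in> A"
    and smooth: "\<And>c. c \<in> A \<Longrightarrow> smooth_in c (dom_of c0) (\<lambda>x. \<rho> (jac c c0 x) v)"
  shows "extend_tensor \<rho> A c0 v \<in> sections A (tensor_fibre \<rho> A) (dom_of c0)"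
  unfolding sections_iff
proof (intro conjI ballI)
  show "extend_tensor \<rho> A c0 v x \<in> tensor_fibre \<rho> A x" if "x \<in> dom_of c0" for x
    using that c0 by (intro extend_tensor_fibre[OF \<rho>]) (simp add: charts_at_def)
  show "smooth_in c (dom_of c0) (\<lambda>x. extend_tensor \<rho> A c0 v x c)" if "c \<in> A" for c
    by (rule smooth_in_cong[OF that open_dom[OF c0] smooth[OF that]])
      (use that in \<open>simp add: extend_tensor_def charts_at_def\<close>)
qed

text \<open>Needed for principal symbols: their defining property quantifies over local sections with a given value,
  and determines the symbol only if there is one.\<close>

definition local_sections :: "('m \<Rightarrow> ('m chart \<Rightarrow> 'v::real_normed_vector) set) \<Rightarrow> bool" where
  "local_sections F \<longleftrightarrow> (\<forall>x. \<forall>v\<in>F x. \<exists>U s. open U \<and> x \<in> U \<and> s \<in> sections A F U \<and> s x = v)"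

lemma tensor_fibre_local_sections:
  assumes \<rho>: "representation \<rho>"
    and smooth: "\<And>c c0 v. c \<in> A \<Longrightarrow> c0 \<in> A \<Longrightarrow> smooth_in c (dom_of c0) (\<lambda>x. \<rho> (jac c c0 x) v)"
  shows "local_sections (tensor_fibre \<rho> A)"
  unfolding local_sections_def
proof (intro allI ballI)
  fix x v assume v: "v \<in> tensor_fibre \<rho> A x"
  obtain c0 where c0: "c0 \<in> charts_at A x" by (rule chart_exists)
  note c0' = charts_at_D[OF c0]
  show "\<exists>U s. open U \<and> x \<in> U \<and> s \<in> sections A (tensor_fibre \<rho> A) U \<and> s x = v"
    using open_dom[OF c0'(1)] c0'(2) extend_tensor_section[OF \<rho> c0'(1) smooth[OF _ c0'(1)]]
      extend_tensor_self[OF v c0] by blast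
qed

text \<open>A section with constant components in one chart is smooth in the other charts because Jacobians, and by
  Cramer's rule their inverses, depend smoothly on the point.\<close>

lemma local_sections_TM: "local_sections (TM A)"
  unfolding TM_def
proof (rule tensor_fibre_local_sections[OF representation_vector])
  fix c c0 :: "'m chart" and v :: "real^4" assume c: "c \<in> A" "c0 \<in> A"
  note o = open_dom[OF c(2)]
  show "smooth_in c (dom_of c0) (\<lambda>x. matrix_inv (jac c c0 x) *v v)"
    unfolding matrix_vector_mult_def
    by (intro smooth_in_arith[OF c(1) o] smooth_in_matrix_inv[OF c(1) o] smooth_in_jac[OF c]
        jac_invertible[OF c])
qed

lemma local_sections_E1: "local_sections (E1_bundle A)"
  unfolding E1_bundle_eq
proof (rule tensor_fibre_local_sections[OF representation_pullE1])
  fix c c0 :: "'m chart" and a :: "real^4^3" assume c: "c \<in> A" "c0 \<in> A"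
  note o = open_dom[OF c(2)]
  show "smooth_in c (dom_of c0) (\<lambda>x. pullE1 (jac c c0 x) a)"
    unfolding pull1_def matrix_vector_mult_def transpose_def vec_lambda_beta
    by (intro smooth_in_arith[OF c(1) o] smooth_in_jac[OF c])
qed

lemma smooth_in_pull2_jac:
  assumes c: "c \<in> A" "c0 \<in> A"
  shows "smooth_in c (dom_of c0) (\<lambda>x. pull2 (jac c c0 x) h $ \<mu> $ \<nu>)"
proof -
  note o = open_dom[OF c(2)]
  show ?thesis unfolding pull2_nth
    by (intro smooth_in_arith[OF c(1) o] smooth_in_jac[OF c])
qed

lemma section_smooth_in:
  assumes "s \<in> sections A F U" "c \<in> A" "open V" "V \<subseteq> U"
  shows "smooth_in c V (\<lambda>x. s x c)"
  using assms by (intro smooth_in_subset[OF assms(2,3), of U]) (auto simp: sections_iff)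

lemma sections_subset:
  assumes "s \<in> sections A F U" "open V" "V \<subseteq> U" shows "s \<in> sections A F V"
  unfolding sections_iff using assms section_smooth_in[OF assms(1) _ assms(2,3)] by (auto simp: sections_iff)

text \<open>The affine function with gradient \<open>k\<close> in one chart.\<close>

lemma function_with_differential:
  assumes k: "k \<in> T_dual A x" and c0: "c0 \<in> charts_at A x"
  obtains f where "smooth_fun A (dom_of c0) f" "f x = 0" "differential A f x = k"
proof -
  note c0' = charts_at_D[OF c0]
  define f where "f y = (\<Sum>\<alpha>\<in>UNIV. k c0 $ \<alpha> * (coord c0 y $ \<alpha> - coord c0 x $ \<alpha>))" for y
  note o = open_dom[OF c0'(1)]
  have sm: "smooth_in c (dom_of c0) f" if "c \<in> A" for c
    unfolding f_def
    by (intro smooth_in_arith[OF that o] smooth_in_nth[OF that o] smooth_in_coord[OF that c0'(1)])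
  have "pd c \<mu> f x = k c $ \<mu>" if c: "c \<in> charts_at A x" for c \<mu>
  proof -
    note c' = charts_at_D[OF c]
    have d: "diff_at c x (\<lambda>y. coord c0 y $ \<alpha>)" for \<alpha>
      by (rule smooth_in_diff_at[OF c'(1) o smooth_in_nth[OF c'(1) o smooth_in_coord[OF c'(1) c0'(1)]] c'(2) c0'(2)])
    have "pd c \<mu> f x = (\<Sum>\<alpha>\<in>UNIV. k c0 $ \<alpha> * jac c c0 x $ \<alpha> $ \<mu>)"
      unfolding f_def jac_eq_pd[OF c'(1) c0'(1) c'(2) c0'(2)]
      by (simp add: pd_sum pd_mult pd_diff pd_const d diff_at_const diff_at_mult diff_at_diff
          chart_inv_coord[OF c'])
    also have "\<dots> = pull1 (jac c c0 x) (k c0) $ \<mu>" by (simp add: pull1_nth mult.commute)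
    also have "\<dots> = k c $ \<mu>" using tensor_fibreD(1)[OF k[unfolded T_dual_eq] c c0] by simp
    finally show ?thesis .
  qed
  then have "differential A f x = k"
    using tensor_fibreD(2)[OF k[unfolded T_dual_eq]] by (auto simp: differential_def fun_eq_iff vec_eq_iff)
  moreover have "smooth_fun A (dom_of c0) f" using sm by (simp add: smooth_fun_def smooth_in_def)
  ultimately show ?thesis using that[of f] by (simp add: f_def)
qed

text \<open>If \<open>f\<close> vanishes at \<open>x\<close>, the zeroth-order terms of \<open>D (f s)\<close> vanish there and the derivatives of
  \<open>f s\<close> are those of \<open>f\<close> times the value of \<open>s\<close>. So \<open>D (f s)\<close> depends only on the covector and the value, and
  the definite description in the definition of the principal symbol is the expected expression
  in the leading coefficients.\<close>

lemma
  fixes F :: "'m \<Rightarrow> ('m chart \<Rightarrow> 'v::real_normed_vector) set"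
    and G :: "'m \<Rightarrow> ('m chart \<Rightarrow> 'w::real_normed_vector) set"
  assumes D: "\<And>U s. open U \<Longrightarrow> s \<in> sections A F U \<Longrightarrow> D s \<in> sections A G U"
    and loc: "\<And>U s c. open U \<Longrightarrow> s \<in> sections A F U \<Longrightarrow> x \<in> U \<Longrightarrow> c \<in> charts_at A x \<Longrightarrow>
      D s x c = (\<Sum>\<mu>\<in>UNIV. a c \<mu> (pd c \<mu> (\<lambda>y. s y c) x)) + b c (s x c)"
    and b: "\<And>c. c \<in> charts_at A x \<Longrightarrow> b c 0 = 0"
    and G: "\<And>w c. w \<in> G x \<Longrightarrow> c \<notin> charts_at A x \<Longrightarrow> w c = 0"
    and F: "\<And>y r w. w \<in> F y \<Longrightarrow> (\<lambda>c. r *\<^sub>R w c) \<in> F y"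
    and ext: "local_sections F" and v: "v \<in> F x" and k: "k \<in> T_dual A x"
  shows principal_symbol_eq: "principal_symbol A F D x k v =
      (\<lambda>c. if c \<in> charts_at A x then \<Sum>\<mu>\<in>UNIV. a c \<mu> (k c $ \<mu> *\<^sub>R v c) else 0)"
    and principal_symbol_fibre: "principal_symbol A F D x k v \<in> G x"
proof -
  let ?w = "\<lambda>c. if c \<in> charts_at A x then \<Sum>\<mu>\<in>UNIV. a c \<mu> (k c $ \<mu> *\<^sub>R v c) else 0"
  let ?P = "\<lambda>U f s. open U \<and> x \<in> U \<and> smooth_fun A U f \<and> f x = 0 \<and> differential A f x = k \<and>
       s \<in> sections A F U \<and> s x = v"
  have *: "D (\<lambda>y c. f y *\<^sub>R s y c) x = ?w \<and> D (\<lambda>y c. f y *\<^sub>R s y c) x \<in> G x" if P: "?P U f s" for U f s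
  proof -
    have U: "open U" "x \<in> U" and f: "\<And>c. c \<in> A \<Longrightarrow> smooth_in c U f" "f x = 0" "differential A f x = k"
      and s: "s \<in> sections A F U" "s x = v"
      using P by (auto simp: smooth_fun_def smooth_in_def)
    have fs: "(\<lambda>y c. f y *\<^sub>R s y c) \<in> sections A F U"
      unfolding sections_iff
    proof (intro conjI ballI)
      show "(\<lambda>c. f y *\<^sub>R s y c) \<in> F y" if "y \<in> U" for y
        using s(1) that by (intro F) (simp add: sections_iff)
      show "smooth_in c U (\<lambda>y. f y *\<^sub>R s y c)" if "c \<in> A" for c
        by (intro smooth_in_scaleR[OF that U(1)] f that section_smooth_in[OF s(1) that U(1) order_refl])
    qed
    have G': "D (\<lambda>y c. f y *\<^sub>R s y c) x \<in> G x"
      using D[OF U(1) fs] U(2) by (simp add: sections_iff)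
    have "D (\<lambda>y c. f y *\<^sub>R s y c) x c = ?w c" for c
    proof (cases "c \<in> charts_at A x")
      case True
      note c = charts_at_D[OF True]
      have d: "diff_at c x f" "diff_at c x (\<lambda>y. s y c)"
        using smooth_in_diff_at[OF c(1) U(1) f(1)[OF c(1)] c(2) U(2)]
          smooth_in_diff_at[OF c(1) U(1) section_smooth_in[OF s(1) c(1) U(1) order_refl] c(2) U(2)] .
      have "pd c \<mu> f x = k c $ \<mu>" for \<mu>
        using arg_cong[OF fun_cong[OF f(3), of c], of "\<lambda>v. v $ \<mu>"] True by (simp add: differential_def)
      then have "pd c \<mu> (\<lambda>y. f y *\<^sub>R s y c) x = k c $ \<mu> *\<^sub>R v c" for \<mu>
        using pd_scaleR[OF d chart_inv_coord[OF c], of \<mu>] f(2) s(2) by simp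
      then show ?thesis using loc[OF U(1) fs U(2) True] True b f(2) by simp
    next
      case False
      then show ?thesis using G[OF G'] by simp
    qed
    then show ?thesis using G' by blast
  qed
  obtain U s where U: "open U" "x \<in> U" and s: "s \<in> sections A F U" "s x = v"
    using ext v unfolding local_sections_def by blast
  obtain c0 where c0: "c0 \<in> charts_at A x" by (rule chart_exists)
  note c0' = charts_at_D[OF c0]
  obtain f where f: "smooth_fun A (dom_of c0) f" "f x = 0" "differential A f x = k"
    using function_with_differential[OF k c0] .
  have o: "open (U \<inter> dom_of c0)" using U(1) open_dom[OF c0'(1)] by blast
  have "smooth_fun A (U \<inter> dom_of c0) f"
    unfolding smooth_fun_def smooth_in_def[symmetric]
  proof
    fix c assume "c \<in> A"
    then show "smooth_in c (U \<inter> dom_of c0) f"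
      using f(1) unfolding smooth_fun_def smooth_in_def[symmetric]
      by (intro smooth_in_subset[OF _ o, of c "dom_of c0"]) auto
  qed
  then have P: "?P (U \<inter> dom_of c0) f s"
    using o U(2) c0'(2) f s sections_subset[OF s(1) o] by auto
  show eq: "principal_symbol A F D x k v = ?w"
    unfolding principal_symbol_def
  proof (rule the_equality)
    show "\<forall>U f s. ?P U f s \<longrightarrow> D (\<lambda>y c. f y *\<^sub>R s y c) x = ?w" using * by blast
    show "w = ?w" if "\<forall>U f s. ?P U f s \<longrightarrow> D (\<lambda>y c. f y *\<^sub>R s y c) x = w" for w
      using that[rule_format, OF P] *[OF P] by simp
  qed
  from *[OF P] have "D (\<lambda>y c. f y *\<^sub>R s y c) x = ?w" "D (\<lambda>y c. f y *\<^sub>R s y c) x \<in> G x" by blast+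
  then show "principal_symbol A F D x k v \<in> G x" unfolding eq by (simp only:)
qed

end

context smooth_manifold
begin

section \<open>Exterior derivatives under changes of charts\<close>

lemma E1_transform:
  assumes "a \<in> sections A (E1_bundle A) U" "x \<in> U" "c \<in> charts_at A x" "c' \<in> charts_at A x"
  shows "a x c = pullE1 (jac c c' x) (a x c')"
  using assms unfolding sections_iff E1_bundle_eq by (intro tensor_fibreD(1)) blast+

lemma E2_transform:
  assumes "s \<in> sections A (E2_bundle A) U" "x \<in> U" "c \<in> charts_at A x" "c' \<in> charts_at A x"
  shows "s x c = pullE2 (jac c c' x) (s x c')"
proof -
  have "s x \<in> tensor_fibre pullE2 A x" using assms(1,2) unfolding sections_iff E2_bundle_eq by blast
  then show ?thesis using assms(3,4) by (rule tensor_fibreD(1))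
qed

lemma E2_antisymmetric:
  assumes "s \<in> sections A (E2_bundle A) U" "x \<in> U" shows "antisymmetric (s x c $ i)"
  using assms unfolding sections_iff E2_bundle_eq by blast

text \<open>Differentiating \<open>a\<^sub>\<nu> = J\<^sup>\<alpha>\<^sub>\<nu> a'\<^sub>\<alpha>\<close> produces the term \<open>(\<partial>\<^sub>\<mu> J\<^sup>\<alpha>\<^sub>\<nu>) a'\<^sub>\<alpha>\<close>, which is symmetric in \<open>\<mu>\<close> and
  \<open>\<nu>\<close>.\<close>

lemma ext_d_transform:
  assumes U: "open U" and a: "a \<in> sections A (E1_bundle A) U" and x: "x \<in> U"
    and c: "c \<in> charts_at A x" and c': "c' \<in> charts_at A x"
  shows "ext_d A a x c = pullE2 (jac c c' x) (ext_d A a x c')"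
proof -
  note C = charts_at_D[OF c] and C' = charts_at_D[OF c']
  let ?V = "U \<inter> dom_of c'"
  have V: "open ?V" using U open_dom[OF C'(1)] by blast
  have da: "diff_at c' x (\<lambda>y. a y c' $ i $ \<alpha>)" for i \<alpha>
    by (rule smooth_in_diff_at[OF C'(1) U smooth_in_nth[OF C'(1) U smooth_in_nth[OF C'(1) U
            section_smooth_in[OF a C'(1) U order_refl]]] C'(2) x])
  note dac = diff_at_chart_change[OF C(1) C'(1) C(2) C'(2) da]
    and pdac = pd_chart_change[OF C(1) C'(1) C(2) C'(2) da]
  have dJ: "diff_at c x (\<lambda>y. jac c c' y $ \<alpha> $ \<mu>)" for \<alpha> \<mu>
    by (rule smooth_in_diff_at[OF C(1) open_dom[OF C'(1)] smooth_in_jac[OF C(1) C'(1)] C(2) C'(2)])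
  have d: "diff_at c x (\<lambda>y. \<Sum>\<alpha>\<in>UNIV. jac c c' y $ \<alpha> $ \<nu> * a y c' $ i $ \<alpha>)" for i \<nu>
    by (intro diff_at_sum diff_at_mult dJ dac)
  define H where "H \<alpha> \<mu> \<nu> = pd c \<mu> (\<lambda>y. jac c c' y $ \<alpha> $ \<nu>) x" for \<alpha> \<mu> \<nu>
  have H: "H \<alpha> \<mu> \<nu> = H \<alpha> \<nu> \<mu>" for \<alpha> \<mu> \<nu>
    unfolding H_def by (rule jac_derivative_symmetric[OF C(1) C'(1) C(2) C'(2)])
  let ?J = "\<lambda>\<alpha> \<mu>. jac c c' x $ \<alpha> $ \<mu>"
  have pd: "pd c \<mu> (\<lambda>y. a y c $ i $ \<nu>) x = (\<Sum>\<alpha>\<in>UNIV. H \<alpha> \<mu> \<nu> * a x c' $ i $ \<alpha>) +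
      (\<Sum>\<beta>\<in>UNIV. \<Sum>\<alpha>\<in>UNIV. ?J \<beta> \<mu> * ?J \<alpha> \<nu> * pd c' \<beta> (\<lambda>y. a y c' $ i $ \<alpha>) x)" for i \<mu> \<nu>
  proof -
    have "pd c \<mu> (\<lambda>y. a y c $ i $ \<nu>) x =
        pd c \<mu> (\<lambda>y. \<Sum>\<alpha>\<in>UNIV. jac c c' y $ \<alpha> $ \<nu> * a y c' $ i $ \<alpha>) x"
    proof (rule pd_cong(1)[OF C(1) V d C(2)])
      show "x \<in> ?V" using x C'(2) by blast
      fix y assume y: "y \<in> dom_of c" "y \<in> ?V"
      then have "a y c = pullE1 (jac c c' y) (a y c')"
        using C(1) C'(1) by (intro E1_transform[OF a]) (auto simp: charts_at_def)
      then show "(\<Sum>\<alpha>\<in>UNIV. jac c c' y $ \<alpha> $ \<nu> * a y c' $ i $ \<alpha>) = a y c $ i $ \<nu>"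
        by (simp add: pull1_nth)
    qed
    also have "\<dots> = (\<Sum>\<alpha>\<in>UNIV. ?J \<alpha> \<nu> * (\<Sum>\<beta>\<in>UNIV. ?J \<beta> \<mu> * pd c' \<beta> (\<lambda>y. a y c' $ i $ \<alpha>) x) +
        H \<alpha> \<mu> \<nu> * a x c' $ i $ \<alpha>)"
      by (simp add: pd_sum diff_at_mult dJ dac pd_mult[OF dJ dac chart_inv_coord[OF C]] H_def pdac)
    also have "\<dots> = (\<Sum>\<alpha>\<in>UNIV. H \<alpha> \<mu> \<nu> * a x c' $ i $ \<alpha>) +
        (\<Sum>\<alpha>\<in>UNIV. \<Sum>\<beta>\<in>UNIV. ?J \<beta> \<mu> * ?J \<alpha> \<nu> * pd c' \<beta> (\<lambda>y. a y c' $ i $ \<alpha>) x)"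
      by (simp add: sum.distrib sum_distrib_left mult_ac)
    finally show ?thesis
      using sum.swap[of "\<lambda>\<alpha> \<beta>. ?J \<beta> \<mu> * ?J \<alpha> \<nu> * pd c' \<beta> (\<lambda>y. a y c' $ i $ \<alpha>) x" UNIV UNIV] by simp
  qed
  have "ext_d A a x c $ i $ \<mu> $ \<nu> = pull2 (jac c c' x) (ext_d A a x c' $ i) $ \<mu> $ \<nu>" for i \<mu> \<nu>
  proof -
    have "(\<Sum>\<beta>\<in>UNIV. \<Sum>\<alpha>\<in>UNIV. ?J \<beta> \<nu> * ?J \<alpha> \<mu> * pd c' \<beta> (\<lambda>y. a y c' $ i $ \<alpha>) x) =
        (\<Sum>\<beta>\<in>UNIV. \<Sum>\<alpha>\<in>UNIV. ?J \<beta> \<mu> * ?J \<alpha> \<nu> * pd c' \<alpha> (\<lambda>y. a y c' $ i $ \<beta>) x)"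
      by (subst sum.swap) (simp only: mult_ac)
    moreover have "(\<Sum>\<alpha>\<in>UNIV. H \<alpha> \<mu> \<nu> * a x c' $ i $ \<alpha>) = (\<Sum>\<alpha>\<in>UNIV. H \<alpha> \<nu> \<mu> * a x c' $ i $ \<alpha>)"
      by (subst H) (rule refl)
    ultimately show ?thesis
      using c c' by (simp add: ext_d_def pd pull2_nth right_diff_distrib sum_subtractf)
  qed
  then show ?thesis by (simp add: vec_eq_iff)
qed

lemma ext_d_section:
  assumes U: "open U" and a: "a \<in> sections A (E1_bundle A) U"
  shows "ext_d A a \<in> sections A (E2_bundle A) U"
  unfolding sections_iff
proof (intro conjI ballI)
  fix x assume x: "x \<in> U"
  have "antisymmetric (ext_d A a x c $ i)" for c i
    by (rule antisymmetricI) (simp add: ext_d_def)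
  moreover have "ext_d A a x \<in> tensor_fibre pullE2 A x"
    unfolding tensor_fibre_def mem_Collect_eq
    by (intro conjI ballI allI impI ext_d_transform[OF U a x]) (simp_all add: ext_d_def)
  ultimately show "ext_d A a x \<in> E2_bundle A x" by (simp add: E2_bundle_eq)
next
  fix c assume c: "c \<in> A"
  have s: "smooth_in c U (\<lambda>x. \<chi> i \<mu> \<nu>. pd c \<mu> (\<lambda>y. a y c $ i $ \<nu>) x - pd c \<nu> (\<lambda>y. a y c $ i $ \<mu>) x)"
    by (intro smooth_in_arith[OF c U] smooth_in_pd[OF c U] smooth_in_nth[OF c U]
        section_smooth_in[OF a c U order_refl])
  show "smooth_in c U (\<lambda>x. ext_d A a x c)"
    by (rule smooth_in_cong[OF c U s]) (simp add: ext_d_def charts_at_def c)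
qed

definition gradient :: "('m \<Rightarrow> 'm chart \<Rightarrow> real^4^4^3) \<Rightarrow> 'm \<Rightarrow> 'm chart \<Rightarrow> 4 \<Rightarrow> real^4^4^3" where
  "gradient s x c \<alpha> = pd c \<alpha> (\<lambda>y. s y c) x"

lemma gradient_nth:
  assumes U: "open U" and s: "s \<in> sections A F U" and x: "x \<in> U" and c: "c \<in> charts_at A x"
  shows "gradient s x c \<alpha> $ i $ \<mu> $ \<nu> = pd c \<alpha> (\<lambda>y. s y c $ i $ \<mu> $ \<nu>) x"
    and "diff_at c x (\<lambda>y. s y c $ i $ \<mu> $ \<nu>)"
proof -
  note C = charts_at_D[OF c]
  have d: "diff_at c x (\<lambda>y. s y c)"
    by (rule smooth_in_diff_at[OF C(1) U section_smooth_in[OF s C(1) U order_refl] C(2) x])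
  show "gradient s x c \<alpha> $ i $ \<mu> $ \<nu> = pd c \<alpha> (\<lambda>y. s y c $ i $ \<mu> $ \<nu>) x"
    by (simp add: gradient_def pd_nth diff_at_nth d)
  show "diff_at c x (\<lambda>y. s y c $ i $ \<mu> $ \<nu>)"
    by (intro diff_at_nth d)
qed

lemma gradient_antisymmetric:
  assumes U: "open U" and s: "s \<in> sections A (E2_bundle A) U" and x: "x \<in> U" and c: "c \<in> charts_at A x"
  shows "antisymmetric (gradient s x c \<alpha> $ i)"
proof (rule antisymmetricI)
  fix \<mu> \<nu>
  note C = charts_at_D[OF c] and g = gradient_nth[OF U s x c]
  have "pd c \<alpha> (\<lambda>y. s y c $ i $ \<mu> $ \<nu>) x = pd c \<alpha> (\<lambda>y. - s y c $ i $ \<nu> $ \<mu>) x"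
    by (rule pd_cong(1)[OF C(1) U diff_at_minus[OF g(2)] C(2) x])
      (rule antisymmetric_nth[OF E2_antisymmetric[OF s], symmetric])
  then show "gradient s x c \<alpha> $ i $ \<mu> $ \<nu> = - gradient s x c \<alpha> $ i $ \<nu> $ \<mu>"
    by (simp add: g pd_minus)
qed

text \<open>Differentiating \<open>s\<^sub>\<nu>\<^sub>\<rho> = J\<^sup>\<alpha>\<^sub>\<nu> J\<^sup>\<beta>\<^sub>\<rho> s'\<^sub>\<alpha>\<^sub>\<beta>\<close> produces two terms with derivatives of \<open>J\<close>. By antisymmetry of
  \<open>s'\<close> they have the form \<open>X\<^sub>\<mu>\<^sub>\<nu>\<^sub>\<rho> - X\<^sub>\<mu>\<^sub>\<rho>\<^sub>\<nu>\<close> with \<open>X\<close> symmetric in its first two indices, and the cyclic sum of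
  such an expression vanishes.\<close>

lemma cyclic_gradient_transform:
  assumes U: "open U" and s: "s \<in> sections A (E2_bundle A) U" and x: "x \<in> U"
    and c: "c \<in> charts_at A x" and c': "c' \<in> charts_at A x"
  shows "cyclic (gradient s x c) i \<mu> \<nu> \<rho> = pull3 (jac c c' x) (cyclic (gradient s x c') i) \<mu> \<nu> \<rho>"
proof -
  note C = charts_at_D[OF c] and C' = charts_at_D[OF c']
  let ?V = "U \<inter> dom_of c'"
  have V: "open ?V" using U open_dom[OF C'(1)] by blast
  note ds = gradient_nth(2)[OF U s x c']
  note dsc = diff_at_chart_change[OF C(1) C'(1) C(2) C'(2) ds]
    and pdsc = pd_chart_change[OF C(1) C'(1) C(2) C'(2) ds]
  have dJ: "diff_at c x (\<lambda>y. jac c c' y $ \<alpha> $ \<mu>)" for \<alpha> \<mu>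
    by (rule smooth_in_diff_at[OF C(1) open_dom[OF C'(1)] smooth_in_jac[OF C(1) C'(1)] C(2) C'(2)])
  have d: "diff_at c x (\<lambda>y. jac c c' y $ \<alpha> $ \<nu> * jac c c' y $ \<beta> $ \<rho> * s y c' $ i $ \<alpha> $ \<beta>)" for \<nu> \<rho> \<alpha> \<beta>
    by (intro diff_at_mult dJ dsc)
  have d2: "diff_at c x (\<lambda>y. \<Sum>\<alpha>\<in>UNIV. \<Sum>\<beta>\<in>UNIV. jac c c' y $ \<alpha> $ \<nu> * jac c c' y $ \<beta> $ \<rho> * s y c' $ i $ \<alpha> $ \<beta>)" for \<nu> \<rho>
    by (intro diff_at_sum d)
  define H where "H \<alpha> \<mu> \<nu> = pd c \<mu> (\<lambda>y. jac c c' y $ \<alpha> $ \<nu>) x" for \<alpha> \<mu> \<nu>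
  have H: "H \<alpha> \<mu> \<nu> = H \<alpha> \<nu> \<mu>" for \<alpha> \<mu> \<nu>
    unfolding H_def by (rule jac_derivative_symmetric[OF C(1) C'(1) C(2) C'(2)])
  let ?J = "\<lambda>\<alpha> \<mu>. jac c c' x $ \<alpha> $ \<mu>" and ?s = "\<lambda>\<alpha> \<beta>. s x c' $ i $ \<alpha> $ \<beta>"
  let ?G = "\<lambda>\<gamma> \<alpha> \<beta>. gradient s x c' \<gamma> $ i $ \<alpha> $ \<beta>"
  \<comment> \<open>the derivative falls on the first Jacobian; by antisymmetry of \<open>s\<close> the other case is \<open>- X \<mu> \<rho> \<nu>\<close>\<close>
  define X where "X \<mu> \<nu> \<rho> = (\<Sum>\<alpha>\<in>UNIV. \<Sum>\<beta>\<in>UNIV. H \<alpha> \<mu> \<nu> * ?J \<beta> \<rho> * ?s \<alpha> \<beta>)" for \<mu> \<nu> \<rho>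
  have X: "X \<mu> \<nu> \<rho> = X \<nu> \<mu> \<rho>" for \<mu> \<nu> \<rho>
    unfolding X_def by (subst H) (rule refl)
  have X': "(\<Sum>\<alpha>\<in>UNIV. \<Sum>\<beta>\<in>UNIV. ?J \<alpha> \<nu> * H \<beta> \<mu> \<rho> * ?s \<alpha> \<beta>) = - X \<mu> \<rho> \<nu>" for \<mu> \<nu> \<rho>
  proof -
    have "(\<Sum>\<alpha>\<in>UNIV. \<Sum>\<beta>\<in>UNIV. ?J \<alpha> \<nu> * H \<beta> \<mu> \<rho> * ?s \<alpha> \<beta>) =
        (\<Sum>\<beta>\<in>UNIV. \<Sum>\<alpha>\<in>UNIV. ?J \<alpha> \<nu> * H \<beta> \<mu> \<rho> * ?s \<alpha> \<beta>)"
      by (rule sum.swap)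
    also have "\<dots> = (\<Sum>\<beta>\<in>UNIV. \<Sum>\<alpha>\<in>UNIV. ?J \<alpha> \<nu> * H \<beta> \<mu> \<rho> * - ?s \<beta> \<alpha>)"
      by (subst antisymmetric_nth[OF E2_antisymmetric[OF s x]]) (rule refl)
    also have "\<dots> = - X \<mu> \<rho> \<nu>"
      unfolding X_def sum_negf[symmetric] mult_minus_right by (simp only: mult_ac)
    finally show ?thesis .
  qed
  have pd: "gradient s x c \<mu> $ i $ \<nu> $ \<rho> = X \<mu> \<nu> \<rho> - X \<mu> \<rho> \<nu> + pull3 (jac c c' x) ?G \<mu> \<nu> \<rho>" for \<mu> \<nu> \<rho>
  proof -
    have "gradient s x c \<mu> $ i $ \<nu> $ \<rho> =
        pd c \<mu> (\<lambda>y. \<Sum>\<alpha>\<in>UNIV. \<Sum>\<beta>\<in>UNIV. jac c c' y $ \<alpha> $ \<nu> * jac c c' y $ \<beta> $ \<rho> * s y c' $ i $ \<alpha> $ \<beta>) x"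
      unfolding gradient_nth(1)[OF U s x c]
    proof (rule pd_cong(1)[OF C(1) V d2 C(2)])
      show "x \<in> ?V" using x C'(2) by blast
      fix y assume y: "y \<in> dom_of c" "y \<in> ?V"
      then have "s y c = pullE2 (jac c c' y) (s y c')"
        using C(1) C'(1) by (intro E2_transform[OF s]) (auto simp: charts_at_def)
      then show "(\<Sum>\<alpha>\<in>UNIV. \<Sum>\<beta>\<in>UNIV. jac c c' y $ \<alpha> $ \<nu> * jac c c' y $ \<beta> $ \<rho> * s y c' $ i $ \<alpha> $ \<beta>) = s y c $ i $ \<nu> $ \<rho>"
        by (simp add: pull2_nth)
    qed
    also have "\<dots> = (\<Sum>\<alpha>\<in>UNIV. \<Sum>\<beta>\<in>UNIV. ?J \<alpha> \<nu> * ?J \<beta> \<rho> * (\<Sum>\<gamma>\<in>UNIV. ?J \<gamma> \<mu> * ?G \<gamma> \<alpha> \<beta>) +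
        (?J \<alpha> \<nu> * H \<beta> \<mu> \<rho> + H \<alpha> \<mu> \<nu> * ?J \<beta> \<rho>) * ?s \<alpha> \<beta>)"
      unfolding pd_sum[OF diff_at_sum[OF d]] pd_sum[OF d]
        pd_mult[OF diff_at_mult[OF dJ dJ] dsc chart_inv_coord[OF C]] pd_mult[OF dJ dJ chart_inv_coord[OF C]]
        pdsc gradient_nth(1)[OF U s x c'] H_def real_scaleR_def ..
    also have "\<dots> = (\<Sum>\<alpha>\<in>UNIV. \<Sum>\<beta>\<in>UNIV. \<Sum>\<gamma>\<in>UNIV. ?J \<gamma> \<mu> * ?J \<alpha> \<nu> * ?J \<beta> \<rho> * ?G \<gamma> \<alpha> \<beta>) +
        ((\<Sum>\<alpha>\<in>UNIV. \<Sum>\<beta>\<in>UNIV. ?J \<alpha> \<nu> * H \<beta> \<mu> \<rho> * ?s \<alpha> \<beta>) + X \<mu> \<nu> \<rho>)"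
      unfolding X_def distrib_right sum.distrib sum_distrib_left by (simp only: mult_ac)
    also have "(\<Sum>\<alpha>\<in>UNIV. \<Sum>\<beta>\<in>UNIV. \<Sum>\<gamma>\<in>UNIV. ?J \<gamma> \<mu> * ?J \<alpha> \<nu> * ?J \<beta> \<rho> * ?G \<gamma> \<alpha> \<beta>) = pull3 (jac c c' x) ?G \<mu> \<nu> \<rho>"
      unfolding pull3_def
      by (rule sum_rotate3[of "\<lambda>\<alpha> \<beta> \<gamma>. ?J \<gamma> \<mu> * ?J \<alpha> \<nu> * ?J \<beta> \<rho> * ?G \<gamma> \<alpha> \<beta>", symmetric])
    finally show ?thesis unfolding X' by simp
  qed
  have "cyclic (gradient s x c) i \<mu> \<nu> \<rho> = pull3 (jac c c' x) ?G \<mu> \<nu> \<rho> + pull3 (jac c c' x) ?G \<nu> \<rho> \<mu> +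
      pull3 (jac c c' x) ?G \<rho> \<mu> \<nu>"
    unfolding cyclic_def pd using X[of \<mu> \<nu> \<rho>] X[of \<mu> \<rho> \<nu>] X[of \<nu> \<rho> \<mu>] by simp
  also have "pull3 (jac c c' x) ?G \<nu> \<rho> \<mu> = pull3 (jac c c' x) (\<lambda>\<gamma> \<alpha> \<beta>. ?G \<alpha> \<beta> \<gamma>) \<mu> \<nu> \<rho>"
    unfolding pull3_def
    by (subst sum_rotate3[of "\<lambda>\<alpha> \<beta> \<gamma>. ?J \<alpha> \<nu> * ?J \<beta> \<rho> * ?J \<gamma> \<mu> * ?G \<alpha> \<beta> \<gamma>", symmetric]) (simp only: mult_ac)
  also have "pull3 (jac c c' x) ?G \<rho> \<mu> \<nu> = pull3 (jac c c' x) (\<lambda>\<gamma> \<alpha> \<beta>. ?G \<beta> \<gamma> \<alpha>) \<mu> \<nu> \<rho>"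
    unfolding pull3_def
    by (subst sum_rotate3[of "\<lambda>\<gamma> \<alpha> \<beta>. ?J \<gamma> \<mu> * ?J \<alpha> \<nu> * ?J \<beta> \<rho> * ?G \<beta> \<gamma> \<alpha>", symmetric]) (simp only: mult_ac)
  also have "pull3 (jac c c' x) ?G \<mu> \<nu> \<rho> + pull3 (jac c c' x) (\<lambda>\<gamma> \<alpha> \<beta>. ?G \<alpha> \<beta> \<gamma>) \<mu> \<nu> \<rho> +
      pull3 (jac c c' x) (\<lambda>\<gamma> \<alpha> \<beta>. ?G \<beta> \<gamma> \<alpha>) \<mu> \<nu> \<rho> = pull3 (jac c c' x) (cyclic (gradient s x c') i) \<mu> \<nu> \<rho>"
    unfolding cyclic_def pull3_add ..
  finally show ?thesis .
qed

end

section \<open>The bundle S and the operators d1 and d2\<close>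

lemma pull2_mult_inverse:
  assumes J: "invertible J" and G: "invertible G"
  shows "pull2 J (h ** matrix_inv G ** S) = pull2 J h ** matrix_inv (pull2 J G) ** pull2 J S"
proof -
  have tJ: "invertible (transpose J)" using J by (rule transpose_invertible)
  have "matrix_inv (pull2 J G) = matrix_inv J ** (matrix_inv G ** matrix_inv (transpose J))"
    unfolding pull2_def by (simp only: matrix_inv_mult J tJ G invertible_mult)
  then have "pull2 J h ** matrix_inv (pull2 J G) ** pull2 J S =
    transpose J ** h ** (J ** matrix_inv J) ** matrix_inv G ** (matrix_inv (transpose J) ** transpose J) ** S ** J"
    by (simp only: pull2_def matrix_mul_assoc)
  then show ?thesis
    by (simp add: matrix_inv_cancel[OF J] matrix_inv_cancel[OF tJ] pull2_def matrix_mul_assoc)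
qed

lemma wedge22_add: "wedge22 (\<alpha> + \<alpha>') \<beta> \<mu> \<nu> \<rho> \<tau> = wedge22 \<alpha> \<beta> \<mu> \<nu> \<rho> \<tau> + wedge22 \<alpha>' \<beta> \<mu> \<nu> \<rho> \<tau>"
  by (simp add: wedge22_def algebra_simps)

lemma wedge22_scale: "wedge22 (r *\<^sub>R \<alpha>) \<beta> \<mu> \<nu> \<rho> \<tau> = r * wedge22 \<alpha> \<beta> \<mu> \<nu> \<rho> \<tau>"
  by (simp add: wedge22_def algebra_simps)

lemma antisymmetric_add:
  assumes "antisymmetric M" "antisymmetric N" shows "antisymmetric (M + N)"
proof (rule antisymmetricI)
  fix a b show "(M + N) $ a $ b = - (M + N) $ b $ a"
    using antisymmetric_nth[OF assms(1), of a b] antisymmetric_nth[OF assms(2), of a b] by simp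
qed

lemma antisymmetric_scale:
  fixes M :: "real^'n^'n"
  assumes "antisymmetric M" shows "antisymmetric (r *\<^sub>R M)"
proof (rule antisymmetricI)
  fix a b show "(r *\<^sub>R M) $ a $ b = - (r *\<^sub>R M) $ b $ a"
    using antisymmetric_nth[OF assms, of a b] by simp
qed

lemma tangent_add:
  assumes "tangent S s" "tangent S t" shows "tangent S (s + t)"
proof -
  have e: "top_wedge (s $ i) (S $ j) + top_wedge (s $ j) (S $ i) = 2/3 * kronecker i j * (\<Sum>k\<in>UNIV. top_wedge (s $ k) (S $ k))"
    "top_wedge (t $ i) (S $ j) + top_wedge (t $ j) (S $ i) = 2/3 * kronecker i j * (\<Sum>k\<in>UNIV. top_wedge (t $ k) (S $ k))" for i j
    using assms unfolding tangent_def by blast+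
  have "top_wedge ((s + t) $ i) (S $ j) + top_wedge ((s + t) $ j) (S $ i) =
      2/3 * kronecker i j * (\<Sum>k\<in>UNIV. top_wedge ((s + t) $ k) (S $ k))" for i j
    using e[of i j] by (simp add: wedge22_add sum.distrib distrib_left)
  then show ?thesis using assms by (simp add: tangent_def antisymmetric_add)
qed

lemma tangent_scale:
  assumes "tangent S s" shows "tangent S (r *\<^sub>R s)"
proof -
  have e: "top_wedge (s $ i) (S $ j) + top_wedge (s $ j) (S $ i) = 2/3 * kronecker i j * (\<Sum>k\<in>UNIV. top_wedge (s $ k) (S $ k))" for i j
    using assms unfolding tangent_def by blast
  have "r * top_wedge (s $ i) (S $ j) + r * top_wedge (s $ j) (S $ i) =
      2/3 * kronecker i j * (\<Sum>k\<in>UNIV. r * top_wedge (s $ k) (S $ k))" for i j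
    unfolding distrib_left[symmetric] e sum_distrib_left[symmetric] by simp
  then show ?thesis using assms by (simp add: tangent_def antisymmetric_scale wedge22_scale)
qed

lemma tangent_sum:
  assumes "\<And>i. i \<in> I \<Longrightarrow> tangent S (s i)" shows "tangent S (\<Sum>i\<in>I. s i)"
proof -
  have "tangent S 0" by (simp add: tangent_def vec_eq_iff transpose_def wedge22_def)
  then show ?thesis using assms
    by (induction I rule: infinite_finite_induct) (simp_all add: tangent_add)
qed

text \<open>The form \<open>k \<and> (v \<lrcorner> S\<^sup>i)\<close> is the antisymmetric part of \<open>B S\<^sup>i\<close> with \<open>B\<close> the rank one matrix
  \<open>2 k v\<^sup>T\<close>.\<close>

lemma symbol1_tangent:
  assumes q: "quaternionic S G" shows "tangent S (symbol1 S k v)"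
  unfolding tangent_iff[OF q]
proof (intro exI allI)
  fix i
  \<comment> \<open>the factor \<open>G\<close> in the witness \<open>?B ** G\<close> cancels the inverse metric\<close>
  let ?B = "(\<chi> \<mu> \<rho>. 2 * k $ \<mu> * v $ \<rho>) :: real^4^4"
  have "?B ** G ** matrix_inv G = ?B ** (G ** matrix_inv G)" by (simp only: matrix_mul_assoc)
  then have B: "?B ** G ** matrix_inv G = ?B"
    by (simp add: matrix_inv_cancel(1)[OF quaternionicD(5)[OF q]])
  show "symbol1 S k v $ i = (1/2) *\<^sub>R (?B ** G ** matrix_inv G ** S $ i - transpose (?B ** G ** matrix_inv G ** S $ i))"
    unfolding B
    by (simp add: symbol1_def outer_def vec_eq_iff transpose_def matrix_matrix_mult_def vector_matrix_mult_def
        sum_distrib_left mult_ac right_diff_distrib sum_divide_distrib diff_divide_distrib)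
qed

lemma sum_alternating_symmetric:
  assumes V: "alternating3 V" and W: "\<And>\<alpha> \<beta> \<gamma>. W \<alpha> \<beta> \<gamma> = (W \<beta> \<alpha> \<gamma> :: real)"
  shows "(\<Sum>\<alpha>\<in>UNIV. \<Sum>\<beta>\<in>UNIV. \<Sum>\<gamma>\<in>UNIV. V \<alpha> \<beta> \<gamma> * W \<alpha> \<beta> \<gamma>) = 0" (is "?S = 0")
proof -
  have "?S = (\<Sum>\<alpha>\<in>UNIV. \<Sum>\<beta>\<in>UNIV. \<Sum>\<gamma>\<in>UNIV. V \<beta> \<alpha> \<gamma> * W \<beta> \<alpha> \<gamma>)" by (rule sum.swap)
  also have "\<dots> = (\<Sum>\<alpha>\<in>UNIV. \<Sum>\<beta>\<in>UNIV. \<Sum>\<gamma>\<in>UNIV. - (V \<alpha> \<beta> \<gamma> * W \<alpha> \<beta> \<gamma>))"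
  proof (intro sum.cong refl)
    fix \<alpha> \<beta> \<gamma>
    show "V \<beta> \<alpha> \<gamma> * W \<beta> \<alpha> \<gamma> = - (V \<alpha> \<beta> \<gamma> * W \<alpha> \<beta> \<gamma>)"
      by (subst alternating3D(1)[OF V], subst W) simp
  qed
  also have "\<dots> = - ?S" by (simp only: sum_negf)
  finally show ?thesis by simp
qed

lemma sum_alternating_symmetric':
  assumes V: "alternating3 V" and W: "\<And>\<alpha> \<beta> \<gamma>. W \<alpha> \<beta> \<gamma> = (W \<gamma> \<beta> \<alpha> :: real)"
  shows "(\<Sum>\<alpha>\<in>UNIV. \<Sum>\<beta>\<in>UNIV. \<Sum>\<gamma>\<in>UNIV. V \<alpha> \<beta> \<gamma> * W \<alpha> \<beta> \<gamma>) = 0"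
proof -
  have "(\<Sum>\<alpha>\<in>UNIV. \<Sum>\<beta>\<in>UNIV. \<Sum>\<gamma>\<in>UNIV. V \<alpha> \<beta> \<gamma> * W \<alpha> \<beta> \<gamma>) = (\<Sum>\<alpha>\<in>UNIV. \<Sum>\<gamma>\<in>UNIV. \<Sum>\<beta>\<in>UNIV. V \<alpha> \<beta> \<gamma> * W \<alpha> \<beta> \<gamma>)"
    by (rule sum.cong[OF refl]) (rule sum.swap)
  also have "\<dots> = (\<Sum>\<alpha>\<in>UNIV. \<Sum>\<gamma>\<in>UNIV. \<Sum>\<beta>\<in>UNIV. - (V \<alpha> \<gamma> \<beta> * W \<alpha> \<beta> \<gamma>))"
  proof (intro sum.cong refl)
    fix \<alpha> \<beta> \<gamma>
    show "V \<alpha> \<beta> \<gamma> * W \<alpha> \<beta> \<gamma> = - (V \<alpha> \<gamma> \<beta> * W \<alpha> \<beta> \<gamma>)"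
      by (subst alternating3D(2)[OF V]) simp
  qed
  also have "\<dots> = 0"
    unfolding sum_negf
    by (subst sum_alternating_symmetric[OF V, of "\<lambda>\<alpha> \<gamma> \<beta>. W \<alpha> \<beta> \<gamma>"]) (rule W, simp)
  finally show ?thesis .
qed

locale hyperkaehler_triple = smooth_manifold A
  for A :: "'m::topological_space chart set" +
  fixes \<Sigma> :: "'m \<Rightarrow> 'm chart \<Rightarrow> real^4^4^3" and g :: "'m \<Rightarrow> 'm chart \<Rightarrow> real^4^4"
  assumes perfect: "perfect_triple A \<Sigma>" and closed: "closed_triple A \<Sigma>" and metric: "triple_metric A \<Sigma> g"
begin

lemma triple_section: "\<Sigma> \<in> sections A (E2_bundle A) UNIV"
  using perfect unfolding perfect_triple_def by blast

lemma triple_transform: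
  assumes "c \<in> charts_at A x" "c' \<in> charts_at A x" shows "\<Sigma> x c = pullE2 (jac c c' x) (\<Sigma> x c')"
  by (rule E2_transform[OF triple_section UNIV_I assms])

lemma triple_antisymmetric: "antisymmetric (\<Sigma> x c $ i)"
  by (rule E2_antisymmetric[OF triple_section UNIV_I])

lemma metric_section: "g \<in> sections A (T2_dual A) UNIV"
  using metric unfolding triple_metric_def riemannian_metric_def by blast

lemma metric_transform:
  assumes "c \<in> charts_at A x" "c' \<in> charts_at A x" shows "g x c = pull2 (jac c c' x) (g x c')"
  using metric_section assms unfolding sections_iff T2_dual_eq by (intro tensor_fibreD(1)) blast+

lemma triple_quaternionic:
  assumes "c \<in> charts_at A x" shows "quaternionic (\<Sigma> x c) (g x c)"
  unfolding quaternionic_def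
proof (intro conjI allI)
  show "transpose (g x c) = g x c"
    using metric assms unfolding triple_metric_def riemannian_metric_def by blast
  show "u \<noteq> 0 \<longrightarrow> u \<bullet> (g x c *v u) > 0" for u
    using metric assms unfolding triple_metric_def riemannian_metric_def by blast
  show "antisymmetric (\<Sigma> x c $ i)" for i by (rule triple_antisymmetric)
  show "raised (\<Sigma> x c) (g x c) i ** raised (\<Sigma> x c) (g x c) j =
      - kronecker i j *\<^sub>R mat 1 + (\<Sum>k\<in>UNIV. eps i j k *\<^sub>R raised (\<Sigma> x c) (g x c) k)" for i j
    using metric assms unfolding triple_metric_def by blast
qed

lemma triple_self_dual:
  assumes "c \<in> charts_at A x" shows "self_dual (\<Sigma> x c) (g x c)"
  using metric assms unfolding triple_metric_def self_dual_def by blast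

lemma triple_vol_nonzero: "c \<in> charts_at A x \<Longrightarrow> vol (\<Sigma> x c) 1 2 3 4 \<noteq> 0"
  using vol_nonzero[OF triple_quaternionic] .

lemma jac_invertible_at:
  assumes "c \<in> charts_at A x" "c' \<in> charts_at A x" shows "invertible (jac c c' x)"
  using jac_invertible charts_at_D[OF assms(1)] charts_at_D[OF assms(2)] by blast

lemma jac_pull_factor:
  assumes "c \<in> charts_at A x" "c' \<in> charts_at A x" shows "pull_factor (jac c c' x) \<noteq> 0"
  using pull_factor_nonzero matrix_inv_cancel(1)[OF jac_invertible_at[OF assms]] .

text \<open>Since both sides transform as tensors, the tensor \<open>h\<close> found in one chart extends to the other ones.\<close>

lemma S_bundle_iff:
  assumes c0: "c0 \<in> charts_at A x"
  shows "s \<in> S_bundle A \<Sigma> g x \<longleftrightarrow> s \<in> E2_bundle A x \<and> tangent (\<Sigma> x c0) (s c0)"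
proof -
  let ?f = "\<lambda>c h i. (1/2) *\<^sub>R (h ** matrix_inv (g x c) ** \<Sigma> x c $ i - transpose (h ** matrix_inv (g x c) ** \<Sigma> x c $ i))"
  have nth: "(s c $ i = ?f c h i) \<longleftrightarrow> (\<forall>\<mu> \<nu>. s c $ i $ \<mu> $ \<nu> = (1/2) *
        ((h ** matrix_inv (g x c) ** (\<Sigma> x c $ i)) $ \<mu> $ \<nu> - (h ** matrix_inv (g x c) ** (\<Sigma> x c $ i)) $ \<nu> $ \<mu>))" for c i h
    by (simp add: vec_eq_iff transpose_def)
  have S: "s \<in> S_bundle A \<Sigma> g x \<longleftrightarrow> s \<in> E2_bundle A x \<and>
      (\<exists>h\<in>T2_dual A x. \<forall>c\<in>charts_at A x. \<forall>i. s c $ i = ?f c (h c) i)"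
    unfolding S_bundle_def mem_Collect_eq nth ..
  show ?thesis
  proof
    assume "s \<in> S_bundle A \<Sigma> g x"
    then show "s \<in> E2_bundle A x \<and> tangent (\<Sigma> x c0) (s c0)"
      unfolding S tangent_iff[OF triple_quaternionic[OF c0]] using c0 by blast
  next
    assume s: "s \<in> E2_bundle A x \<and> tangent (\<Sigma> x c0) (s c0)"
    then obtain h where h: "\<And>i. s c0 $ i = ?f c0 h i"
      unfolding tangent_iff[OF triple_quaternionic[OF c0]] by blast
    let ?h = "extend_tensor pull2 A c0 h x"
    have "?h \<in> T2_dual A x"
      unfolding T2_dual_eq by (rule extend_tensor_fibre(1)[OF representation_pull2 c0])
    moreover have "s c $ i = ?f c (?h c) i" if c: "c \<in> charts_at A x" for c i
    proof -
      let ?J = "jac c c0 x"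
      have s': "s \<in> tensor_fibre pullE2 A x" using s unfolding E2_bundle_eq by blast
      have "s c $ i = pullE2 ?J (s c0) $ i" by (rule arg_cong[OF tensor_fibreD(1)[OF s' c c0]])
      also have "\<dots> = pull2 ?J (?f c0 h i)" unfolding vec_lambda_beta h ..
      also have "\<dots> = ?f c (pull2 ?J h) i"
        unfolding pull2_half_antisymmetrization
          pull2_mult_inverse[OF jac_invertible_at[OF c c0] quaternionicD(5)[OF triple_quaternionic[OF c0]]]
        by (simp only: triple_transform[OF c c0] metric_transform[OF c c0] vec_lambda_beta)
      also have "pull2 ?J h = ?h c" using c by (simp add: extend_tensor_def)
      finally show ?thesis .
    qed
    ultimately show "s \<in> S_bundle A \<Sigma> g x" using s unfolding S by blast
  qed
qed

lemma S_bundle_section_E2: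
  assumes "s \<in> sections A (S_bundle A \<Sigma> g) U" shows "s \<in> sections A (E2_bundle A) U"
  using assms by (auto simp: sections_iff S_bundle_def)

lemma interior_product_nth: "interior_product \<xi> \<Sigma> x c $ i = \<xi> x c v* \<Sigma> x c $ i"
  by (simp add: interior_product_def vector_matrix_mult_def vec_eq_iff mult.commute)

lemma interior_product_section:
  assumes U: "open U" and \<xi>: "\<xi> \<in> sections A (TM A) U"
  shows "interior_product \<xi> \<Sigma> \<in> sections A (E1_bundle A) U"
  unfolding sections_iff
proof (intro conjI ballI)
  fix x assume x: "x \<in> U"
  have \<xi>x: "\<xi> x \<in> tensor_fibre (\<lambda>J v. matrix_inv J *v v) A x"
    using \<xi> x by (auto simp: sections_iff TM_def)
  have "interior_product \<xi> \<Sigma> x c = pullE1 (jac c c' x) (interior_product \<xi> \<Sigma> x c')"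
    if c: "c \<in> charts_at A x" "c' \<in> charts_at A x" for c c'
  proof -
    have "jac c c' x *v \<xi> x c = \<xi> x c'"
      unfolding tensor_fibreD(1)[OF \<xi>x c] matrix_vector_mul_assoc matrix_inv_cancel(1)[OF jac_invertible_at[OF c]]
      by simp
    moreover have "interior_product \<xi> \<Sigma> x c $ i = \<xi> x c v* pull2 (jac c c' x) (\<Sigma> x c' $ i)" for i
      unfolding interior_product_nth triple_transform[OF c] vec_lambda_beta ..
    ultimately have "interior_product \<xi> \<Sigma> x c $ i = pull1 (jac c c' x) (interior_product \<xi> \<Sigma> x c' $ i)" for i
      unfolding interior_product_nth vector_matrix_pull2 by (simp only:)
    then show ?thesis by (subst vec_eq_iff) simp
  qed
  moreover have "interior_product \<xi> \<Sigma> x c = 0" if "c \<notin> charts_at A x" for c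
    using tensor_fibreD(2)[OF \<xi>x that] by (simp add: interior_product_def vec_eq_iff)
  ultimately show "interior_product \<xi> \<Sigma> x \<in> E1_bundle A x"
    unfolding E1_bundle_eq tensor_fibre_def by blast
next
  fix c assume c: "c \<in> A"
  show "smooth_in c U (\<lambda>x. interior_product \<xi> \<Sigma> x c)"
    unfolding interior_product_def
    by (intro smooth_in_arith[OF c U] smooth_in_nth[OF c U] section_smooth_in[OF \<xi> c U
        order_refl] section_smooth_in[OF triple_section c U subset_UNIV])
qed

lemma triple_closed:
  assumes c: "c \<in> charts_at A x"
  shows "gradient \<Sigma> x c \<mu> $ i $ \<rho> $ \<nu> - gradient \<Sigma> x c \<nu> $ i $ \<rho> $ \<mu> = gradient \<Sigma> x c \<rho> $ i $ \<mu> $ \<nu>"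
proof -
  note G = gradient_nth[OF open_UNIV triple_section UNIV_I c]
  have "gradient \<Sigma> x c \<mu> $ i $ \<nu> $ \<rho> + gradient \<Sigma> x c \<nu> $ i $ \<rho> $ \<mu> + gradient \<Sigma> x c \<rho> $ i $ \<mu> $ \<nu> = 0"
    unfolding G using closed c unfolding closed_triple_def by blast
  moreover have "gradient \<Sigma> x c \<mu> $ i $ \<nu> $ \<rho> = - gradient \<Sigma> x c \<mu> $ i $ \<rho> $ \<nu>"
    by (rule antisymmetric_nth[OF gradient_antisymmetric[OF open_UNIV triple_section UNIV_I c]])
  ultimately show ?thesis by linarith
qed

text \<open>Closedness replaces the terms \<open>\<partial>\<^sub>\<mu> \<Sigma>\<^sub>\<rho>\<^sub>\<nu> - \<partial>\<^sub>\<nu> \<Sigma>\<^sub>\<rho>\<^sub>\<mu>\<close> in \<open>d(v \<lrcorner> \<Sigma>)\<close> by the derivative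
  \<open>\<partial>\<^sub>\<rho> \<Sigma>\<^sub>\<mu>\<^sub>\<nu>\<close>, as in Cartan's formula for the Lie derivative.\<close>

definition d1_zeroth_order :: "'m chart \<Rightarrow> 'm \<Rightarrow> real^4 \<Rightarrow> real^4^4^3" where
  "d1_zeroth_order c x v = (\<Sum>\<rho>\<in>UNIV. v $ \<rho> *\<^sub>R gradient \<Sigma> x c \<rho>)"

lemma d1_local:
  assumes U: "open U" and \<xi>: "\<xi> \<in> sections A (TM A) U" and x: "x \<in> U" and c: "c \<in> charts_at A x"
  shows "d1 A \<Sigma> \<xi> x c =
    (\<Sum>\<kappa>\<in>UNIV. symbol1 (\<Sigma> x c) (axis \<kappa> 1) (pd c \<kappa> (\<lambda>y. \<xi> y c) x)) + d1_zeroth_order c x (\<xi> x c)"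
proof -
  note C = charts_at_D[OF c]
  note G = gradient_nth[OF open_UNIV triple_section UNIV_I c]
  have d\<xi>: "diff_at c x (\<lambda>y. \<xi> y c)"
    by (rule smooth_in_diff_at[OF C(1) U section_smooth_in[OF \<xi> C(1) U order_refl] C(2) x])
  have pd: "pd c \<mu> (\<lambda>y. interior_product \<xi> \<Sigma> y c $ i $ \<nu>) x =
      (pd c \<mu> (\<lambda>y. \<xi> y c) x v* \<Sigma> x c $ i) $ \<nu> + (\<Sum>\<rho>\<in>UNIV. \<xi> x c $ \<rho> * gradient \<Sigma> x c \<mu> $ i $ \<rho> $ \<nu>)" for i \<mu> \<nu>
    by (simp add: interior_product_def pd_sum diff_at_mult diff_at_nth d\<xi> G
        pd_mult[OF _ _ chart_inv_coord[OF C]] pd_nth sum.distrib vector_matrix_mult_def mult_ac)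
  have zeroth: "(\<Sum>\<rho>\<in>UNIV. \<xi> x c $ \<rho> * gradient \<Sigma> x c \<mu> $ i $ \<rho> $ \<nu>) -
      (\<Sum>\<rho>\<in>UNIV. \<xi> x c $ \<rho> * gradient \<Sigma> x c \<nu> $ i $ \<rho> $ \<mu>) = d1_zeroth_order c x (\<xi> x c) $ i $ \<mu> $ \<nu>" for i \<mu> \<nu>
    unfolding sum_subtractf[symmetric] right_diff_distrib[symmetric] triple_closed[OF c]
    by (simp add: d1_zeroth_order_def)
  have "d1 A \<Sigma> \<xi> x c $ i $ \<mu> $ \<nu> = ((\<Sum>\<kappa>\<in>UNIV. symbol1 (\<Sigma> x c) (axis \<kappa> 1) (pd c \<kappa> (\<lambda>y. \<xi> y c) x))
      + d1_zeroth_order c x (\<xi> x c)) $ i $ \<mu> $ \<nu>" for i \<mu> \<nu>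
    using c by (simp add: d1_def ext_d_def pd zeroth[symmetric] symbol1_def outer_def axis_def
        sum_subtractf if_distrib[of "\<lambda>t. t * _"] cong: if_cong)
  then show ?thesis by (simp add: vec_eq_iff)
qed

lemma pd_top_wedge:
  assumes c: "c \<in> charts_at A x" and s: "\<And>\<mu> \<nu>. diff_at c x (\<lambda>y. s y $ \<mu> $ \<nu>)" "\<And>\<mu> \<nu>. diff_at c x (\<lambda>y. t y $ \<mu> $ \<nu>)"
  shows "pd c \<alpha> (\<lambda>y. top_wedge (s y) (t y)) x =
      top_wedge (\<chi> \<mu> \<nu>. pd c \<alpha> (\<lambda>y. s y $ \<mu> $ \<nu>) x) (t x) + top_wedge (s x) (\<chi> \<mu> \<nu>. pd c \<alpha> (\<lambda>y. t y $ \<mu> $ \<nu>) x)"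
    and "diff_at c x (\<lambda>y. top_wedge (s y) (t y))"
proof -
  note C = charts_at_D[OF c]
  note m = pd_mult[OF s(1) s(2) chart_inv_coord[OF C]] diff_at_mult[OF s(1) s(2)]
  show "pd c \<alpha> (\<lambda>y. top_wedge (s y) (t y)) x =
      top_wedge (\<chi> \<mu> \<nu>. pd c \<alpha> (\<lambda>y. s y $ \<mu> $ \<nu>) x) (t x) + top_wedge (s x) (\<chi> \<mu> \<nu>. pd c \<alpha> (\<lambda>y. t y $ \<mu> $ \<nu>) x)"
    unfolding wedge22_def by (simp add: pd_add pd_diff diff_at_add diff_at_diff m)
  show "diff_at c x (\<lambda>y. top_wedge (s y) (t y))"
    unfolding wedge22_def by (intro diff_at_add diff_at_diff m(2))
qed

text \<open>Perfect triples in a fixed chart satisfy the equations whose linearisation defines tangency; differentiate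
  them.\<close>

lemma gradient_tangent:
  assumes c: "c \<in> charts_at A x" shows "tangent (\<Sigma> x c) (gradient \<Sigma> x c \<alpha>)"
  unfolding tangent_def
proof (intro conjI allI)
  note C = charts_at_D[OF c]
  note G = gradient_nth[OF open_UNIV triple_section UNIV_I c]
  show "antisymmetric (gradient \<Sigma> x c \<alpha> $ i)" for i
    by (rule gradient_antisymmetric[OF open_UNIV triple_section UNIV_I c])
  let ?W = "\<lambda>i j y. top_wedge (\<Sigma> y c $ i) (\<Sigma> y c $ j)"
  have g: "(\<chi> \<mu> \<nu>. pd c \<alpha> (\<lambda>y. \<Sigma> y c $ i $ \<mu> $ \<nu>) x) = gradient \<Sigma> x c \<alpha> $ i" for i
    by (simp add: vec_eq_iff G)
  have W: "pd c \<alpha> (?W i j) x = top_wedge (gradient \<Sigma> x c \<alpha> $ i) (\<Sigma> x c $ j) + top_wedge (gradient \<Sigma> x c \<alpha> $ j) (\<Sigma> x c $ i)" for i j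
    using pd_top_wedge(1)[OF c G(2) G(2), of \<alpha> i j] unfolding g by (simp add: wedge22_commute[of "\<Sigma> x c $ i"])
  have d: "diff_at c x (?W i j)" for i j by (rule pd_top_wedge(2)[OF c G(2) G(2)])
  fix i j :: 3
  have dsum: "diff_at c x (\<lambda>y. (1/3) * kronecker i j * (\<Sum>k\<in>UNIV. ?W k k y))"
    by (intro diff_at_mult diff_at_const diff_at_sum d)
  have "pd c \<alpha> (?W i j) x = pd c \<alpha> (\<lambda>y. (1/3) * kronecker i j * (\<Sum>k\<in>UNIV. ?W k k y)) x"
  proof (rule pd_cong(1)[OF C(1) open_UNIV dsum C(2) UNIV_I])
    fix y assume "y \<in> dom_of c"
    then have "c \<in> charts_at A y" using C(1) by (simp add: charts_at_def)
    then have "?W i j y = 2 * kronecker i j * vol (\<Sigma> y c) 1 2 3 4"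
      using perfect unfolding perfect_triple_def by blast
    then show "(1/3) * kronecker i j * (\<Sum>k\<in>UNIV. ?W k k y) = ?W i j y" by (simp add: vol_def)
  qed
  also have "\<dots> = (1/3) * kronecker i j * (\<Sum>k\<in>UNIV. pd c \<alpha> (?W k k) x)"
    unfolding pd_linear[OF bounded_linear_mult_right diff_at_sum[OF d]] pd_sum[OF d] ..
  finally show "top_wedge (gradient \<Sigma> x c \<alpha> $ i) (\<Sigma> x c $ j) + top_wedge (gradient \<Sigma> x c \<alpha> $ j) (\<Sigma> x c $ i) =
      2/3 * kronecker i j * (\<Sum>k\<in>UNIV. top_wedge (gradient \<Sigma> x c \<alpha> $ k) (\<Sigma> x c $ k))"
    unfolding W by (simp add: sum_3)
qed

lemma d1_section:
  assumes U: "open U" and \<xi>: "\<xi> \<in> sections A (TM A) U"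
  shows "d1 A \<Sigma> \<xi> \<in> sections A (S_bundle A \<Sigma> g) U"
proof -
  have E2: "d1 A \<Sigma> \<xi> \<in> sections A (E2_bundle A) U"
    unfolding d1_def by (rule ext_d_section[OF U interior_product_section[OF U \<xi>]])
  have "d1 A \<Sigma> \<xi> x \<in> S_bundle A \<Sigma> g x" if x: "x \<in> U" for x
  proof -
    obtain c where c: "c \<in> charts_at A x" by (rule chart_exists)
    have "tangent (\<Sigma> x c) (d1 A \<Sigma> \<xi> x c)"
      unfolding d1_local[OF U \<xi> x c] d1_zeroth_order_def
      by (intro tangent_add tangent_sum tangent_scale symbol1_tangent[OF triple_quaternionic[OF c]] gradient_tangent[OF c])
    then show ?thesis using E2 x by (simp add: S_bundle_iff[OF c] sections_iff)
  qed
  then show ?thesis using E2 by (simp add: sections_iff)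
qed

lemma christoffel_symmetric:
  assumes c: "c \<in> charts_at A x" shows "christoffel g c x \<kappa> \<mu> \<nu> = christoffel g c x \<kappa> \<nu> \<mu>"
proof -
  note C = charts_at_D[OF c]
  have "diff_at c x (\<lambda>y. g y c $ \<mu> $ \<nu>)" for \<mu> \<nu>
    by (rule smooth_in_diff_at[OF C(1) open_UNIV smooth_in_nth[OF C(1) open_UNIV smooth_in_nth[OF C(1) open_UNIV
            section_smooth_in[OF metric_section C(1) open_UNIV order_refl]]] C(2) UNIV_I])
  from pd_cong(1)[OF C(1) open_UNIV this C(2) UNIV_I]
  have "pd c \<rho> (\<lambda>y. g y c $ \<nu> $ \<mu>) x = pd c \<rho> (\<lambda>y. g y c $ \<mu> $ \<nu>) x" for \<rho>
  proof -
    have "g y c $ \<mu> $ \<nu> = g y c $ \<nu> $ \<mu>" if "y \<in> dom_of c" for y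
    proof -
      have "c \<in> charts_at A y" using that C(1) by (simp add: charts_at_def)
      from arg_cong[OF quaternionicD(1)[OF triple_quaternionic[OF this]], of "\<lambda>M. M $ \<nu> $ \<mu>"]
      show ?thesis by (simp add: transpose_def)
    qed
    then show ?thesis
      by (intro pd_cong(1)[OF C(1) open_UNIV \<open>\<And>\<mu> \<nu>. diff_at c x (\<lambda>y. g y c $ \<mu> $ \<nu>)\<close> C(2) UNIV_I])
  qed
  then show ?thesis unfolding christoffel_def by (simp add: add.commute)
qed

text \<open>The volume form is alternating and the Christoffel symbols are symmetric in their lower indices, so they drop out
  and the covariant derivatives may be replaced by partial ones.\<close>

lemma star_d_eq:
  assumes U: "open U" and s: "s \<in> sections A (E2_bundle A) U" and x: "x \<in> U" and c: "c \<in> charts_at A x"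
  shows "star_d \<Sigma> g s x c = star3 (\<Sigma> x c) (g x c) (gradient s x c)"
proof -
  have "star_d \<Sigma> g s x c $ i $ \<mu> = star3 (\<Sigma> x c) (g x c) (gradient s x c) $ i $ \<mu>" for i \<mu>
  proof -
    let ?V = "pull3 (matrix_inv (g x c)) (vol (\<Sigma> x c) \<mu>)"
    let ?\<Gamma> = "christoffel g c x" and ?s = "s x c $ i"
    have V: "alternating3 ?V" by (intro pull3_alternating vol_alternating triple_antisymmetric)
    have V': "?V \<alpha> \<beta> \<gamma> = (\<Sum>\<kappa>\<in>UNIV. \<Sum>\<rho>\<in>UNIV. \<Sum>\<tau>\<in>UNIV. vol (\<Sigma> x c) \<mu> \<kappa> \<rho> \<tau> *
         matrix_inv (g x c) $ \<kappa> $ \<alpha> * matrix_inv (g x c) $ \<rho> $ \<beta> * matrix_inv (g x c) $ \<tau> $ \<gamma>)" for \<alpha> \<beta> \<gamma>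
      unfolding pull3_def by (simp only: mult_ac)
    have 1: "(\<Sum>\<alpha>\<in>UNIV. \<Sum>\<beta>\<in>UNIV. \<Sum>\<gamma>\<in>UNIV. ?V \<alpha> \<beta> \<gamma> * (\<Sum>\<kappa>\<in>UNIV. ?\<Gamma> \<kappa> \<alpha> \<beta> * ?s $ \<kappa> $ \<gamma>)) = 0"
      by (rule sum_alternating_symmetric[OF V]) (subst christoffel_symmetric[OF c], rule refl)
    have 2: "(\<Sum>\<alpha>\<in>UNIV. \<Sum>\<beta>\<in>UNIV. \<Sum>\<gamma>\<in>UNIV. ?V \<alpha> \<beta> \<gamma> * (\<Sum>\<kappa>\<in>UNIV. ?\<Gamma> \<kappa> \<alpha> \<gamma> * ?s $ \<beta> $ \<kappa>)) = 0"
      by (rule sum_alternating_symmetric'[OF V]) (subst christoffel_symmetric[OF c], rule refl)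
    show ?thesis
      unfolding star_d_def star3_def vec_lambda_beta nabla_def V'[symmetric] gradient_nth(1)[OF U s x c]
        right_diff_distrib sum_subtractf 1 2 by simp
  qed
  then show ?thesis by (simp add: vec_eq_iff)
qed

lemma d2_local:
  assumes U: "open U" and s: "s \<in> sections A (E2_bundle A) U" and x: "x \<in> U" and c: "c \<in> charts_at A x"
  shows "d2 A \<Sigma> g s x c = connection (\<Sigma> x c) (g x c) (gradient s x c)"
  using c by (simp add: d2_def connection_def star_d_eq[OF assms])

lemma d2_iff:
  assumes U: "open U" and s: "s \<in> sections A (E2_bundle A) U" and x: "x \<in> U" and c: "c \<in> charts_at A x"
  shows "connection_eq (\<Sigma> x c) (cyclic (gradient s x c)) a \<longleftrightarrow> a = d2 A \<Sigma> g s x c"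
  unfolding d2_local[OF assms]
  by (rule connection_eq_iff[OF triple_quaternionic[OF c] triple_self_dual[OF c] gradient_antisymmetric[OF assms]])

lemma smooth_in_metric_inv:
  assumes c: "c \<in> A" and U: "open U"
  shows "smooth_in c U (\<lambda>x. matrix_inv (g x c) $ \<mu> $ \<nu>)"
proof (rule smooth_in_matrix_inv[OF c U])
  show "smooth_in c U (\<lambda>x. g x c $ i $ j)" for i j
    by (intro smooth_in_nth[OF c U] section_smooth_in[OF metric_section c U subset_UNIV])
  show "invertible (g x c)" if "x \<in> dom_of c" for x
    using that c by (intro quaternionicD(5)[OF triple_quaternionic]) (simp add: charts_at_def)
qed

lemma smooth_in_triple:
  assumes c: "c \<in> A" and U: "open U"
  shows "smooth_in c U (\<lambda>x. \<Sigma> x c $ i $ \<mu> $ \<nu>)"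
  by (intro smooth_in_nth[OF c U] section_smooth_in[OF triple_section c U subset_UNIV])

lemma smooth_in_vol:
  assumes c: "c \<in> A" and U: "open U"
  shows "smooth_in c U (\<lambda>x. vol (\<Sigma> x c) \<mu> \<nu> \<rho> \<tau>)"
  unfolding vol_def wedge22_def
  by (intro smooth_in_arith[OF c U] smooth_in_triple[OF c U])

text \<open>The inverse of \<open>J1\<close> is \<open>(1/2) (J1 - 1)\<close>, a polynomial in \<open>J1\<close>, so the connection is polynomial in its arguments, the
  triple and the inverse metric.\<close>

lemma smooth_in_connection:
  assumes c: "c \<in> A" and U: "open U"
    and Q: "\<And>\<alpha> i \<beta> \<gamma>. smooth_in c U (\<lambda>x. Q x \<alpha> $ i $ \<beta> $ \<gamma>)"
  shows "smooth_in c U (\<lambda>x. connection (\<Sigma> x c) (g x c) (Q x))"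
proof -
  let ?w = "\<lambda>x. star3 (\<Sigma> x c) (g x c) (Q x)"
  have w: "smooth_in c U (\<lambda>x. ?w x $ i $ \<mu>)" for i \<mu>
    unfolding star3_def vec_lambda_beta pull3_def
    by (intro smooth_in_arith[OF c U] smooth_in_vol[OF c U] smooth_in_metric_inv[OF c U] Q)
  have J: "smooth_in c U (\<lambda>x. J1 (\<Sigma> x c) (g x c) (?w x))"
    unfolding J1_def raised_def matrix_matrix_mult_def vec_lambda_beta
    by (intro smooth_in_arith[OF c U] smooth_in_metric_inv[OF c U] smooth_in_triple[OF c U] w)
  have "smooth_in c U (\<lambda>x. \<chi> i \<mu>. ?w x $ i $ \<mu>)"
    by (intro smooth_in_vec_lambda[OF c U] w)
  then have w': "smooth_in c U ?w" by (simp only: vec_nth_inverse)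
  have "smooth_in c U (\<lambda>x. (1/2) *\<^sub>R ((1/2) *\<^sub>R (J1 (\<Sigma> x c) (g x c) (?w x) - ?w x)))"
    by (intro smooth_in_arith[OF c U] J w')
  then show ?thesis
  proof (rule smooth_in_cong[OF c U])
    fix x assume "x \<in> dom_of c"
    then have "c \<in> charts_at A x" using c by (simp add: charts_at_def)
    then show "(1/2) *\<^sub>R ((1/2) *\<^sub>R (J1 (\<Sigma> x c) (g x c) (?w x) - ?w x)) = connection (\<Sigma> x c) (g x c) (Q x)"
      unfolding connection_def inv_J1[OF triple_quaternionic] by (simp add: inv_J1[OF triple_quaternionic])
  qed
qed

text \<open>The equation that characterises \<open>d2 s\<close> is natural under changes of coordinates, so by uniqueness its solution
  transforms as a 1-form.\<close>

lemma d2_section: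
  assumes U: "open U" and s: "s \<in> sections A (E2_bundle A) U"
  shows "d2 A \<Sigma> g s \<in> sections A (E1_bundle A) U"
  unfolding sections_iff
proof (intro conjI ballI)
  fix x assume x: "x \<in> U"
  have law: "d2 A \<Sigma> g s x c = pullE1 (jac c c' x) (d2 A \<Sigma> g s x c')"
    if c: "c \<in> charts_at A x" "c' \<in> charts_at A x" for c c'
  proof -
    have "connection_eq (\<Sigma> x c') (cyclic (gradient s x c')) (d2 A \<Sigma> g s x c')"
      using d2_iff[OF U s x c(2)] by blast
    from connection_eq_pull[OF this, of "jac c c' x"]
    have "connection_eq (\<Sigma> x c) (cyclic (gradient s x c)) (pullE1 (jac c c' x) (d2 A \<Sigma> g s x c'))"
      unfolding triple_transform[OF c, symmetric] connection_eq_def cyclic_gradient_transform[OF U s x c] .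
    then show ?thesis using d2_iff[OF U s x c(1)] by simp
  qed
  show "d2 A \<Sigma> g s x \<in> E1_bundle A x"
    unfolding E1_bundle_eq tensor_fibre_def mem_Collect_eq
    by (intro conjI ballI allI impI law) (simp_all add: d2_def)
next
  fix c assume c: "c \<in> A"
  have "smooth_in c U (\<lambda>x. connection (\<Sigma> x c) (g x c) (gradient s x c))"
    unfolding gradient_def
    by (intro smooth_in_connection[OF c U] smooth_in_nth[OF c U] smooth_in_pd[OF c U]
       
        section_smooth_in[OF s c U order_refl])
  then show "smooth_in c U (\<lambda>x. d2 A \<Sigma> g s x c)"
    by (rule smooth_in_cong[OF c U]) (simp add: d2_local[OF U s] charts_at_def c)
qed

end

section \<open>The operator d3 and the complex\<close>

lemma symbol1_linear: "linear (symbol1 S k)"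
  by (rule linearI) (simp_all add: symbol1_def outer_def vec_eq_iff vector_matrix_mult_def sum_4 algebra_simps)

lemma symbol1_axis_sum: "(\<Sum>\<kappa>\<in>UNIV. symbol1 S (axis \<kappa> 1) (k $ \<kappa> *\<^sub>R v)) = symbol1 S k v"
  unfolding linear_scale[OF symbol1_linear]
  by (simp add: symbol1_def outer_def vec_eq_iff axis_def right_diff_distrib sum_subtractf
      if_distrib[of "\<lambda>t. t * _"] if_distrib[of "\<lambda>t. _ * t"] cong: if_cong)

lemma wedge22_add_right: "wedge22 \<alpha> (\<beta> + \<beta>') \<mu> \<nu> \<rho> \<tau> = wedge22 \<alpha> \<beta> \<mu> \<nu> \<rho> \<tau> + wedge22 \<alpha> \<beta>' \<mu> \<nu> \<rho> \<tau>"
  by (simp add: wedge22_def algebra_simps)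

lemma wedge22_scale_right: "wedge22 \<alpha> (r *\<^sub>R \<beta>) \<mu> \<nu> \<rho> \<tau> = r * wedge22 \<alpha> \<beta> \<mu> \<nu> \<rho> \<tau>"
  by (simp add: wedge22_def algebra_simps)

lemma outer_linear: "linear (outer k)"
  by (rule linearI) (simp_all add: outer_def vec_eq_iff algebra_simps)

lemma outer_axis_sum: "(\<Sum>\<kappa>\<in>UNIV. outer (axis \<kappa> 1) (k $ \<kappa> *\<^sub>R b)) = outer k b"
  unfolding linear_scale[OF outer_linear]
  by (simp add: outer_def vec_eq_iff axis_def right_diff_distrib sum_subtractf
      if_distrib[of "\<lambda>t. t * _"] if_distrib[of "\<lambda>t. _ * t"] cong: if_cong)

text \<open>The algebraic part \<open>f \<mapsto> \<epsilon>\<^sup>i\<^sup>j\<^sup>k S\<^sup>j \<and> f\<^sup>k / v\<close> of \<open>d3\<close>, which is common to the operator and its symbol.\<close>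

definition wedge_contraction :: "real^4^4^3 \<Rightarrow> real^4^4^3 \<Rightarrow> real^3" where
  "wedge_contraction S f = (\<chi> i. \<Sum>j\<in>UNIV. \<Sum>l\<in>UNIV. eps i j l * (top_wedge (S $ j) (f $ l) / vol S 1 2 3 4))"

lemma symbol3_eq_wedge_contraction: "symbol3 S k a = wedge_contraction S (\<chi> l. outer k (a $ l))"
  by (simp add: symbol3_def wedge_contraction_def)

lemma wedge_contraction_linear: "linear (wedge_contraction S)"
  by (rule linearI) (simp_all add: wedge_contraction_def vec_eq_iff wedge22_add_right wedge22_scale_right
      sum_3 add_divide_distrib algebra_simps)

lemma symbol3_linear: "linear (symbol3 S k)"
proof -
  have "symbol3 S k = wedge_contraction S \<circ> (\<lambda>a. \<chi> l. outer k (a $ l))"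
    by (simp add: fun_eq_iff symbol3_eq_wedge_contraction)
  moreover have "linear (\<lambda>a :: real^4^3. \<chi> l. outer k (a $ l))"
    by (rule linearI) (simp_all add: vec_eq_iff linear_add[OF outer_linear] linear_scale[OF outer_linear])
  ultimately show ?thesis using linear_compose wedge_contraction_linear by metis
qed

lemma symbol3_axis_sum: "(\<Sum>\<kappa>\<in>UNIV. symbol3 S (axis \<kappa> 1) (k $ \<kappa> *\<^sub>R a)) = symbol3 S k a"
proof -
  have "(\<Sum>\<kappa>\<in>UNIV. (\<chi> l. outer (axis \<kappa> 1) ((k $ \<kappa> *\<^sub>R a) $ l))) = (\<chi> l. outer k (a $ l))"
    by (subst vec_eq_iff) (simp add: outer_axis_sum)
  then show ?thesis
    unfolding symbol3_eq_wedge_contraction linear_sum[OF wedge_contraction_linear, symmetric] by simp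
qed

text \<open>The family that is \<open>s\<close> in direction \<open>\<kappa>\<close> and zero in the other ones; it isolates the coefficient of one partial
  derivative in \<open>d2\<close>.\<close>

abbreviation single :: "4 \<Rightarrow> real^4^4^3 \<Rightarrow> 4 \<Rightarrow> real^4^4^3" where
  "single \<kappa> s \<equiv> (\<lambda>\<alpha>. if \<alpha> = \<kappa> then s else 0)"

lemma
  assumes "quaternionic S G"
  shows connection_single_linear: "linear (\<lambda>s. connection S G (single \<kappa> s))"
    and connection_single_sum: "(\<Sum>\<kappa>\<in>UNIV. connection S G (single \<kappa> (Q \<kappa>))) = connection S G Q"
proof -
  define L where "L w = (1/2) *\<^sub>R inv (J1 S G) w" for w
  have L: "linear L"
    unfolding L_def inv_J1[OF assms]
    by (rule linearI) (simp_all add: linear_add[OF J1_linear] linear_scale[OF J1_linear] algebra_simps)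
  have conn: "connection S G Q = L (star3 S G Q)" for Q
    by (simp add: connection_def L_def)
  have star: "star3 S G (single \<kappa> s) $ i $ \<mu> = (\<Sum>\<beta>\<in>UNIV. \<Sum>\<gamma>\<in>UNIV.
      pull3 (matrix_inv G) (vol S \<mu>) \<kappa> \<beta> \<gamma> * s $ i $ \<beta> $ \<gamma>)" for s \<kappa> i \<mu>
  proof -
    have "star3 S G (single \<kappa> s) $ i $ \<mu> = (\<Sum>\<alpha>\<in>UNIV. if \<alpha> = \<kappa> then (\<Sum>\<beta>\<in>UNIV. \<Sum>\<gamma>\<in>UNIV.
        pull3 (matrix_inv G) (vol S \<mu>) \<alpha> \<beta> \<gamma> * s $ i $ \<beta> $ \<gamma>) else 0)"
      unfolding star3_def vec_lambda_beta by (rule sum.cong[OF refl]) simp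
    then show ?thesis by simp
  qed
  have "linear (\<lambda>s. star3 S G (single \<kappa> s))"
    by (rule linearI) (simp_all add: vec_eq_iff star distrib_left sum.distrib sum_distrib_left mult_ac)
  then show "linear (\<lambda>s. connection S G (single \<kappa> s))"
    unfolding conn using linear_compose[OF _ L] by (simp add: o_def)
  have "(\<Sum>\<kappa>\<in>UNIV. star3 S G (single \<kappa> (Q \<kappa>))) = star3 S G Q"
    by (simp add: vec_eq_iff star) (simp add: star3_def)
  then show "(\<Sum>\<kappa>\<in>UNIV. connection S G (single \<kappa> (Q \<kappa>))) = connection S G Q"
    unfolding conn linear_sum[OF L, symmetric] by simp
qed

context smooth_manifold
begin

lemma first_order_operatorI:
  fixes F :: "'m \<Rightarrow> ('m chart \<Rightarrow> 'v::real_normed_vector) set"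
    and G :: "'m \<Rightarrow> ('m chart \<Rightarrow> 'w::real_normed_vector) set"
  assumes D: "\<And>U s. open U \<Longrightarrow> s \<in> sections A F U \<Longrightarrow> D s \<in> sections A G U"
    and a: "\<And>c x \<mu>. c \<in> charts_at A x \<Longrightarrow> linear (a c x \<mu>)" and b: "\<And>c x. c \<in> charts_at A x \<Longrightarrow> linear (b c x)"
    and sa: "\<And>c \<mu> v. c \<in> A \<Longrightarrow> smooth_in c UNIV (\<lambda>x. a c x \<mu> v)"
    and sb: "\<And>c v. c \<in> A \<Longrightarrow> smooth_in c UNIV (\<lambda>x. b c x v)"
    and loc: "\<And>U s x c. open U \<Longrightarrow> s \<in> sections A F U \<Longrightarrow> x \<in> U \<Longrightarrow> c \<in> charts_at A x \<Longrightarrow>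
      D s x c = (\<Sum>\<mu>\<in>UNIV. a c x \<mu> (pd c \<mu> (\<lambda>y. s y c) x)) + b c x (s x c)"
  shows "first_order_operator A F G D"
  unfolding first_order_operator_def
proof (intro conjI allI impI ballI)
  show "D s \<in> sections A G U" if "open U \<and> s \<in> sections A F U" for U s using D that by blast
  fix c assume c: "c \<in> A"
  have ch: "c \<in> charts_at A x" if "x \<in> dom_of c" for x using c that by (simp add: charts_at_def)
  show "\<exists>(a :: 4 \<Rightarrow> 'm \<Rightarrow> 'v \<Rightarrow> 'w) (b :: 'm \<Rightarrow> 'v \<Rightarrow> 'w).
      (\<forall>x\<in>dom_of c. (\<forall>\<mu>. linear (a \<mu> x)) \<and> linear (b x)) \<and>
      (\<forall>v. (\<forall>\<mu>. smooth_on (coord c ` dom_of c) ((\<lambda>x. a \<mu> x v) \<circ> chart_inv c)) \<and>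
           smooth_on (coord c ` dom_of c) ((\<lambda>x. b x v) \<circ> chart_inv c)) \<and>
      (\<forall>U s x. open U \<and> s \<in> sections A F U \<and> x \<in> U \<inter> dom_of c \<longrightarrow>
        D s x c = (\<Sum>\<mu>\<in>UNIV. a \<mu> x (pd c \<mu> (\<lambda>y. s y c) x)) + b x (s x c))"
  proof (intro exI[of _ "\<lambda>\<mu> x. a c x \<mu>"] exI[of _ "b c"] conjI ballI allI impI)
    show "linear (a c x \<mu>)" "linear (b c x)" if "x \<in> dom_of c" for x \<mu>
      using a b ch[OF that] by blast+
    show "smooth_on (coord c ` dom_of c) ((\<lambda>x. a c x \<mu> v) \<circ> chart_inv c)" for v \<mu>
      using sa[OF c, of \<mu> v] by (simp add: smooth_in_def)
    show "smooth_on (coord c ` dom_of c) ((\<lambda>x. b c x v) \<circ> chart_inv c)" for v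
      using sb[OF c, of v] by (simp add: smooth_in_def)
    show "D s x c = (\<Sum>\<mu>\<in>UNIV. a c x \<mu> (pd c \<mu> (\<lambda>y. s y c) x)) + b c x (s x c)"
      if "open U \<and> s \<in> sections A F U \<and> x \<in> U \<inter> dom_of c" for U s x
      using loc ch that by blast
  qed
qed

lemma tensor_fibre_zero:
  assumes "\<And>J. \<rho> J 0 = 0" shows "(\<lambda>_. 0) \<in> tensor_fibre \<rho> A x"
  using assms by (simp add: tensor_fibre_def)

lemma covector_nonzero_at:
  assumes "k \<in> T_dual A x" "k \<noteq> (\<lambda>_. 0)" "c \<in> charts_at A x" shows "k c \<noteq> 0"
proof
  assume "k c = 0"
  moreover have "(\<lambda>_. 0) \<in> tensor_fibre pull1 A x"
    by (rule tensor_fibre_zero) (simp add: pull1_def)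
  ultimately have "k = (\<lambda>_. 0)"
    using tensor_fibre_eqI[OF assms(1)[unfolded T_dual_eq] _ assms(3)] by blast
  with assms(2) show False ..
qed

end

context hyperkaehler_triple
begin

lemma ext_d_eq_outer:
  assumes U: "open U" and a: "a \<in> sections A (E1_bundle A) U" and x: "x \<in> U" and c: "c \<in> charts_at A x"
  shows "ext_d A a x c = (\<Sum>\<kappa>\<in>UNIV. \<chi> l. outer (axis \<kappa> 1) (pd c \<kappa> (\<lambda>y. a y c) x $ l))"
proof -
  note C = charts_at_D[OF c]
  have d: "diff_at c x (\<lambda>y. a y c)"
    by (rule smooth_in_diff_at[OF C(1) U section_smooth_in[OF a C(1) U order_refl] C(2) x])
  show ?thesis
    using c by (simp add: ext_d_def vec_eq_iff outer_def axis_def pd_nth diff_at_nth d sum_subtractf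
        if_distrib[of "\<lambda>t. t * _"] cong: if_cong)
qed

lemma d3_eq_wedge_contraction: "c \<in> charts_at A x \<Longrightarrow> d3 A \<Sigma> a x c = wedge_contraction (\<Sigma> x c) (ext_d A a x c)"
  by (simp add: d3_def wedge_contraction_def)

lemma d3_local:
  assumes U: "open U" and a: "a \<in> sections A (E1_bundle A) U" and x: "x \<in> U" and c: "c \<in> charts_at A x"
  shows "d3 A \<Sigma> a x c = (\<Sum>\<kappa>\<in>UNIV. symbol3 (\<Sigma> x c) (axis \<kappa> 1) (pd c \<kappa> (\<lambda>y. a y c) x))"
  unfolding d3_eq_wedge_contraction[OF c] ext_d_eq_outer[OF assms] linear_sum[OF wedge_contraction_linear]
    symbol3_eq_wedge_contraction ..

lemma d3_section:
  assumes U: "open U" and a: "a \<in> sections A (E1_bundle A) U"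
  shows "d3 A \<Sigma> a \<in> sections A (E_bundle A) U"
  unfolding sections_iff
proof (intro conjI ballI)
  fix x assume x: "x \<in> U"
  have law: "d3 A \<Sigma> a x c = d3 A \<Sigma> a x c'" if c: "c \<in> charts_at A x" "c' \<in> charts_at A x" for c c'
  proof -
    have anti: "antisymmetric (ext_d A a x c' $ i)" for i
      by (rule E2_antisymmetric[OF ext_d_section[OF U a] x])
    show ?thesis
      unfolding d3_eq_wedge_contraction[OF c(1)] d3_eq_wedge_contraction[OF c(2)] ext_d_transform[OF U a x c]
        triple_transform[OF c] wedge_contraction_def vol_pull[OF triple_antisymmetric]
      by (simp add: top_wedge_pull2 triple_antisymmetric anti jac_pull_factor[OF c])
  qed
  show "d3 A \<Sigma> a x \<in> E_bundle A x"
    unfolding E_bundle_def tensor_fibre_def mem_Collect_eq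
    by (intro conjI ballI allI impI law) (simp_all add: d3_def)
next
  fix c assume c: "c \<in> A"
  have ch: "c \<in> charts_at A x" if "x \<in> dom_of c" for x using c that by (simp add: charts_at_def)
  have "smooth_in c U (\<lambda>x. \<chi> i. \<Sum>j\<in>UNIV. \<Sum>l\<in>UNIV. eps i j l *
      (top_wedge (\<Sigma> x c $ j) (ext_d A a x c $ l) / vol (\<Sigma> x c) 1 2 3 4))"
    unfolding wedge22_def
    by (intro smooth_in_arith[OF c U] smooth_in_divide[OF c U] smooth_in_triple[OF c U]
        smooth_in_vol[OF c U] smooth_in_nth[OF c U] section_smooth_in[OF ext_d_section[OF U
        a] c U order_refl] triple_vol_nonzero ch)
  then show "smooth_in c U (\<lambda>x. d3 A \<Sigma> a x c)"
    by (rule smooth_in_cong[OF c U]) (simp add: d3_def ch)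
qed

lemma d1_first_order: "first_order_operator A (TM A) (S_bundle A \<Sigma> g) (d1 A \<Sigma>)"
proof (rule first_order_operatorI[where a = "\<lambda>c x \<mu>. symbol1 (\<Sigma> x c) (axis \<mu> 1)" and b = d1_zeroth_order])
  show "d1 A \<Sigma> s \<in> sections A (S_bundle A \<Sigma> g) U" if "open U" "s \<in> sections A (TM A) U" for U s
    by (rule d1_section[OF that])
  show "d1 A \<Sigma> s x c =
      (\<Sum>\<mu>\<in>UNIV. symbol1 (\<Sigma> x c) (axis \<mu> 1) (pd c \<mu> (\<lambda>y. s y c) x)) + d1_zeroth_order c x (s x c)"
    if "open U" "s \<in> sections A (TM A) U" "x \<in> U" "c \<in> charts_at A x" for U s x c
    by (rule d1_local[OF that])
  show "linear (symbol1 (\<Sigma> x c) (axis \<mu> 1))" for x c \<mu> by (rule symbol1_linear)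
  show "linear (d1_zeroth_order c x)" for c x
    by (rule linearI) (simp_all add: d1_zeroth_order_def scaleR_left_distrib sum.distrib scaleR_sum_right)
  fix c assume c: "c \<in> A"
  note o = open_UNIV
  show "smooth_in c UNIV (\<lambda>x. symbol1 (\<Sigma> x c) (axis \<mu> 1) v)" for \<mu> v
    unfolding symbol1_def outer_def vector_matrix_mult_def vec_lambda_beta
    by (intro smooth_in_arith[OF c o] smooth_in_triple[OF c o])
  show "smooth_in c UNIV (\<lambda>x. d1_zeroth_order c x v)" for v
    unfolding d1_zeroth_order_def gradient_def
    by (intro smooth_in_arith[OF c o] smooth_in_pd[OF c o] section_smooth_in[OF triple_section c o
        order_refl])
qed

lemma d2_S_section:
  "open U \<Longrightarrow> s \<in> sections A (S_bundle A \<Sigma> g) U \<Longrightarrow> d2 A \<Sigma> g s \<in> sections A (E1_bundle A) U"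
  by (rule d2_section[OF _ S_bundle_section_E2])

lemma d2_S_local:
  assumes "open U" "s \<in> sections A (S_bundle A \<Sigma> g) U" "x \<in> U" "c \<in> charts_at A x"
  shows "d2 A \<Sigma> g s x c =
    (\<Sum>\<kappa>\<in>UNIV. connection (\<Sigma> x c) (g x c) (single \<kappa> (pd c \<kappa> (\<lambda>y. s y c) x))) + 0"
proof -
  have "d2 A \<Sigma> g s x c = connection (\<Sigma> x c) (g x c) (gradient s x c)"
    by (rule d2_local[OF assms(1) S_bundle_section_E2[OF assms(2)] assms(3,4)])
  also have "\<dots> = (\<Sum>\<kappa>\<in>UNIV. connection (\<Sigma> x c) (g x c) (single \<kappa> (gradient s x c \<kappa>)))"
    by (rule connection_single_sum[OF triple_quaternionic[OF assms(4)], symmetric])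
  finally show ?thesis by (simp only: gradient_def add_0_right)
qed

lemma linear_zero: "linear (\<lambda>_. 0)"
  by (rule linearI) simp_all

lemma d2_first_order: "first_order_operator A (S_bundle A \<Sigma> g) (E1_bundle A) (d2 A \<Sigma> g)"
proof (rule first_order_operatorI[where b = "\<lambda>_ _ _. 0"
      and a = "\<lambda>c x \<mu> s. connection (\<Sigma> x c) (g x c) (single \<mu> s)"])
  show "d2 A \<Sigma> g s \<in> sections A (E1_bundle A) U" if "open U" "s \<in> sections A (S_bundle A \<Sigma> g) U" for U s
    by (rule d2_S_section[OF that])
  show "d2 A \<Sigma> g s x c =
      (\<Sum>\<mu>\<in>UNIV. connection (\<Sigma> x c) (g x c) (single \<mu> (pd c \<mu> (\<lambda>y. s y c) x))) + 0"
    if "open U" "s \<in> sections A (S_bundle A \<Sigma> g) U" "x \<in> U" "c \<in> charts_at A x" for U s x c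
    by (rule d2_S_local[OF that])
  show "linear (\<lambda>s. connection (\<Sigma> x c) (g x c) (single \<mu> s))" if "c \<in> charts_at A x" for x c \<mu>
    by (rule connection_single_linear[OF triple_quaternionic[OF that]])
  show "linear (\<lambda>_. 0)" by (rule linear_zero)
  fix c assume c: "c \<in> A"
  show "smooth_in c UNIV (\<lambda>x. connection (\<Sigma> x c) (g x c) (single \<mu> v))" for \<mu> v
    by (rule smooth_in_connection[OF c open_UNIV]) (rule smooth_in_const[OF c open_UNIV])
  show "smooth_in c UNIV (\<lambda>x. 0)" by (rule smooth_in_const[OF c open_UNIV])
qed

lemma d3_first_order: "first_order_operator A (E1_bundle A) (E_bundle A) (d3 A \<Sigma>)"
proof (rule first_order_operatorI[where a = "\<lambda>c x \<mu>. symbol3 (\<Sigma> x c) (axis \<mu> 1)" and b = "\<lambda>_ _ _. 0"])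
  show "d3 A \<Sigma> s \<in> sections A (E_bundle A) U" if "open U" "s \<in> sections A (E1_bundle A) U" for U s
    by (rule d3_section[OF that])
  show "d3 A \<Sigma> s x c = (\<Sum>\<mu>\<in>UNIV. symbol3 (\<Sigma> x c) (axis \<mu> 1) (pd c \<mu> (\<lambda>y. s y c) x)) + 0"
    if "open U" "s \<in> sections A (E1_bundle A) U" "x \<in> U" "c \<in> charts_at A x" for U s x c
    unfolding d3_local[OF that] by simp
  show "linear (symbol3 (\<Sigma> x c) (axis \<mu> 1))" for x c \<mu> by (rule symbol3_linear)
  show "linear (\<lambda>_. 0)" by (rule linear_zero)
  fix c assume c: "c \<in> A"
  have ch: "c \<in> charts_at A x" if "x \<in> dom_of c" for x using c that by (simp add: charts_at_def)
  note o = open_UNIV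
  show "smooth_in c UNIV (\<lambda>x. symbol3 (\<Sigma> x c) (axis \<mu> 1) v)" for \<mu> v
    unfolding symbol3_def wedge22_def
    by (intro smooth_in_arith[OF c o] smooth_in_divide[OF c o] smooth_in_triple[OF c o]
        smooth_in_vol[OF c o] triple_vol_nonzero ch)
  show "smooth_in c UNIV (\<lambda>x. 0)" by (rule smooth_in_const[OF c o])
qed

text \<open>For \<open>\<sigma> = d(\<xi> \<lrcorner> \<Sigma>)\<close> the 3-form \<open>d\<sigma>\<close> vanishes since partial derivatives commute, and then \<open>a = 0\<close> solves the
  equation for \<open>d2 \<sigma>\<close>.\<close>

lemma d2_d1_eq_zero:
  assumes U: "open U" and \<xi>: "\<xi> \<in> sections A (TM A) U" and x: "x \<in> U"
  shows "d2 A \<Sigma> g (d1 A \<Sigma> \<xi>) x = (\<lambda>_. 0)"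
proof
  fix c
  show "d2 A \<Sigma> g (d1 A \<Sigma> \<xi>) x c = 0"
  proof (cases "c \<in> charts_at A x")
    case False
    then show ?thesis by (simp add: d2_def)
  next
    case c: True
    note C = charts_at_D[OF c]
    define b where "b = interior_product \<xi> \<Sigma>"
    have b: "b \<in> sections A (E1_bundle A) U" unfolding b_def by (rule interior_product_section[OF U \<xi>])
    have s: "ext_d A b \<in> sections A (E2_bundle A) U" by (rule ext_d_section[OF U b])
    have sb: "smooth_in c U (\<lambda>y. b y c $ i $ \<nu>)" for i \<nu>
      by (intro smooth_in_nth[OF C(1) U] section_smooth_in[OF b C(1) U order_refl])
    note dpd = smooth_in_diff_at[OF C(1) U smooth_in_pd[OF C(1) U sb] C(2) x]
    have g: "gradient (ext_d A b) x c \<alpha> $ i $ \<mu> $ \<nu> =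
        pd c \<alpha> (pd c \<mu> (\<lambda>y. b y c $ i $ \<nu>)) x - pd c \<alpha> (pd c \<nu> (\<lambda>y. b y c $ i $ \<mu>)) x" for i \<alpha> \<mu> \<nu>
    proof -
      have "gradient (ext_d A b) x c \<alpha> $ i $ \<mu> $ \<nu> =
          pd c \<alpha> (\<lambda>y. pd c \<mu> (\<lambda>y. b y c $ i $ \<nu>) y - pd c \<nu> (\<lambda>y. b y c $ i $ \<mu>) y) x"
        unfolding gradient_nth(1)[OF U s x c]
        by (rule pd_cong(1)[OF C(1) U diff_at_diff[OF dpd dpd] C(2) x])
          (simp add: ext_d_def charts_at_def C(1))
      then show ?thesis using pd_diff[OF dpd dpd] by simp
    qed
    have "cyclic (gradient (ext_d A b) x c) i \<mu> \<nu> \<rho> = 0" for i \<mu> \<nu> \<rho>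
      unfolding cyclic_def g
      using pd_commute[OF C(1) U sb C(2) x, of \<mu> \<nu> i \<rho>] pd_commute[OF C(1) U sb C(2) x, of \<mu> \<rho> i \<nu>]
        pd_commute[OF C(1) U sb C(2) x, of \<nu> \<rho> i \<mu>] by linarith
    then have "connection_eq (\<Sigma> x c) (cyclic (gradient (ext_d A b) x c)) 0"
      by (simp add: connection_eq_def wedge12_def)
    then have "0 = d2 A \<Sigma> g (ext_d A b) x c" using d2_iff[OF U s x c] by blast
    then show ?thesis by (simp add: d1_def b_def)
  qed
qed

end

text \<open>If \<open>B \<tau>\<close> is the derivative of a 1-form \<open>a\<close> in direction \<open>\<tau>\<close>, this and the next lemma are the two parts of
  \<open>d(a \<and> S) = da \<and> S - a \<and> dS\<close>; the second one vanishes for closed \<open>S\<close>.\<close>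

lemma wedge12_curl:
  fixes B :: "4 \<Rightarrow> real^4"
  assumes "antisymmetric S"
  shows "wedge12 (B 1) S 2 3 4 - wedge12 (B 2) S 1 3 4 + wedge12 (B 3) S 1 2 4 - wedge12 (B 4) S 1 2 3 =
    top_wedge (\<chi> \<mu> \<nu>. B \<mu> $ \<nu> - B \<nu> $ \<mu>) S"
proof -
  have e: "S$4$2 = - S$2$4" "S$4$1 = - S$1$4" "S$3$1 = - S$1$3" by (rule antisymmetric_nth[OF assms])+
  show ?thesis unfolding wedge12_def wedge22_def vec_lambda_beta e by (simp add: algebra_simps)
qed

lemma wedge12_closed:
  fixes H :: "4 \<Rightarrow> real^4^4"
  assumes anti: "\<And>\<mu>. antisymmetric (H \<mu>)" and closed: "\<And>\<mu> \<nu> \<rho>. H \<mu> $ \<nu> $ \<rho> + H \<nu> $ \<rho> $ \<mu> + H \<rho> $ \<mu> $ \<nu> = 0"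
  shows "wedge12 a (H 1) 2 3 4 - wedge12 a (H 2) 1 3 4 + wedge12 a (H 3) 1 2 4 - wedge12 a (H 4) 1 2 3 = 0"
proof -
  have e: "H \<mu>$4$1 = - H \<mu>$1$4" "H \<mu>$4$2 = - H \<mu>$2$4" "H \<mu>$4$3 = - H \<mu>$3$4" "H \<mu>$3$1 = - H \<mu>$1$3"
    "H \<mu>$2$1 = - H \<mu>$1$2" "H \<mu>$3$2 = - H \<mu>$2$3" for \<mu>
    by (rule antisymmetric_nth[OF anti])+
  have "wedge12 a (H 1) 2 3 4 - wedge12 a (H 2) 1 3 4 + wedge12 a (H 3) 1 2 4 - wedge12 a (H 4) 1 2 3 =
    - a$1 * (H 2 $ 3 $ 4 + H 3 $ 4 $ 2 + H 4 $ 2 $ 3) + a$2 * (H 1 $ 3 $ 4 + H 3 $ 4 $ 1 + H 4 $ 1 $ 3)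
    - a$3 * (H 1 $ 2 $ 4 + H 2 $ 4 $ 1 + H 4 $ 1 $ 2) + a$4 * (H 1 $ 2 $ 3 + H 2 $ 3 $ 1 + H 3 $ 1 $ 2)"
    unfolding wedge12_def e by (simp add: algebra_simps)
  then show ?thesis unfolding closed by simp
qed

context hyperkaehler_triple
begin

text \<open>The equation for \<open>a = d2 s\<close> holds near \<open>x\<close>, so it may be differentiated. The alternating sum of the derivatives
  of \<open>d\<sigma>\<close> vanishes, and that of \<open>a\<^sup>j \<and> \<Sigma>\<^sup>k\<close> leaves \<open>da\<^sup>j \<and> \<Sigma>\<^sup>k\<close> because \<open>\<Sigma>\<^sup>k\<close> is closed.\<close>

lemma d3_d2_eq_zero:
  assumes U: "open U" and s: "s \<in> sections A (E2_bundle A) U" and x: "x \<in> U"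
  shows "d3 A \<Sigma> (d2 A \<Sigma> g s) x = (\<lambda>_. 0)"
proof
  fix c
  show "d3 A \<Sigma> (d2 A \<Sigma> g s) x c = 0"
  proof (cases "c \<in> charts_at A x")
    case False
    then show ?thesis by (simp add: d3_def)
  next
    case c: True
    note C = charts_at_D[OF c]
    define a where "a = d2 A \<Sigma> g s"
    have a: "a \<in> sections A (E1_bundle A) U" unfolding a_def by (rule d2_section[OF U s])
    have da: "diff_at c x (\<lambda>y. a y c $ i $ \<mu>)" for i \<mu>
      by (rule smooth_in_diff_at[OF C(1) U smooth_in_nth[OF C(1) U smooth_in_nth[OF C(1) U
              section_smooth_in[OF a C(1) U order_refl]]] C(2) x])
    note G = gradient_nth[OF open_UNIV triple_section UNIV_I c]
    note Ganti = gradient_antisymmetric[OF open_UNIV triple_section UNIV_I c]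
    have ss: "smooth_in c U (\<lambda>y. s y c $ i $ \<mu> $ \<nu>)" for i \<mu> \<nu>
      by (intro smooth_in_nth[OF C(1) U] section_smooth_in[OF s C(1) U order_refl])
    note dpd = smooth_in_diff_at[OF C(1) U smooth_in_pd[OF C(1) U ss] C(2) x]
    define P where "P \<tau> \<mu> i \<nu> \<rho> = pd c \<tau> (pd c \<mu> (\<lambda>y. s y c $ i $ \<nu> $ \<rho>)) x" for \<tau> \<mu> i \<nu> \<rho>
    have Pcomm: "P \<tau> \<mu> i \<nu> \<rho> = P \<mu> \<tau> i \<nu> \<rho>" for \<tau> \<mu> i \<nu> \<rho>
      unfolding P_def by (rule pd_commute[OF C(1) U ss C(2) x])
    have ch: "c \<in> charts_at A y" if "y \<in> dom_of c" for y using C(1) that by (simp add: charts_at_def)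
    have Panti: "P \<tau> \<mu> i \<nu> \<rho> = - P \<tau> \<mu> i \<rho> \<nu>" for \<tau> \<mu> i \<nu> \<rho>
    proof -
      have "P \<tau> \<mu> i \<nu> \<rho> = pd c \<tau> (\<lambda>y. - pd c \<mu> (\<lambda>y. s y c $ i $ \<rho> $ \<nu>) y) x"
        unfolding P_def
      proof (rule pd_cong(1)[OF C(1) U diff_at_minus[OF dpd] C(2) x])
        fix y assume y: "y \<in> dom_of c" "y \<in> U"
        show "- pd c \<mu> (\<lambda>y. s y c $ i $ \<rho> $ \<nu>) y = pd c \<mu> (\<lambda>y. s y c $ i $ \<nu> $ \<rho>) y"
          using antisymmetric_nth[OF gradient_antisymmetric[OF U s y(2) ch[OF y(1)]], of \<mu> i \<nu> \<rho>]
          unfolding gradient_nth(1)[OF U s y(2) ch[OF y(1)]] by simp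
      qed
      then show ?thesis by (simp add: P_def pd_minus dpd)
    qed
    \<comment> \<open>\<open>T\<close> and \<open>W\<close> are the two terms of the equation for \<open>a\<close>, as functions near \<open>x\<close>\<close>
    define T where "T i \<mu> \<nu> \<rho> y = pd c \<mu> (\<lambda>y. s y c $ i $ \<nu> $ \<rho>) y + pd c \<nu> (\<lambda>y. s y c $ i $ \<rho> $ \<mu>) y
        + pd c \<rho> (\<lambda>y. s y c $ i $ \<mu> $ \<nu>) y" for i \<mu> \<nu> \<rho> y
    define W where "W i \<mu> \<nu> \<rho> y = (\<Sum>j\<in>UNIV. \<Sum>k\<in>UNIV. eps i j k * wedge12 (a y c $ j) (\<Sigma> y c $ k) \<mu> \<nu> \<rho>)" for i \<mu> \<nu> \<rho> y
    have pdT: "pd c \<tau> (T i \<mu> \<nu> \<rho>) x = P \<tau> \<mu> i \<nu> \<rho> + P \<tau> \<nu> i \<rho> \<mu> + P \<tau> \<rho> i \<mu> \<nu>"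
      and dT: "diff_at c x (T i \<mu> \<nu> \<rho>)" for i \<mu> \<nu> \<rho> \<tau>
      unfolding T_def P_def by (simp_all add: pd_add diff_at_add dpd)
    define B where "B j \<tau> = (\<chi> \<mu>. pd c \<tau> (\<lambda>y. a y c $ j $ \<mu>) x)" for j \<tau>
    have pdw: "pd c \<tau> (\<lambda>y. wedge12 (a y c $ j) (\<Sigma> y c $ k) \<mu> \<nu> \<rho>) x =
        wedge12 (B j \<tau>) (\<Sigma> x c $ k) \<mu> \<nu> \<rho> + wedge12 (a x c $ j) (gradient \<Sigma> x c \<tau> $ k) \<mu> \<nu> \<rho>"
      and dw: "diff_at c x (\<lambda>y. wedge12 (a y c $ j) (\<Sigma> y c $ k) \<mu> \<nu> \<rho>)" for j k \<mu> \<nu> \<rho> \<tau>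
      unfolding wedge12_def
      by (simp_all add: pd_add diff_at_add diff_at_mult da G(2) pd_mult[OF da G(2) chart_inv_coord[OF C]]
          B_def G(1))
    have pdW: "pd c \<tau> (W i \<mu> \<nu> \<rho>) x = (\<Sum>j\<in>UNIV. \<Sum>k\<in>UNIV. eps i j k *
        (wedge12 (B j \<tau>) (\<Sigma> x c $ k) \<mu> \<nu> \<rho> + wedge12 (a x c $ j) (gradient \<Sigma> x c \<tau> $ k) \<mu> \<nu> \<rho>))"
      and dW: "diff_at c x (W i \<mu> \<nu> \<rho>)" for i \<mu> \<nu> \<rho> \<tau>
      unfolding W_def
      by (simp_all add: pd_sum diff_at_sum diff_at_linear[OF bounded_linear_mult_right]
          pd_linear[OF bounded_linear_mult_right] dw pdw)
    have TW: "pd c \<tau> (T i \<mu> \<nu> \<rho>) x + pd c \<tau> (W i \<mu> \<nu> \<rho>) x = 0" for i \<mu> \<nu> \<rho> \<tau>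
    proof -
      have "pd c \<tau> (\<lambda>y. T i \<mu> \<nu> \<rho> y + W i \<mu> \<nu> \<rho> y) x = pd c \<tau> (\<lambda>_. 0) x"
      proof (rule pd_cong(1)[OF C(1) U diff_at_const C(2) x])
        fix y assume y: "y \<in> dom_of c" "y \<in> U"
        have "connection_eq (\<Sigma> y c) (cyclic (gradient s y c)) (a y c)"
          using d2_iff[OF U s y(2) ch[OF y(1)]] unfolding a_def by blast
        then show "0 = T i \<mu> \<nu> \<rho> y + W i \<mu> \<nu> \<rho> y"
          unfolding connection_eq_def cyclic_def gradient_nth(1)[OF U s y(2) ch[OF y(1)]] T_def W_def by simp
      qed
      then show ?thesis using pd_add[OF dT dW] by (simp add: pd_const)
    qed
    \<comment> \<open>the second derivatives cancel in pairs, since they commute and \<open>s\<close> is antisymmetric: \<open>d \<circ> d = 0\<close>\<close>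
    have "pd c 1 (T i 2 3 4) x - pd c 2 (T i 1 3 4) x + pd c 3 (T i 1 2 4) x - pd c 4 (T i 1 2 3) x = 0" for i
      unfolding pdT
      using Pcomm[of 2 1 i 3 4] Pcomm[of 3 1 i 4 2] Pcomm[of 4 1 i 2 3] Pcomm[of 3 2 i 4 1] Pcomm[of 4 2 i 1 3]
        Pcomm[of 4 3 i 1 2] Panti[of 1 3 i 4 2] Panti[of 2 4 i 1 3] Panti[of 3 1 i 2 4] Panti[of 4 2 i 3 1]
      by linarith
    then have W0: "pd c 1 (W i 2 3 4) x - pd c 2 (W i 1 3 4) x + pd c 3 (W i 1 2 4) x - pd c 4 (W i 1 2 3) x = 0" for i
      using TW[of 1 i 2 3 4] TW[of 2 i 1 3 4] TW[of 3 i 1 2 4] TW[of 4 i 1 2 3] by (smt (verit))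
    \<comment> \<open>the terms of \<open>a\<^sup>j \<and> d\<Sigma>\<^sup>k\<close>\<close>
    have Gclosed: "wedge12 (a x c $ j) (gradient \<Sigma> x c 1 $ k) 2 3 4 - wedge12 (a x c $ j) (gradient \<Sigma> x c 2 $ k) 1 3 4
        + wedge12 (a x c $ j) (gradient \<Sigma> x c 3 $ k) 1 2 4 - wedge12 (a x c $ j) (gradient \<Sigma> x c 4 $ k) 1 2 3 = 0" for j k
    proof (rule wedge12_closed[of "\<lambda>\<mu>. gradient \<Sigma> x c \<mu> $ k"])
      show "antisymmetric (gradient \<Sigma> x c \<mu> $ k)" for \<mu> by (rule Ganti)
      show "gradient \<Sigma> x c \<mu> $ k $ \<nu> $ \<rho> + gradient \<Sigma> x c \<nu> $ k $ \<rho> $ \<mu> + gradient \<Sigma> x c \<rho> $ k $ \<mu> $ \<nu> = 0" for \<mu> \<nu> \<rho>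
        unfolding G using closed c unfolding closed_triple_def by blast
    qed
    have ext: "ext_d A a x c $ j = (\<chi> \<mu> \<nu>. B j \<mu> $ \<nu> - B j \<nu> $ \<mu>)" for j
      using c by (simp add: ext_d_def B_def)
    have sum0: "(\<Sum>j\<in>UNIV. \<Sum>k\<in>UNIV. eps i j k * top_wedge (ext_d A a x c $ j) (\<Sigma> x c $ k)) = 0" for i
    proof -
      have "(\<Sum>j\<in>UNIV. \<Sum>k\<in>UNIV. eps i j k * top_wedge (ext_d A a x c $ j) (\<Sigma> x c $ k)) =
          (\<Sum>j\<in>UNIV. \<Sum>k\<in>UNIV. eps i j k * (
            (wedge12 (B j 1) (\<Sigma> x c $ k) 2 3 4 + wedge12 (a x c $ j) (gradient \<Sigma> x c 1 $ k) 2 3 4)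
          - (wedge12 (B j 2) (\<Sigma> x c $ k) 1 3 4 + wedge12 (a x c $ j) (gradient \<Sigma> x c 2 $ k) 1 3 4)
          + (wedge12 (B j 3) (\<Sigma> x c $ k) 1 2 4 + wedge12 (a x c $ j) (gradient \<Sigma> x c 3 $ k) 1 2 4)
          - (wedge12 (B j 4) (\<Sigma> x c $ k) 1 2 3 + wedge12 (a x c $ j) (gradient \<Sigma> x c 4 $ k) 1 2 3)))"
      proof (intro sum.cong refl)
        fix j k
        show "eps i j k * top_wedge (ext_d A a x c $ j) (\<Sigma> x c $ k) = eps i j k * (
            (wedge12 (B j 1) (\<Sigma> x c $ k) 2 3 4 + wedge12 (a x c $ j) (gradient \<Sigma> x c 1 $ k) 2 3 4)
          - (wedge12 (B j 2) (\<Sigma> x c $ k) 1 3 4 + wedge12 (a x c $ j) (gradient \<Sigma> x c 2 $ k) 1 3 4)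
          + (wedge12 (B j 3) (\<Sigma> x c $ k) 1 2 4 + wedge12 (a x c $ j) (gradient \<Sigma> x c 3 $ k) 1 2 4)
          - (wedge12 (B j 4) (\<Sigma> x c $ k) 1 2 3 + wedge12 (a x c $ j) (gradient \<Sigma> x c 4 $ k) 1 2 3))"
          unfolding ext wedge12_curl[OF triple_antisymmetric, symmetric]
          using Gclosed[of j k] by (intro arg_cong2[where f = "(*)"] refl) linarith
      qed
      also have "\<dots> = pd c 1 (W i 2 3 4) x - pd c 2 (W i 1 3 4) x + pd c 3 (W i 1 2 4) x - pd c 4 (W i 1 2 3) x"
        unfolding pdW right_diff_distrib distrib_left[of "eps i _ _" "_ - _"] distrib_left[of "eps i _ _" "_ - _ + _"]
        by (simp only: sum.distrib sum_subtractf distrib_left right_diff_distrib)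
      finally show ?thesis using W0 by simp
    qed
    have "\<forall>i. d3 A \<Sigma> a x c $ i = 0"
    proof
      fix i
      have "d3 A \<Sigma> a x c $ i = - (\<Sum>j\<in>UNIV. \<Sum>k\<in>UNIV. eps i j k * top_wedge (ext_d A a x c $ j) (\<Sigma> x c $ k)) / vol (\<Sigma> x c) 1 2 3 4"
      proof -
        have sw: "top_wedge (\<Sigma> x c $ j) \<beta> = top_wedge \<beta> (\<Sigma> x c $ j)" for j \<beta>
          by (rule fun_cong[OF fun_cong[OF fun_cong[OF fun_cong[OF wedge22_commute]]]])
        show ?thesis
          using exhaust_3[of i] c unfolding d3_def sw
          by (elim disjE) (simp_all add: sum_3 eps_def diff_divide_distrib)
      qed
      then show "d3 A \<Sigma> a x c $ i = 0" unfolding sum0 by simp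
    qed
    then show ?thesis by (simp add: a_def vec_eq_iff)
  qed
qed

end

context hyperkaehler_triple
begin

section \<open>The sequence of principal symbols\<close>

lemma fibre_zero_outside:
  "w \<in> E2_bundle A x \<Longrightarrow> c \<notin> charts_at A x \<Longrightarrow> w c = 0"
  "w' \<in> E1_bundle A x \<Longrightarrow> c \<notin> charts_at A x \<Longrightarrow> w' c = 0"
  "w'' \<in> E_bundle A x \<Longrightarrow> c \<notin> charts_at A x \<Longrightarrow> w'' c = 0"
  unfolding E2_bundle_eq E1_bundle_eq E_bundle_def by (auto dest: tensor_fibreD(2))

lemma S_bundle_E2: "s \<in> S_bundle A \<Sigma> g x \<Longrightarrow> s \<in> E2_bundle A x"
  by (simp add: S_bundle_def)

lemma tensor_fibre_scale:
  fixes w :: "'m chart \<Rightarrow> 'v::real_vector"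
  assumes "w \<in> tensor_fibre \<rho> A x" "\<And>J v. \<rho> J (r *\<^sub>R v) = r *\<^sub>R \<rho> J v"
  shows "(\<lambda>c. r *\<^sub>R w c) \<in> tensor_fibre \<rho> A x"
  unfolding tensor_fibre_def mem_Collect_eq
proof (intro conjI ballI allI impI)
  fix c c' assume "c \<in> charts_at A x" "c' \<in> charts_at A x"
  from tensor_fibreD(1)[OF assms(1) this] show "r *\<^sub>R w c = \<rho> (jac c c' x) (r *\<^sub>R w c')"
    unfolding assms(2) by simp
qed (simp add: tensor_fibreD(2)[OF assms(1)])

lemma TM_scale: "w \<in> TM A x \<Longrightarrow> (\<lambda>c. r *\<^sub>R w c) \<in> TM A x"
  unfolding TM_def by (erule tensor_fibre_scale) (simp add: matrix_vector_mult_scaleR)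

lemma E1_scale: "w \<in> E1_bundle A x \<Longrightarrow> (\<lambda>c. r *\<^sub>R w c) \<in> E1_bundle A x"
  unfolding E1_bundle_eq
  by (erule tensor_fibre_scale) (simp add: vec_eq_iff pull1_nth sum_distrib_left mult_ac)

lemma S_scale:
  assumes w: "w \<in> S_bundle A \<Sigma> g x" shows "(\<lambda>c. r *\<^sub>R w c) \<in> S_bundle A \<Sigma> g x"
proof -
  obtain c where c: "c \<in> charts_at A x" by (rule chart_exists)
  have w': "w \<in> tensor_fibre pullE2 A x" "\<And>c i. antisymmetric (w c $ i)" "tangent (\<Sigma> x c) (w c)"
    using w unfolding S_bundle_iff[OF c] E2_bundle_eq by auto
  have "(\<lambda>c. r *\<^sub>R w c) \<in> tensor_fibre pullE2 A x"
    by (rule tensor_fibre_scale[OF w'(1)]) (simp add: vec_eq_iff pull2_nth sum_distrib_left mult_ac)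
  then show ?thesis
    unfolding S_bundle_iff[OF c] E2_bundle_eq using tangent_scale[OF w'(3)] antisymmetric_scale[OF w'(2)] by simp
qed

text \<open>Unlike the other bundles, \<open>S\<close> is not given by a transformation law alone: constant components would leave it.
  Instead the tensor \<open>h\<close> is kept constant in a chart, while the triple and the metric vary.\<close>

lemma local_sections_S: "local_sections (S_bundle A \<Sigma> g)"
  unfolding local_sections_def
proof (intro allI ballI)
  fix x s assume s: "s \<in> S_bundle A \<Sigma> g x"
  obtain c0 where c0: "c0 \<in> charts_at A x" by (rule chart_exists)
  note C0 = charts_at_D[OF c0]
  note o = open_dom[OF C0(1)]
  from s obtain h where h: "\<And>i. s c0 $ i = (1/2) *\<^sub>R (h ** matrix_inv (g x c0) ** \<Sigma> x c0 $ i
      - transpose (h ** matrix_inv (g x c0) ** \<Sigma> x c0 $ i))"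
    unfolding S_bundle_iff[OF c0] tangent_iff[OF triple_quaternionic[OF c0]] by blast
  let ?f = "\<lambda>y c h i. (1/2) *\<^sub>R (h ** matrix_inv (g y c) ** \<Sigma> y c $ i - transpose (h ** matrix_inv (g y c) ** \<Sigma> y c $ i))"
  define t where "t y = extend_tensor pullE2 A c0 (\<chi> i. ?f y c0 h i) y" for y
  have t: "t y c = (\<chi> i. ?f y c (pull2 (jac c c0 y) h) i)" if "c \<in> charts_at A y" "c0 \<in> charts_at A y" for y c
  proof -
    have "t y c $ i = ?f y c (pull2 (jac c c0 y) h) i" for i
      using that unfolding t_def extend_tensor_def
      by (simp only: if_True vec_lambda_beta pull2_half_antisymmetrization
          pull2_mult_inverse[OF jac_invertible_at[OF that] quaternionicD(5)[OF triple_quaternionic[OF that(2)]]]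
          triple_transform[OF that] metric_transform[OF that])
    then show ?thesis by (simp add: vec_eq_iff)
  qed
  have "t \<in> sections A (S_bundle A \<Sigma> g) (dom_of c0)"
    unfolding sections_iff
  proof (intro conjI ballI)
    fix y assume "y \<in> dom_of c0"
    then have y: "c0 \<in> charts_at A y" using C0(1) by (simp add: charts_at_def)
    have t0: "t y c0 = (\<chi> i. ?f y c0 h i)"
      unfolding t_def by (rule extend_tensor_fibre(2)[OF representation_pullE2 y])
    then have tan: "tangent (\<Sigma> y c0) (t y c0)"
      unfolding tangent_iff[OF triple_quaternionic[OF y]] by (intro exI[of _ h]) simp
    have "antisymmetric (t y c $ i)" for c i
    proof (cases "c \<in> charts_at A y")
      case True
      have "t y c = pullE2 (jac c c0 y) (t y c0)"
        using True t0 by (simp add: t_def extend_tensor_def)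
      then show ?thesis using tan by (simp add: tangent_def pull2_antisymmetric)
    next
      case False
      then show ?thesis by (simp add: t_def extend_tensor_def vec_eq_iff transpose_def)
    qed
    moreover have "t y \<in> tensor_fibre pullE2 A y"
      unfolding t_def by (rule extend_tensor_fibre(1)[OF representation_pullE2 y])
    ultimately show "t y \<in> S_bundle A \<Sigma> g y"
      unfolding S_bundle_iff[OF y] E2_bundle_eq using tan by simp
  next
    fix c assume c: "c \<in> A"
    have sm: "smooth_in c (dom_of c0) (\<lambda>y. (pull2 (jac c c0 y) h ** matrix_inv (g y c) ** \<Sigma> y c $ i) $ \<mu> $ \<nu>)" for i \<mu> \<nu>
      unfolding matrix_matrix_mult_def vec_lambda_beta
      by (intro smooth_in_arith[OF c o] smooth_in_pull2_jac[OF c C0(1)] smooth_in_metric_inv[OF c o]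
        smooth_in_triple[OF c o])
    have "smooth_in c (dom_of c0) (\<lambda>y. \<chi> i \<mu> \<nu>. (1/2) * ((pull2 (jac c c0 y) h ** matrix_inv (g y c) ** \<Sigma> y c $ i) $ \<mu> $ \<nu>
        - (pull2 (jac c c0 y) h ** matrix_inv (g y c) ** \<Sigma> y c $ i) $ \<nu> $ \<mu>))"
      by (intro smooth_in_arith[OF c o] sm)
    then show "smooth_in c (dom_of c0) (\<lambda>y. t y c)"
      by (rule smooth_in_cong[OF c o]) (simp add: t charts_at_def c C0(1) vec_eq_iff transpose_def)
  qed
  moreover have "t x = s"
  proof (rule tensor_fibre_eqI[OF _ _ c0])
    show "t x \<in> tensor_fibre pullE2 A x"
      unfolding t_def by (rule extend_tensor_fibre(1)[OF representation_pullE2 c0])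
    show "s \<in> tensor_fibre pullE2 A x" using S_bundle_E2[OF s] by (simp add: E2_bundle_eq)
    show "t x c0 = s c0"
      using h unfolding t_def extend_tensor_fibre(2)[OF representation_pullE2 c0] by (simp add: vec_eq_iff)
  qed
  ultimately show "\<exists>U t. open U \<and> x \<in> U \<and> t \<in> sections A (S_bundle A \<Sigma> g) U \<and> t x = s"
    using o C0(2) by blast
qed

lemma
  assumes k: "k \<in> T_dual A x" and v: "v \<in> TM A x"
  shows principal_symbol_d1: "principal_symbol A (TM A) (d1 A \<Sigma>) x k v =
      (\<lambda>c. if c \<in> charts_at A x then symbol1 (\<Sigma> x c) (k c) (v c) else 0)"
    and principal_symbol_d1_fibre: "principal_symbol A (TM A) (d1 A \<Sigma>) x k v \<in> S_bundle A \<Sigma> g x"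
proof -
  have z: "d1_zeroth_order c x 0 = 0" for c by (simp add: d1_zeroth_order_def)
  note P = d1_section d1_local[where x = x] z fibre_zero_outside(1)[OF S_bundle_E2] TM_scale local_sections_TM v k
  show "principal_symbol A (TM A) (d1 A \<Sigma>) x k v =
      (\<lambda>c. if c \<in> charts_at A x then symbol1 (\<Sigma> x c) (k c) (v c) else 0)"
    by (subst principal_symbol_eq[where G = "S_bundle A \<Sigma> g" and b = "\<lambda>c. d1_zeroth_order c x"
          and a = "\<lambda>c \<mu>. symbol1 (\<Sigma> x c) (axis \<mu> 1)"]; (rule P)?)
      (simp_all only: symbol1_axis_sum)
  show "principal_symbol A (TM A) (d1 A \<Sigma>) x k v \<in> S_bundle A \<Sigma> g x"
    by (rule principal_symbol_fibre[where G = "S_bundle A \<Sigma> g" and b = "\<lambda>c. d1_zeroth_order c x"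
          and a = "\<lambda>c \<mu>. symbol1 (\<Sigma> x c) (axis \<mu> 1)"]; rule P)
qed

lemma
  assumes k: "k \<in> T_dual A x" and s: "s \<in> S_bundle A \<Sigma> g x"
  shows principal_symbol_d2: "c \<in> charts_at A x \<Longrightarrow>
      principal_symbol A (S_bundle A \<Sigma> g) (d2 A \<Sigma> g) x k s c = a \<longleftrightarrow>
      connection_eq (\<Sigma> x c) (\<lambda>i. wedge12 (k c) (s c $ i)) a"
    and principal_symbol_d2_fibre: "principal_symbol A (S_bundle A \<Sigma> g) (d2 A \<Sigma> g) x k s \<in> E1_bundle A x"
proof -
  note P = d2_S_section d2_S_local[where x = x] refl fibre_zero_outside(2) S_scale local_sections_S s k
  have e: "principal_symbol A (S_bundle A \<Sigma> g) (d2 A \<Sigma> g) x k s =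
      (\<lambda>c. if c \<in> charts_at A x then \<Sum>\<mu>\<in>UNIV. connection (\<Sigma> x c) (g x c) (single \<mu> (k c $ \<mu> *\<^sub>R s c)) else 0)"
    by (rule principal_symbol_eq[where G = "E1_bundle A" and b = "\<lambda>_ _. 0"
          and a = "\<lambda>c \<mu> s. connection (\<Sigma> x c) (g x c) (single \<mu> s)"]; rule P)
  show "principal_symbol A (S_bundle A \<Sigma> g) (d2 A \<Sigma> g) x k s \<in> E1_bundle A x"
    by (rule principal_symbol_fibre[where G = "E1_bundle A" and b = "\<lambda>_ _. 0"
          and a = "\<lambda>c \<mu> s. connection (\<Sigma> x c) (g x c) (single \<mu> s)"]; rule P)
  assume c: "c \<in> charts_at A x"
  have "antisymmetric (s c $ i)" for i
    using S_bundle_E2[OF s] unfolding E2_bundle_eq by blast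
  then have anti: "antisymmetric ((k c $ \<alpha> *\<^sub>R s c) $ i)" for \<alpha> i
    by (simp add: antisymmetric_scale)
  have "cyclic (\<lambda>\<alpha>. k c $ \<alpha> *\<^sub>R s c) = (\<lambda>i. wedge12 (k c) (s c $ i))"
    by (simp add: fun_eq_iff cyclic_def wedge12_def)
  with connection_eq_iff[OF triple_quaternionic[OF c] triple_self_dual[OF c], of "\<lambda>\<alpha>. k c $ \<alpha> *\<^sub>R s c" a, OF anti]
  have "connection_eq (\<Sigma> x c) (\<lambda>i. wedge12 (k c) (s c $ i)) a \<longleftrightarrow> a = connection (\<Sigma> x c) (g x c) (\<lambda>\<alpha>. k c $ \<alpha> *\<^sub>R s c)"
    by simp
  then show "principal_symbol A (S_bundle A \<Sigma> g) (d2 A \<Sigma> g) x k s c = a \<longleftrightarrow>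
      connection_eq (\<Sigma> x c) (\<lambda>i. wedge12 (k c) (s c $ i)) a"
    unfolding e using c connection_single_sum[OF triple_quaternionic[OF c], of "\<lambda>\<alpha>. k c $ \<alpha> *\<^sub>R s c"] by auto
qed

lemma
  assumes k: "k \<in> T_dual A x" and a: "a \<in> E1_bundle A x"
  shows principal_symbol_d3: "principal_symbol A (E1_bundle A) (d3 A \<Sigma>) x k a =
      (\<lambda>c. if c \<in> charts_at A x then symbol3 (\<Sigma> x c) (k c) (a c) else 0)"
    and principal_symbol_d3_fibre: "principal_symbol A (E1_bundle A) (d3 A \<Sigma>) x k a \<in> E_bundle A x"
proof -
  have l: "d3 A \<Sigma> a x c = (\<Sum>\<kappa>\<in>UNIV. symbol3 (\<Sigma> x c) (axis \<kappa> 1) (pd c \<kappa> (\<lambda>y. a y c) x)) + 0"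
    if "open U" "a \<in> sections A (E1_bundle A) U" "x \<in> U" "c \<in> charts_at A x" for U a c
    unfolding d3_local[OF that] by simp
  note P = d3_section l refl fibre_zero_outside(3) E1_scale local_sections_E1 a k
  show "principal_symbol A (E1_bundle A) (d3 A \<Sigma>) x k a =
      (\<lambda>c. if c \<in> charts_at A x then symbol3 (\<Sigma> x c) (k c) (a c) else 0)"
    by (subst principal_symbol_eq[where G = "E_bundle A" and b = "\<lambda>_ _. 0"
          and a = "\<lambda>c \<mu>. symbol3 (\<Sigma> x c) (axis \<mu> 1)"]; (rule P)?)
      (simp_all only: symbol3_axis_sum)
  show "principal_symbol A (E1_bundle A) (d3 A \<Sigma>) x k a \<in> E_bundle A x"
    by (rule principal_symbol_fibre[where G = "E_bundle A" and b = "\<lambda>_ _. 0"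
          and a = "\<lambda>c \<mu>. symbol3 (\<Sigma> x c) (axis \<mu> 1)"]; rule P)
qed

text \<open>Tensors at \<open>x\<close> are determined by their components in one chart, and arbitrary components in that chart extend
  to a tensor; so exactness can be checked on components.\<close>

lemma symbol_sequence_exact:
  assumes k: "k \<in> T_dual A x" and k0: "k \<noteq> (\<lambda>_. 0)"
  defines "\<sigma>1 \<equiv> principal_symbol A (TM A) (d1 A \<Sigma>) x k"
    and "\<sigma>2 \<equiv> principal_symbol A (S_bundle A \<Sigma> g) (d2 A \<Sigma> g) x k"
    and "\<sigma>3 \<equiv> principal_symbol A (E1_bundle A) (d3 A \<Sigma>) x k"
  shows "{v \<in> TM A x. \<sigma>1 v = (\<lambda>_. 0)} = {\<lambda>_. 0}" (is ?inj)
    and "\<sigma>1 ` TM A x = {s \<in> S_bundle A \<Sigma> g x. \<sigma>2 s = (\<lambda>_. 0)}" (is ?exact1)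
    and "\<sigma>2 ` S_bundle A \<Sigma> g x = {a \<in> E1_bundle A x. \<sigma>3 a = (\<lambda>_. 0)}" (is ?exact2)
    and "\<sigma>3 ` E1_bundle A x = E_bundle A x" (is ?surj)
proof -
  note \<sigma>1 = principal_symbol_d1[OF k, folded \<sigma>1_def] principal_symbol_d1_fibre[OF k, folded \<sigma>1_def]
  note \<sigma>2 = principal_symbol_d2[OF k, folded \<sigma>2_def] principal_symbol_d2_fibre[OF k, folded \<sigma>2_def]
  note \<sigma>3 = principal_symbol_d3[OF k, folded \<sigma>3_def] principal_symbol_d3_fibre[OF k, folded \<sigma>3_def]
  obtain c where c: "c \<in> charts_at A x" by (rule chart_exists)
  note q = triple_quaternionic[OF c] and kc = covector_nonzero_at[OF k k0]
  have TM0: "(\<lambda>_. 0) \<in> TM A x" unfolding TM_def by (rule tensor_fibre_zero) simp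
  show ?inj
  proof (intro equalityI subsetI)
    fix v assume "v \<in> {v \<in> TM A x. \<sigma>1 v = (\<lambda>_. 0)}"
    then have v: "v \<in> TM A x" and "\<sigma>1 v c = 0" by auto
    then have "symbol1 (\<Sigma> x c) (k c) (v c) = 0" using \<sigma>1(1)[OF v] c by simp
    then have "v c = 0" by (rule symbol1_injective[OF q kc[OF c]])
    then have "v = (\<lambda>_. 0)" using tensor_fibre_eqI[OF v[unfolded TM_def] TM0[unfolded TM_def] c] by simp
    then show "v \<in> {\<lambda>_. 0}" by simp
  next
    fix v :: "'m chart \<Rightarrow> real^4" assume "v \<in> {\<lambda>_. 0}"
    then have v: "v = (\<lambda>_. 0)" by simp
    have "\<sigma>1 (\<lambda>_. 0) = (\<lambda>_. 0)"
      unfolding \<sigma>1(1)[OF TM0] linear_0[OF symbol1_linear] by simp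
    then show "v \<in> {v \<in> TM A x. \<sigma>1 v = (\<lambda>_. 0)}"
      using TM0 unfolding v by blast
  qed
  show ?exact1
  proof (intro equalityI subsetI)
    fix s assume "s \<in> \<sigma>1 ` TM A x"
    then obtain v where v: "v \<in> TM A x" and s: "s = \<sigma>1 v" by blast
    have S: "s \<in> S_bundle A \<Sigma> g x" unfolding s by (rule \<sigma>1(2)[OF v])
    have "\<sigma>2 s c = 0" for c
    proof (cases "c \<in> charts_at A x")
      case True
      then have "s c = symbol1 (\<Sigma> x c) (k c) (v c)" unfolding s \<sigma>1(1)[OF v] by simp
      then show ?thesis
        unfolding \<sigma>2(1)[OF S True] by (simp add: connection_eq_def symbol1_closed) (simp add: wedge12_def)
    next
      case False
      then show ?thesis by (rule fibre_zero_outside(2)[OF \<sigma>2(2)[OF S]])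
    qed
    then show "s \<in> {s \<in> S_bundle A \<Sigma> g x. \<sigma>2 s = (\<lambda>_. 0)}" using S by auto
  next
    fix s assume "s \<in> {s \<in> S_bundle A \<Sigma> g x. \<sigma>2 s = (\<lambda>_. 0)}"
    then have s: "s \<in> S_bundle A \<Sigma> g x" and "\<sigma>2 s c = 0" by auto
    then have "connection_eq (\<Sigma> x c) (\<lambda>i. wedge12 (k c) (s c $ i)) 0" using \<sigma>2(1)[OF s c] by blast
    then have w: "wedge12 (k c) (s c $ i) \<mu> \<nu> \<rho> = 0" for i \<mu> \<nu> \<rho>
      unfolding connection_eq_def by (simp add: wedge12_def[of "0::real^4"])
    have "tangent (\<Sigma> x c) (s c)" using s S_bundle_iff[OF c] by blast
    from symbol1_surjective[OF q kc[OF c] this w] obtain v0 where v0: "s c = symbol1 (\<Sigma> x c) (k c) v0" by blast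
    define v where "v = extend_tensor (\<lambda>J v. matrix_inv J *v v) A c v0 x"
    have v: "v \<in> TM A x" "v c = v0"
      unfolding v_def TM_def using extend_tensor_fibre[OF representation_vector c] by blast+
    have "s = \<sigma>1 v"
    proof (rule tensor_fibre_eqI[OF _ _ c])
      show "s \<in> tensor_fibre pullE2 A x" "\<sigma>1 v \<in> tensor_fibre pullE2 A x"
        using S_bundle_E2[OF s] S_bundle_E2[OF \<sigma>1(2)[OF v(1)]] by (simp_all add: E2_bundle_eq)
      show "s c = \<sigma>1 v c" unfolding \<sigma>1(1)[OF v(1)] using c v(2) v0 by simp
    qed
    then show "s \<in> \<sigma>1 ` TM A x" using v(1) by blast
  qed
  show ?exact2
  proof (intro equalityI subsetI)
    fix a assume "a \<in> \<sigma>2 ` S_bundle A \<Sigma> g x"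
    then obtain s where s: "s \<in> S_bundle A \<Sigma> g x" and a: "a = \<sigma>2 s" by blast
    have E1: "a \<in> E1_bundle A x" unfolding a by (rule \<sigma>2(2)[OF s])
    have "\<sigma>3 a c = 0" for c
    proof (cases "c \<in> charts_at A x")
      case True
      have "connection_eq (\<Sigma> x c) (\<lambda>i. wedge12 (k c) (s c $ i)) (a c)"
        using \<sigma>2(1)[OF s True] a by blast
      from symbol3_connection[OF triple_quaternionic[OF True] kc[OF True] this]
      show ?thesis unfolding \<sigma>3(1)[OF E1] by simp
    next
      case False
      then show ?thesis by (rule fibre_zero_outside(3)[OF \<sigma>3(2)[OF E1]])
    qed
    then show "a \<in> {a \<in> E1_bundle A x. \<sigma>3 a = (\<lambda>_. 0)}" using E1 by auto
  next
    fix a assume "a \<in> {a \<in> E1_bundle A x. \<sigma>3 a = (\<lambda>_. 0)}"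
    then have a: "a \<in> E1_bundle A x" and "\<sigma>3 a c = 0" by auto
    then have "symbol3 (\<Sigma> x c) (k c) (a c) = 0" using \<sigma>3(1)[OF a] c by simp
    from connection_symbol_exact[OF q kc[OF c] this] obtain s0 where s0: "tangent (\<Sigma> x c) s0"
      "connection_eq (\<Sigma> x c) (\<lambda>i. wedge12 (k c) (s0 $ i)) (a c)" by blast
    define s where "s = extend_tensor pullE2 A c s0 x"
    have sc: "s \<in> tensor_fibre pullE2 A x" "s c = s0"
      unfolding s_def using extend_tensor_fibre[OF representation_pullE2 c] by blast+
    have "antisymmetric (s c' $ i)" for c' i
    proof (cases "c' \<in> charts_at A x")
      case True
      then show ?thesis using s0(1) by (simp add: s_def extend_tensor_def tangent_def pull2_antisymmetric)
    next
      case False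
      then show ?thesis by (simp add: s_def extend_tensor_def vec_eq_iff transpose_def)
    qed
    then have s: "s \<in> S_bundle A \<Sigma> g x"
      unfolding S_bundle_iff[OF c] E2_bundle_eq using sc s0(1) by simp
    have "a = \<sigma>2 s"
    proof (rule tensor_fibre_eqI[OF _ _ c])
      show "a \<in> tensor_fibre pullE1 A x" "\<sigma>2 s \<in> tensor_fibre pullE1 A x"
        using a \<sigma>2(2)[OF s] by (simp_all only: E1_bundle_eq)
      show "a c = \<sigma>2 s c" using \<sigma>2(1)[OF s c, of "a c"] s0(2) sc(2) by simp
    qed
    then show "a \<in> \<sigma>2 ` S_bundle A \<Sigma> g x" using s by blast
  qed
  show ?surj
  proof (intro equalityI subsetI)
    show "e \<in> E_bundle A x" if "e \<in> \<sigma>3 ` E1_bundle A x" for e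
      using that \<sigma>3(2) by blast
  next
    fix e assume e: "e \<in> E_bundle A x"
    obtain a0 where a0: "symbol3 (\<Sigma> x c) (k c) a0 = e c" using symbol3_surjective[OF q kc[OF c]] by blast
    define a where "a = extend_tensor pullE1 A c a0 x"
    have a: "a \<in> E1_bundle A x" "a c = a0"
      unfolding a_def E1_bundle_eq using extend_tensor_fibre[OF representation_pullE1 c] by blast+
    have "e = \<sigma>3 a"
    proof (rule tensor_fibre_eqI[OF _ _ c])
      show "e \<in> tensor_fibre (\<lambda>J e. e) A x" "\<sigma>3 a \<in> tensor_fibre (\<lambda>J e. e) A x"
        using e \<sigma>3(2)[OF a(1)] by (simp_all only: E_bundle_def)
      show "e c = \<sigma>3 a c" unfolding \<sigma>3(1)[OF a(1)] using c a(2) a0 by simp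
    qed
    then show "e \<in> \<sigma>3 ` E1_bundle A x" using a(1) by blast
  qed
qed

end

theorem theorem1:
  fixes A :: "'m::{t2_space, second_countable_topology} chart set"
    and \<Sigma> :: "'m \<Rightarrow> 'm chart \<Rightarrow> real^4^4^3"
    and g :: "'m \<Rightarrow> 'm chart \<Rightarrow> real^4^4"
  assumes "smooth_atlas A"
    and "perfect_triple A \<Sigma>"
    and "closed_triple A \<Sigma>"
    and "triple_metric A \<Sigma> g"
  shows "first_order_operator A (TM A) (S_bundle A \<Sigma> g) (d1 A \<Sigma>) \<and>
    first_order_operator A (S_bundle A \<Sigma> g) (E1_bundle A) (d2 A \<Sigma> g) \<and>
    first_order_operator A (E1_bundle A) (E_bundle A) (d3 A \<Sigma>) \<and>
    (\<forall>U. open U \<longrightarrow>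
      (\<forall>\<xi>\<in>sections A (TM A) U. \<forall>x\<in>U. d2 A \<Sigma> g (d1 A \<Sigma> \<xi>) x = (\<lambda>_. 0)) \<and>
      (\<forall>\<sigma>\<in>sections A (S_bundle A \<Sigma> g) U. \<forall>x\<in>U. d3 A \<Sigma> (d2 A \<Sigma> g \<sigma>) x = (\<lambda>_. 0))) \<and>
    (\<forall>x. \<forall>k\<in>T_dual A x. k \<noteq> (\<lambda>_. 0) \<longrightarrow>
      (let \<sigma>1 = principal_symbol A (TM A) (d1 A \<Sigma>) x k;
           \<sigma>2 = principal_symbol A (S_bundle A \<Sigma> g) (d2 A \<Sigma> g) x k;
           \<sigma>3 = principal_symbol A (E1_bundle A) (d3 A \<Sigma>) x k
       in {v \<in> TM A x. \<sigma>1 v = (\<lambda>_. 0)} = {\<lambda>_. 0} \<and>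
          \<sigma>1 ` TM A x = {s \<in> S_bundle A \<Sigma> g x. \<sigma>2 s = (\<lambda>_. 0)} \<and>
          \<sigma>2 ` S_bundle A \<Sigma> g x = {a \<in> E1_bundle A x. \<sigma>3 a = (\<lambda>_. 0)} \<and>
          \<sigma>3 ` E1_bundle A x = E_bundle A x))"
proof -
  interpret hyperkaehler_triple A \<Sigma> g
    using assms by unfold_locales
  show ?thesis
    unfolding Let_def
  proof (intro conjI allI impI ballI)
    show "d2 A \<Sigma> g (d1 A \<Sigma> \<xi>) x = (\<lambda>_. 0)"
      if "open U" "\<xi> \<in> sections A (TM A) U" "x \<in> U" for U \<xi> x
      by (rule d2_d1_eq_zero[OF that])
    show "d3 A \<Sigma> (d2 A \<Sigma> g \<sigma>) x = (\<lambda>_. 0)"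
      if "open U" "\<sigma> \<in> sections A (S_bundle A \<Sigma> g) U" "x \<in> U" for U \<sigma> x
      by (rule d3_d2_eq_zero[OF that(1) S_bundle_section_E2[OF that(2)] that(3)])
  qed (rule d1_first_order d2_first_order d3_first_order symbol_sequence_exact; assumption)+
qed

end
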